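(* Let $K$ be a field, let $a\ge1$, $n\ge1$, $b\ge 3$ be integers, and let $G_{a,b,n}=\overline{K}_a\nabla(nB_b)$. For every $i\ge 1$, $$\beta_{i,i+1}(G_{a,b,n})=n\sum_{j=0}^{i-1}\binom{a}{j}\lambda_{i-j}+\sum_{j=1}^{i}\binom{a}{j}\binom{2bn}{i-j+1}.$$
   Context: All graphs are finite, simple and undirected. For $b\ge 2$, $B_b$ is the graph with vertices $x_1,\dots,x_b,y_1,\dots,y_b$ and edges $\{x_i,x_j\}$ and $\{y_i,y_j\}$ for $1\le i<j\le b$, and $\{x_i,y_i\}$ for $1\le i\le b$. $nB_b$ is the disjoint union of $n$ copies of $B_b$. The join $G\nabla H$ of graphs on disjoint vertex sets is obtained from the disjoint union by adding every edge between $V(G)$ and $V(H)$. $\overline{K}_a$ is the edgeless graph on $a$ vertices. For a graph $G$, $R_G$ is the standard graded polynomial ring over $K$ whose variables are the vertices of $G$, $I(G)=(xy:\{x,y\}\in E(G))\subseteq R_G$ is the edge ideal, and $\beta_{i,d}(G)$ denotes the graded Betti number of $R_G/I(G)$ over $R_G$ in homological degree $i$ and internal degree $d$. For fixed $b\ge3$ the integers $\lambda_i$ are defined as follows, with the convention $\binom{u}{v}=0$ if $v<0$ or $v>u$. For $1\le i\le 2b-2$: $\lambda_1=2\binom{b}{2}+b$; $\lambda_3=6\binom{b}{4}+2b\binom{b-1}{2}+\binom{b}{2}$; and $\lambda_i=2i\binom{b}{i+1}+2b\binom{b-1}{i-1}$ for $i\ne1,3$. Also $\lambda_i=0$ outside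 $1\le i\le 2b-2$. *)

theory Defs
  imports "HOL-Algebra.QuotRing" "HOL-Algebra.Module" "HOL-Library.Poly_Mapping"
begin

section \<open>Graphs\<close>

text \<open>A simple graph is given by its vertices and its edges, an edge being a two-element set of vertices.\<close>

record 'v graph =
  verts :: "'v set"
  edges :: "'v set set"

definition edgeless :: "nat \<Rightarrow> nat graph" where
  "edgeless a = \<lparr>verts = {1..a}, edges = {}\<rparr>"

text \<open>In \<open>B_graph b\<close> the vertex \<open>x\<^sub>i\<close> is \<open>Inl i\<close> and the vertex \<open>y\<^sub>i\<close> is \<open>Inr i\<close>.\<close>

definition B_graph :: "nat \<Rightarrow> (nat + nat) graph" where
  "B_graph b = \<lparr>verts = Inl ` {1..b} \<union> Inr ` {1..b},
     edges = {{Inl i, Inl j} | i j. 1 \<le> i \<and> i < j \<and> j \<le> b}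
           \<union> {{Inr i, Inr j} | i j. 1 \<le> i \<and> i < j \<and> j \<le> b}
           \<union> {{Inl i, Inr i} | i. 1 \<le> i \<and> i \<le> b}\<rparr>"

definition disjoint_copies :: "nat \<Rightarrow> 'v graph \<Rightarrow> (nat \<times> 'v) graph" where
  "disjoint_copies n G = \<lparr>verts = {1..n} \<times> verts G,
     edges = {Pair k ` e | k e. k \<in> {1..n} \<and> e \<in> edges G}\<rparr>"

definition graph_join :: "'v graph \<Rightarrow> 'w graph \<Rightarrow> ('v + 'w) graph"  (infixl \<open>\<nabla>\<close> 65) where
  "G \<nabla> H = \<lparr>verts = Inl ` verts G \<union> Inr ` verts H,
     edges = image Inl ` edges G \<union> image Inr ` edges H
           \<union> {{Inl u, Inr v} | u v. u \<in> verts G \<and> v \<in> verts H}\<rparr>"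


section \<open>The standard graded polynomial ring on a set of variables\<close>

type_synonym ('v, 'k) mpoly = "('v \<Rightarrow>\<^sub>0 nat) \<Rightarrow>\<^sub>0 'k"

definition Var :: "'v \<Rightarrow> ('v, 'k::field) mpoly" where
  "Var x = Poly_Mapping.single (Poly_Mapping.single x 1) 1"

definition mpoly_ring :: "'v set \<Rightarrow> ('v, 'k::field) mpoly ring" where
  "mpoly_ring V = \<lparr>carrier = {p. \<forall>m \<in> Poly_Mapping.keys p. Poly_Mapping.keys m \<subseteq> V},
     mult = (*), one = 1, zero = 0, add = (+)\<rparr>"

definition monomial_degree :: "('v \<Rightarrow>\<^sub>0 nat) \<Rightarrow> nat" where
  "monomial_degree m = (\<Sum>x \<in> Poly_Mapping.keys m. Poly_Mapping.lookup m x)"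

definition homogeneous_part :: "'v set \<Rightarrow> int \<Rightarrow> ('v, 'k::field) mpoly set" where
  "homogeneous_part V e =
     {p \<in> carrier (mpoly_ring V). \<forall>m \<in> Poly_Mapping.keys p. int (monomial_degree m) = e}"

definition irrelevant_ideal :: "'v set \<Rightarrow> ('v, 'k::field) mpoly set" where
  "irrelevant_ideal V = Idl\<^bsub>mpoly_ring V\<^esub> (Var ` V)"


section \<open>Modules\<close>

definition module_hom ::
    "'r ring \<Rightarrow> ('r, 'm) module \<Rightarrow> ('r, 'n) module \<Rightarrow> ('m \<Rightarrow> 'n) set" where
  "module_hom R M N = {f \<in> carrier M \<rightarrow> carrier N.
     (\<forall>x \<in> carrier M. \<forall>y \<in> carrier M. f (x \<oplus>\<^bsub>M\<^esub> y) = f x \<oplus>\<^bsub>N\<^esub> f y) \<and>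
     (\<forall>r \<in> carrier R. \<forall>x \<in> carrier M. f (r \<odot>\<^bsub>M\<^esub> x) = r \<odot>\<^bsub>N\<^esub> f x)}"

text \<open>The residue class ring \<open>R Quot I\<close> as a module over \<open>R\<close>.\<close>

definition quotient_module :: "'r ring \<Rightarrow> 'r set \<Rightarrow> ('r, 'r set) module" where
  "quotient_module R I = ring.extend (R Quot I)
     (module.fields (\<lambda>r X. (I +>\<^bsub>R\<^esub> r) \<otimes>\<^bsub>R Quot I\<^esub> X))"

text \<open>
  The free module with basis indexed by \<open>J\<close>; an element is the finitely supported family of its
  coordinates.  The fields \<open>mult\<close> and \<open>one\<close>, which HOL-Algebra's module records inherit from ring
  records, have no meaning for a module and are filled arbitrarily.
\<close>

definition free_module :: "'v set \<Rightarrow> nat set \<Rightarrow>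
    (('v, 'k::field) mpoly, nat \<Rightarrow>\<^sub>0 ('v, 'k) mpoly) module" where
  "free_module V J =
     \<lparr>carrier = {f. Poly_Mapping.keys f \<subseteq> J \<and>
                    (\<forall>j. Poly_Mapping.lookup f j \<in> carrier (mpoly_ring V))},
      mult = (\<lambda>_ _. 0), one = 0, zero = 0, add = (+),
      smult = (\<lambda>r f. Poly_Mapping.map (\<lambda>p. r * p) f)\<rparr>"

text \<open>
  The component of degree \<open>e\<close> of \<open>\<Oplus>\<^sub>j R(-c j)\<close>, the free module graded so that the
  \<open>j\<close>-th basis element has degree \<open>c j\<close>.
\<close>

definition free_module_part :: "'v set \<Rightarrow> nat set \<Rightarrow> (nat \<Rightarrow> int) \<Rightarrow> int \<Rightarrow>
    (nat \<Rightarrow>\<^sub>0 ('v, 'k::field) mpoly) set" where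
  "free_module_part V J c e =
     {f \<in> carrier (free_module V J).
        \<forall>j. Poly_Mapping.lookup f j \<in> homogeneous_part V (e - c j)}"


section \<open>Minimal graded free resolutions and graded Betti numbers\<close>

text \<open>
  A graded free resolution
  \<open>\<dots> \<rightarrow> F 2 \<rightarrow> F 1 \<rightarrow> F 0 \<rightarrow> M \<rightarrow> 0\<close> of a module \<open>M\<close> over the polynomial ring \<open>R\<close> in the
  variables \<open>V\<close>, where \<open>gr e\<close> is the component of \<open>M\<close> in degree \<open>e\<close>.  The free module \<open>F i\<close> has
  the basis \<open>J i\<close>, whose element \<open>j\<close> has degree \<open>c i j\<close>; \<open>d i\<close> maps \<open>F (i + 1)\<close> to \<open>F i\<close> and
  \<open>\<epsilon>\<close> maps \<open>F 0\<close> to \<open>M\<close>.  Indexing bases by natural numbers is no restriction for finitely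
  generated \<open>M\<close> and finite \<open>V\<close>, where minimal resolutions consist of modules of finite rank.
\<close>

locale graded_free_resolution =
  fixes V :: "'v set"
    and M :: "(('v, 'k::field) mpoly, 'm) module"
    and gr :: "int \<Rightarrow> 'm set"
    and J :: "nat \<Rightarrow> nat set"
    and c :: "nat \<Rightarrow> nat \<Rightarrow> int"
    and d :: "nat \<Rightarrow> (nat \<Rightarrow>\<^sub>0 ('v, 'k) mpoly) \<Rightarrow> (nat \<Rightarrow>\<^sub>0 ('v, 'k) mpoly)"
    and \<epsilon> :: "(nat \<Rightarrow>\<^sub>0 ('v, 'k) mpoly) \<Rightarrow> 'm"
  assumes differential_hom:
      "d i \<in> module_hom (mpoly_ring V) (free_module V (J (i + 1))) (free_module V (J i))"
    and differential_graded:
      "d i ` free_module_part V (J (i + 1)) (c (i + 1)) e \<subseteq> free_module_part V (J i) (c i) e"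
    and augmentation_hom: "\<epsilon> \<in> module_hom (mpoly_ring V) (free_module V (J 0)) M"
    and augmentation_graded: "\<epsilon> ` free_module_part V (J 0) (c 0) e \<subseteq> gr e"
    and exact_at_module: "\<epsilon> ` carrier (free_module V (J 0)) = carrier M"
    and exact_at_0: "d 0 ` carrier (free_module V (J 1)) =
      {x \<in> carrier (free_module V (J 0)). \<epsilon> x = \<zero>\<^bsub>M\<^esub>}"
    and exact_at_Suc: "d (i + 1) ` carrier (free_module V (J (i + 2))) =
      {x \<in> carrier (free_module V (J (i + 1))). d i x = 0}"

text \<open>Minimality: the image of \<open>d i\<close> lies in \<open>\<mm> F i\<close>, where \<open>\<mm>\<close> is the irrelevant ideal.\<close>

locale minimal_graded_free_resolution = graded_free_resolution +
  assumes minimal: "x \<in> carrier (free_module V (J (i + 1))) \<Longrightarrow>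
      Poly_Mapping.lookup (d i x) j \<in> irrelevant_ideal V"

text \<open>
  \<open>betti_number V M gr i e\<close> is the number of copies of \<open>R(-e)\<close> in the \<open>i\<close>-th module of a minimal
  graded free resolution of \<open>M\<close>.
\<close>

definition betti_number :: "'v set \<Rightarrow> (('v, 'k::field) mpoly, 'm) module \<Rightarrow> (int \<Rightarrow> 'm set) \<Rightarrow>
    nat \<Rightarrow> int \<Rightarrow> nat" where
  "betti_number V M gr i e = (THE n. \<exists>J c d \<epsilon>.
     minimal_graded_free_resolution V M gr J c d \<epsilon> \<and>
     finite {j \<in> J i. c i j = e} \<and> n = card {j \<in> J i. c i j = e})"


section \<open>Graded Betti numbers of a graph\<close>

definition edge_ideal :: "'v graph \<Rightarrow> ('v, 'k::field) mpoly set" where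
  "edge_ideal G = Idl\<^bsub>mpoly_ring (verts G)\<^esub> {Var x * Var y | x y. {x, y} \<in> edges G}"

definition edge_ring_module :: "'v graph \<Rightarrow> (('v, 'k::field) mpoly, ('v, 'k) mpoly set) module" where
  "edge_ring_module G = quotient_module (mpoly_ring (verts G)) (edge_ideal G)"

definition edge_ring_part :: "'v graph \<Rightarrow> int \<Rightarrow> ('v, 'k::field) mpoly set set" where
  "edge_ring_part G e =
     (\<lambda>p. edge_ideal G +>\<^bsub>mpoly_ring (verts G)\<^esub> p) ` homogeneous_part (verts G) e"

text \<open>The field is passed as a type argument.\<close>

definition graph_betti :: "'k::field itself \<Rightarrow> 'v graph \<Rightarrow> nat \<Rightarrow> int \<Rightarrow> nat" where
  "graph_betti K G i e =
     betti_number (verts G) (edge_ring_module G :: (('v, 'k) mpoly, ('v, 'k) mpoly set) module)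
       (edge_ring_part G) i e"


section \<open>The integers \<open>\<lambda>\<^sub>i\<close>\<close>

definition lam :: "nat \<Rightarrow> nat \<Rightarrow> nat" where
  "lam b i =
     (if i < 1 \<or> i > 2 * b - 2 then 0
      else if i = 1 then 2 * (b choose 2) + b
      else if i = 3 then 6 * (b choose 4) + 2 * b * ((b - 1) choose 2) + (b choose 2)
      else 2 * i * (b choose (i + 1)) + 2 * b * ((b - 1) choose (i - 1)))"

end

theory Submission
  imports Defs "HOL.Vector_Spaces" "HOL-Library.Countable_Set" "HOL-Library.Multiset"
begin

text \<open>
  In a minimal graded free resolution of \<open>R / I(G)\<close> the generators of degree \<open>i + 1\<close> in homological
  degree \<open>i \<ge> 1\<close> form a linear strand: splitting the differential into its coefficients at the variables
  again and again identifies their span with the alternating functions \<open>\<phi>\<close> on lists of \<open>i - 1\<close>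
  variables, with values in \<open>I(G)\<^sub>2\<close>, such that \<open>\<Sum>\<^sub>x x \<phi>(\<dots>, x) = 0\<close>.  This does not
  depend on the resolution, and the multigraded piece of this space at a vertex set \<open>S\<close> with \<open>i + 1\<close>
  elements consists of the 1-cocycles on the full simplex on \<open>S\<close> that vanish on the non-edges of
  \<open>G\<close>; its dimension is the number of components of the complement of \<open>G[S]\<close> minus one, and the pieces
  that are not squarefree vanish.  So \<open>\<beta>\<^sub>i\<^sub>,\<^sub>i\<^sub>+\<^sub>1\<close> is the sum of these numbers.  For a join the
  complement is a disjoint union; for disjoint copies it is connected unless \<open>S\<close> lies in one copy; and for
  \<open>B\<^sub>b\<close> it is a complete bipartite graph minus a matching if \<open>S\<close> meets both cliques, and edgeless
  otherwise.
\<close>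

section \<open>Polynomials and free modules\<close>

text \<open>\<open>betti_number\<close> is a definite description over all minimal graded free
  resolutions, so one must exist and all must give the same count. Neither fact is taken from Tor or
  from a comparison of resolutions. Existence comes from iterating minimal covers of graded kernels.
  Independence comes from minimality used directly: for \<open>i \<ge> 1\<close> the generators in
  homological degree \<open>i\<close> have degree at least \<open>i + 1\<close>, so on the span of
  those of degree exactly \<open>i + 1\<close> the differential is injective with linear
  coefficients, and recording these coefficients loses nothing. Dimensions are computed by dual
  systems: a family of coordinates that separates elements, and elements dual to it. They are
  indexed by a vertex set together with a component of the complement that avoids a chosen root. The
  argument works over every field; because of characteristic 2, vanishing on repeated arguments is
  always carried along beside antisymmetry. In the final formula, the second sum counts the vertex
  sets that meet both sides of the join: there the edgeless side adds exactly one component.\<close>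

abbreviation lookup :: "('a \<Rightarrow>\<^sub>0 'b::zero) \<Rightarrow> 'a \<Rightarrow> 'b" where
  "lookup \<equiv> Poly_Mapping.lookup"

abbreviation keys :: "('a \<Rightarrow>\<^sub>0 'b::zero) \<Rightarrow> 'a set" where
  "keys \<equiv> Poly_Mapping.keys"

abbreviation single :: "'a \<Rightarrow> 'b::zero \<Rightarrow> 'a \<Rightarrow>\<^sub>0 'b" where
  "single \<equiv> Poly_Mapping.single"

abbreviation deg :: "('v \<Rightarrow>\<^sub>0 nat) \<Rightarrow> int" where
  "deg m \<equiv> int (monomial_degree m)"

abbreviation polys :: "'v set \<Rightarrow> ('v, 'k::field) mpoly set" where
  "polys V \<equiv> carrier (mpoly_ring V)"

type_synonym ('v, 'k) vec = "nat \<Rightarrow>\<^sub>0 ('v, 'k) mpoly"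

abbreviation vecs :: "'v set \<Rightarrow> nat set \<Rightarrow> ('v, 'k::field) vec set" where
  "vecs V J \<equiv> carrier (free_module V J)"

abbreviation hpart :: "'v set \<Rightarrow> int \<Rightarrow> ('v, 'k::field) mpoly set" where
  "hpart \<equiv> homogeneous_part"

abbreviation vpart :: "'v set \<Rightarrow> nat set \<Rightarrow> (nat \<Rightarrow> int) \<Rightarrow> int \<Rightarrow> ('v, 'k::field) vec set" where
  "vpart \<equiv> free_module_part"

lemma keys_add_nat: "keys (m + m') = keys m \<union> keys (m' :: 'v \<Rightarrow>\<^sub>0 nat)"
  by (auto simp: in_keys_iff lookup_add)

lemma monomial_degree_superset:
  assumes "finite A" "keys m \<subseteq> A" shows "monomial_degree m = (\<Sum>x\<in>A. lookup m x)"
  unfolding monomial_degree_def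
  by (rule sum.mono_neutral_left) (use assms in \<open>auto simp: in_keys_iff\<close>)

lemma monomial_degree_add: "monomial_degree (m + m') = monomial_degree m + monomial_degree m'"
proof -
  let ?A = "keys m \<union> keys m'"
  have "monomial_degree (m + m') = (\<Sum>x\<in>?A. lookup (m + m') x)"
    by (rule monomial_degree_superset) (auto simp: keys_add_nat)
  also have "\<dots> = (\<Sum>x\<in>?A. lookup m x) + (\<Sum>x\<in>?A. lookup m' x)"
    by (simp add: lookup_add sum.distrib)
  also have "(\<Sum>x\<in>?A. lookup m x) = monomial_degree m"
    by (rule monomial_degree_superset[symmetric]) auto
  also have "(\<Sum>x\<in>?A. lookup m' x) = monomial_degree m'"
    by (rule monomial_degree_superset[symmetric]) auto
  finally show ?thesis .
qed

lemma monomial_degree_single [simp]: "monomial_degree (single x k) = k"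
  by (simp add: monomial_degree_def)

lemma monomial_degree_zero [simp]: "monomial_degree 0 = 0" by (simp add: monomial_degree_def)

lemma monomial_degree_eq_0_iff [simp]: "monomial_degree m = 0 \<longleftrightarrow> m = 0"
  by (auto simp: monomial_degree_def in_keys_iff intro!: poly_mapping_eqI)

lemma single_eq_0_iff [simp]: "single x c = 0 \<longleftrightarrow> c = 0"
  by (metis lookup_single_eq lookup_zero single_zero)

lemma single_plus_diff:
  assumes "x \<in> keys (m :: 'v \<Rightarrow>\<^sub>0 nat)"
  shows "single x 1 + (m - single x 1) = m" by (rule poly_mapping_eqI)
    (use assms in \<open>auto simp: lookup_add lookup_minus lookup_single in_keys_iff when_def\<close>)

lemma poly_mapping_sum_single: "(\<Sum>m\<in>keys p. single m (lookup p m)) = p"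
  by (rule poly_mapping_eqI)
    (auto simp: lookup_sum lookup_single when_def in_keys_iff sum.delta)

text \<open>Subtraction of exponent vectors is truncated, so \<open>m + (n - m) = n\<close> is the
  test that the monomial \<open>m\<close> divides \<open>n\<close>.\<close>

lemma lookup_single_times:
  fixes p :: "('v, 'k::field) mpoly"
  shows "lookup (single m c * p) n = (if m + (n - m) = n then c * lookup p (n - m) else 0)"
proof -
  have "lookup (single m c * p) n = (\<Sum>l. (c * (\<Sum>q. lookup p q when n = l + q)) when l = m)"
    unfolding lookup_mult by (intro Sum_any.cong) (auto simp: lookup_single when_def)
  also have "\<dots> = c * (\<Sum>q. lookup p q when n = m + q)" by simp
  also have "(\<Sum>q. lookup p q when n = m + q) = (if m + (n - m) = n then lookup p (n - m) else 0)"
  proof (cases "m + (n - m) = n")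
    case True
    then have "n = m + q \<longleftrightarrow> q = n - m" for q by auto
    then show ?thesis using True by simp
  next
    case False
    then have "n \<noteq> m + q" for q by auto
    then show ?thesis using False by simp
  qed
  finally show ?thesis by simp
qed

lemma lookup_Var_times:
  "lookup (Var x * p) n = (if x \<in> keys n then lookup p (n - single x 1) else 0)"
proof -
  have "single x 1 + (n - single x 1) = n \<longleftrightarrow> x \<in> keys n"
    using single_plus_diff[of x n] keys_add_nat[of "single x 1" "n - single x 1"] by auto
  then show ?thesis by (simp add: Var_def lookup_single_times)
qed

lemma lookup_single0_times [simp]: "lookup (single 0 c * p) n = c * lookup p (n :: 'v \<Rightarrow>\<^sub>0 nat)"
  for c :: "'k::field" by (simp add: lookup_single_times)

text \<open>Exponents are nonnegative, so a product of monomials is constant only if both factors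
  are; the constant coefficient is therefore multiplicative.\<close>

lemma lookup_times_zero: "lookup (p * q) 0 = lookup p 0 * lookup q (0 :: 'v \<Rightarrow>\<^sub>0 nat)"
  for p q :: "('v, 'k::field) mpoly"
proof -
  have "(0 = l + m) = (l = 0 \<and> m = 0)" for l m :: "'v \<Rightarrow>\<^sub>0 nat"
  proof
    assume "0 = l + m"
    then have "monomial_degree l + monomial_degree m = 0"
      by (metis monomial_degree_add monomial_degree_zero)
    then show "l = 0 \<and> m = 0" by simp
  qed simp
  then have "lookup (p * q) 0 = (\<Sum>l. (lookup p l * (\<Sum>m. lookup q m when m = 0)) when l = 0)"
    unfolding lookup_mult by (intro Sum_any.cong) (auto simp: when_def)
  then show ?thesis by simp
qed

section \<open>Polynomials in the variables \<open>V\<close> and their homogeneous parts\<close>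

lemma polys_iff: "p \<in> polys V \<longleftrightarrow> (\<forall>m. lookup p m \<noteq> 0 \<longrightarrow> keys m \<subseteq> V)"
  by (auto simp: mpoly_ring_def in_keys_iff)

lemma polys_zero [simp]: "0 \<in> polys V" and polys_one [simp]: "1 \<in> polys V"
  and polys_single: "keys m \<subseteq> V \<Longrightarrow> single m c \<in> polys V"
  and polys_Var: "x \<in> V \<Longrightarrow> Var x \<in> polys V"
  by (auto simp: mpoly_ring_def Var_def split: if_splits)

lemma polys_const [simp]: "single 0 c \<in> polys V" by (simp add: polys_single)

lemma polys_add: "p \<in> polys V \<Longrightarrow> q \<in> polys V \<Longrightarrow> p + q \<in> polys V"
  unfolding polys_iff by (metis add.left_neutral lookup_add)

lemma polys_uminus: "p \<in> polys V \<Longrightarrow> - p \<in> polys V" by (simp add: polys_iff)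

lemma polys_mult: "p \<in> polys V \<Longrightarrow> q \<in> polys V \<Longrightarrow> p * q \<in> polys V"
  using keys_mult[of p q] by (fastforce simp: mpoly_ring_def keys_add_nat)

lemma polys_sum: "(\<And>i. i \<in> A \<Longrightarrow> f i \<in> polys V) \<Longrightarrow> sum f A \<in> polys V"
  by (induction A rule: infinite_finite_induct) (auto intro: polys_add)

lemma hpart_iff:
  "p \<in> hpart V e \<longleftrightarrow> (\<forall>m. lookup p m \<noteq> 0 \<longrightarrow> keys m \<subseteq> V \<and> deg m = e)"
  by (auto simp: homogeneous_part_def polys_iff in_keys_iff)

lemma hpart_add:
  "p \<in> hpart V e \<Longrightarrow> q \<in> hpart V e \<Longrightarrow> p + q \<in> hpart V e"
  unfolding hpart_iff by (metis add.left_neutral lookup_add)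

lemma hpart_zero [simp]: "0 \<in> hpart V e" by (simp add: hpart_iff)

lemma hpart_mult:
  assumes "p \<in> hpart V e" "q \<in> hpart V e'" shows "p * q \<in> hpart V (e + e')"
proof -
  have "\<forall>m\<in>keys (p * q). deg m = e + e'"
    using keys_mult[of p q] assms by (fastforce simp: homogeneous_part_def monomial_degree_add)
  then show ?thesis using assms polys_mult[of p V q] by (simp add: homogeneous_part_def)
qed

lemma hpart_neg: "p \<in> hpart V e \<Longrightarrow> e < 0 \<Longrightarrow> p = 0"
  by (rule poly_mapping_eqI) (use of_nat_0_le_iff in \<open>fastforce simp: hpart_iff\<close>)

lemma hpart_0: "p \<in> hpart V 0 \<Longrightarrow> p = single 0 (lookup p 0)"
  by (rule poly_mapping_eqI) (auto simp: hpart_iff lookup_single when_def)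

lemma hpart_const [simp]: "single 0 c \<in> hpart V 0"
  by (auto simp: hpart_iff lookup_single when_def)

lemma hpart_Var: "x \<in> V \<Longrightarrow> Var x \<in> hpart V 1"
  by (auto simp: hpart_iff Var_def lookup_single when_def split: if_splits)

lemma degree_one_monomial:
  assumes "deg m = 1"
  obtains x where "m = single x 1"
proof -
  obtain x where x: "x \<in> keys m"
    using assms by (metis monomial_degree_zero ex_in_conv keys_eq_empty of_nat_0 zero_neq_one)
  have "monomial_degree (m - single x 1) = 0"
    using assms monomial_degree_add[of "single x 1" "m - single x 1"] single_plus_diff[OF x] by simp
  then have "m = single x 1" using single_plus_diff[OF x] by simp
  then show ?thesis by (rule that)
qed

lemma cring_mpoly_ring: "cring (mpoly_ring V :: ('v, 'k::field) mpoly ring)"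
proof (intro cringI abelian_groupI comm_monoidI)
  fix p :: "('v, 'k) mpoly"
  assume "p \<in> polys V"
  then have "- p \<in> polys V" by (rule polys_uminus)
  then show "\<exists>q\<in>polys V. q \<oplus>\<^bsub>mpoly_ring V\<^esub> p = \<zero>\<^bsub>mpoly_ring V\<^esub>"
    by (intro bexI[of _ "- p"]) (simp_all add: mpoly_ring_def)
qed (use polys_add[of _ V] polys_mult[of _ V] polys_zero[of V] polys_one[of V]
  in \<open>simp_all add: mpoly_ring_def algebra_simps\<close>)

lemma mpoly_ring_simps [simp]:
  "x \<otimes>\<^bsub>mpoly_ring V\<^esub> y = x * y" "x \<oplus>\<^bsub>mpoly_ring V\<^esub> y = x + y"
  "\<one>\<^bsub>mpoly_ring V\<^esub> = 1" "\<zero>\<^bsub>mpoly_ring V\<^esub> = 0"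
  by (simp_all add: mpoly_ring_def)

text \<open>Negation is multiplication by the constant \<open>- 1\<close>, so the subgroup property
  follows from the listed closure conditions.\<close>

lemma ideal_mpoly_ringI:
  assumes "I \<subseteq> polys V" "0 \<in> I" "\<And>p q. p \<in> I \<Longrightarrow> q \<in> I \<Longrightarrow> p + q \<in> I"
    "\<And>r p. r \<in> polys V \<Longrightarrow> p \<in> I \<Longrightarrow> r * p \<in> I"
  shows "ideal I (mpoly_ring V)"
proof -
  interpret cring "mpoly_ring V" by (rule cring_mpoly_ring)
  show ?thesis
  proof (intro idealI)
    have neg: "\<ominus>\<^bsub>mpoly_ring V\<^esub> p \<in> I" if "p \<in> I" for p
    proof -
      have "\<ominus>\<^bsub>mpoly_ring V\<^esub> p = - 1 * p"
        by (rule minus_equality) (use that assms(1) in \<open>auto intro: polys_uminus\<close>)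
      then show ?thesis using assms(4)[OF polys_uminus[OF polys_one] that] by simp
    qed
    show "subgroup I (add_monoid (mpoly_ring V))"
      by (rule subgroup.intro) (use assms neg in \<open>auto simp: a_inv_def\<close>)
    show "p \<otimes>\<^bsub>mpoly_ring V\<^esub> r \<in> I" if "p \<in> I" "r \<in> polys V" for p r
      using assms(4)[OF that(2,1)] by (simp add: mult.commute)
  qed (use assms in \<open>auto simp: ring_axioms\<close>)
qed

lemma ideal_mpoly_ringD:
  assumes "ideal I (mpoly_ring V)"
  shows "I \<subseteq> polys V" "0 \<in> I" "\<And>p q. p \<in> I \<Longrightarrow> q \<in> I \<Longrightarrow> p + q \<in> I"
    "\<And>r p. r \<in> polys V \<Longrightarrow> p \<in> I \<Longrightarrow> r * p \<in> I"
proof -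
  interpret ideal I "mpoly_ring V" by (rule assms)
  show "I \<subseteq> polys V" "0 \<in> I" "\<And>p q. p \<in> I \<Longrightarrow> q \<in> I \<Longrightarrow> p + q \<in> I"
    "\<And>r p. r \<in> polys V \<Longrightarrow> p \<in> I \<Longrightarrow> r * p \<in> I"
    using a_subset additive_subgroup.zero_closed[OF additive_subgroup_axioms] 
      additive_subgroup.a_closed[OF additive_subgroup_axioms] I_l_closed by auto
qed

lemma ideal_mpoly_ring_sum:
  assumes "ideal I (mpoly_ring V)" "\<And>i. i \<in> A \<Longrightarrow> f i \<in> I"
  shows "sum f A \<in> I"
  using assms(2) ideal_mpoly_ringD[OF assms(1)] by (induction A rule: infinite_finite_induct) auto

lemma monomial_in_ideal:
  assumes I: "ideal I (mpoly_ring V)" and p: "single m 1 \<in> I" and "keys m' \<subseteq> V"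
  shows "single (m + m') (c :: 'k::field) \<in> I"
proof -
  have "single (m + m') c = single m' c * single m 1" by (simp add: mult_single add.commute)
  then show ?thesis using ideal_mpoly_ringD(4)[OF I polys_single[OF assms(3)] p, of c] by metis
qed

text \<open>A monomial other than 1 is divisible by a variable, so a polynomial without constant
  term lies in the ideal term by term. Minimality thereby becomes the vanishing of constant
  coefficients, the form in which it is used throughout.\<close>

lemma irrelevant_ideal_eq:
  fixes V :: "'v set"
  shows "irrelevant_ideal V = {p \<in> polys V. lookup p 0 = (0 :: 'k::field)}" (is "_ = ?I")
proof
  interpret cring "mpoly_ring V :: ('v, 'k) mpoly ring" by (rule cring_mpoly_ring)
  have I: "ideal ?I (mpoly_ring V)"
    by (rule ideal_mpoly_ringI) (auto intro: polys_add polys_mult simp: lookup_add lookup_times_zero)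
  have "Var ` V \<subseteq> ?I"
    by (auto simp: polys_Var) (auto simp: Var_def lookup_single when_def)
  then show "irrelevant_ideal V \<subseteq> ?I"
    unfolding irrelevant_ideal_def by (rule genideal_minimal[OF I])
  show "?I \<subseteq> irrelevant_ideal V"
  proof
    fix p assume p: "p \<in> ?I"
    have V: "Var ` V \<subseteq> (polys V :: ('v, 'k) mpoly set)" by (auto intro: polys_Var)
    have J: "ideal (irrelevant_ideal V) (mpoly_ring V :: ('v, 'k) mpoly ring)"
      unfolding irrelevant_ideal_def by (rule genideal_ideal[OF V])
    have "single m (lookup p m) \<in> irrelevant_ideal V" if m: "m \<in> keys p" for m
    proof -
      have "m \<noteq> 0" using m p by (auto simp: in_keys_iff)
      then obtain x where x: "x \<in> keys m" by (metis ex_in_conv keys_eq_empty)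
      have mV: "keys m \<subseteq> V" using p m by (auto simp: polys_iff in_keys_iff)
      have "single x 1 + (m - single x 1) = m" by (rule single_plus_diff[OF x])
      moreover from this have "keys (m - single x 1) \<subseteq> V" 
        using mV by (metis Un_subset_iff keys_add_nat)
      moreover have "(Var x :: ('v, 'k) mpoly) \<in> irrelevant_ideal V"
        using genideal_self[OF V] x mV unfolding irrelevant_ideal_def by blast
      then have "single (single x 1) (1 :: 'k) \<in> irrelevant_ideal V" by (simp only: Var_def)
      ultimately show ?thesis
        using monomial_in_ideal[OF J, of "single x 1" "m - single x 1"] by metis
    qed
    then have "(\<Sum>m\<in>keys p. single m (lookup p m)) \<in> irrelevant_ideal V"
      by (rule ideal_mpoly_ring_sum[OF J])
    then show "p \<in> irrelevant_ideal V" by (simp add: poly_mapping_sum_single)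
  qed
qed

section \<open>Free modules as finitely supported families of polynomials\<close>

definition smul :: "('v, 'k::field) mpoly \<Rightarrow> ('v, 'k) vec \<Rightarrow> ('v, 'k) vec" where
  "smul r f = Poly_Mapping.map (\<lambda>p. r * p) f"

lemma lookup_smul [simp]: "lookup (smul r f) j = r * lookup f j"
  by (simp add: smul_def Poly_Mapping.map.rep_eq when_def)

lemma free_module_simps [simp]:
  "x \<oplus>\<^bsub>free_module V J\<^esub> y = x + y"
  "r \<odot>\<^bsub>free_module V J\<^esub> x = smul r x"
  "\<zero>\<^bsub>free_module V J\<^esub> = 0" by (simp_all add: free_module_def smul_def)

lemma vecs_iff: "f \<in> vecs V J \<longleftrightarrow> keys f \<subseteq> J \<and> (\<forall>j. lookup f j \<in> polys V)"
  by (simp add: free_module_def)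

lemma smul_add: "smul r (f + g) = smul r f + smul r g"
  and smul_add_left: "smul (r + s) f = smul r f + smul s f"
  and smul_smul: "smul r (smul s f) = smul (r * s) f" and smul_one [simp]: "smul 1 f = f"
  and smul_zero [simp]: "smul 0 f = 0" and smul_zero_right [simp]: "smul r 0 = 0"
  by (auto intro!: poly_mapping_eqI simp: lookup_add algebra_simps simp del: map_eq_zero_iff)

lemma smul_sum: "smul r (sum f A) = (\<Sum>i\<in>A. smul r (f i))"
  by (induction A rule: infinite_finite_induct) (auto simp: smul_add)

lemma smul_sum_left: "smul (sum r A) f = (\<Sum>i\<in>A. smul (r i) f)"
  by (induction A rule: infinite_finite_induct) (auto simp: smul_add_left)

lemma vecs_zero [simp]: "0 \<in> vecs V J" by (simp add: vecs_iff)

lemma vecs_add: "f \<in> vecs V J \<Longrightarrow> g \<in> vecs V J \<Longrightarrow> f + g \<in> vecs V J"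
  using keys_add[of f g] by (auto simp: vecs_iff lookup_add polys_add)

lemma vecs_smul: "r \<in> polys V \<Longrightarrow> f \<in> vecs V J \<Longrightarrow> smul r f \<in> vecs V J"
  by (force simp: vecs_iff polys_mult in_keys_iff)

lemma vecs_sum: "(\<And>i. i \<in> A \<Longrightarrow> f i \<in> vecs V J) \<Longrightarrow> sum f A \<in> vecs V J"
  by (induction A rule: infinite_finite_induct) (auto intro: vecs_add)

lemma vecs_unit: "j \<in> J \<Longrightarrow> p \<in> polys V \<Longrightarrow> single j p \<in> vecs V J"
  by (auto simp: vecs_iff lookup_single when_def)

lemma vecs_decomp: "f = (\<Sum>j\<in>keys f. smul (lookup f j) (single j 1))"
proof -
  have "single j (lookup f j) = smul (lookup f j) (single j 1)" for j
    by (rule poly_mapping_eqI) (simp add: lookup_single when_def)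
  then show ?thesis using poly_mapping_sum_single[of f] by simp
qed

lemma vpart_iff:
  "f \<in> vpart V J c e \<longleftrightarrow> f \<in> vecs V J \<and> (\<forall>j. lookup f j \<in> hpart V (e - c j))"
  by (simp add: free_module_part_def)

lemma vpart_add:
  "f \<in> vpart V J c e \<Longrightarrow> g \<in> vpart V J c e \<Longrightarrow> f + g \<in> vpart V J c e"
  by (auto simp: vpart_iff lookup_add intro: vecs_add hpart_add)

lemma vpart_zero [simp]: "0 \<in> vpart V J c e" by (simp add: vpart_iff)

lemma vpart_sum:
  "(\<And>i. i \<in> A \<Longrightarrow> f i \<in> vpart V J c e) \<Longrightarrow> sum f A \<in> vpart V J c e"
  by (induction A rule: infinite_finite_induct) (auto intro: vpart_add)

lemma vpart_smul:
  assumes "r \<in> hpart V d" "f \<in> vpart V J c e" shows "smul r f \<in> vpart V J c (d + e)"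
proof -
  have "r \<in> polys V" using assms(1) by (simp add: homogeneous_part_def)
  moreover have "r * lookup f j \<in> hpart V (d + e - c j)" for j
    using hpart_mult[OF assms(1), of "lookup f j" "e - c j"] assms(2)
    by (simp add: vpart_iff algebra_simps)
  ultimately show ?thesis using assms(2) by (auto simp: vpart_iff vecs_smul)
qed

lemma vpart_unit:
  "j \<in> J \<Longrightarrow> p \<in> hpart V d \<Longrightarrow> single j p \<in> vpart V J c (c j + d)"
  by (auto simp: vpart_iff lookup_single when_def homogeneous_part_def intro: vecs_unit)

definition fscale :: "'k::field \<Rightarrow> ('v, 'k) vec \<Rightarrow> ('v, 'k) vec" where
  "fscale k f = smul (single 0 k) f"

text \<open>One ambient space over the field, independent of \<open>V\<close> and of the index set,
  with scalars acting as constant polynomials. The graded pieces of all free modules are subspaces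
  of it, so spans and independence can be discussed here.\<close>

interpretation fv: vector_space fscale
proof unfold_locales
  fix a b :: "'k::field" and f g :: "('v, 'k) vec"
  show "fscale a (f + g) = fscale a f + fscale a g" by (simp only: fscale_def smul_add)
  show "fscale (a + b) f = fscale a f + fscale b f"
    by (simp only: fscale_def single_add smul_add_left)
  show "fscale a (fscale b f) = fscale (a * b) f" by (simp add: fscale_def smul_smul mult_single)
  show "fscale 1 f = f" by (simp add: fscale_def)
qed

section \<open>Homogeneous components and graded maps\<close>

lemma vec_eqI:
  assumes "\<And>j m. lookup (lookup f j) m = lookup (lookup g j) m" shows "f = g"
  by (rule poly_mapping_eqI, rule poly_mapping_eqI) (rule assms)

definition restrict_keys :: "('a \<Rightarrow> bool) \<Rightarrow> ('a \<Rightarrow>\<^sub>0 'b::comm_monoid_add) \<Rightarrow> 'a \<Rightarrow>\<^sub>0 'b" where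
  "restrict_keys Q p = (\<Sum>m\<in>{m \<in> keys p. Q m}. single m (lookup p m))"

lemma lookup_restrict_keys [simp]: "lookup (restrict_keys Q p) m = (if Q m then lookup p m else 0)"
  by (auto simp: restrict_keys_def lookup_sum lookup_single when_def sum.delta in_keys_iff)

definition hcomp :: "(nat \<Rightarrow> int) \<Rightarrow> int \<Rightarrow> ('v, 'k::field) vec \<Rightarrow> ('v, 'k) vec" where
  "hcomp c e f = (\<Sum>j\<in>keys f. single j (restrict_keys (\<lambda>m. deg m = e - c j) (lookup f j)))"

lemma lookup_hcomp: "lookup (hcomp c e f) j = restrict_keys (\<lambda>m. deg m = e - c j) (lookup f j)"
proof -
  have "restrict_keys Q 0 = 0" for Q :: "'x \<Rightarrow> bool" by (rule poly_mapping_eqI) simp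
  then show ?thesis
    by (auto simp: hcomp_def lookup_sum lookup_single when_def sum.delta in_keys_iff)
qed

lemma lookup_lookup_hcomp [simp]:
  "lookup (lookup (hcomp c e f) j) m = (if deg m = e - c j then lookup (lookup f j) m else 0)"
  by (simp add: lookup_hcomp)

lemma hcomp_zero [simp]: "hcomp c e 0 = 0" by (simp add: hcomp_def)

lemma hcomp_add: "hcomp c e (f + g) = hcomp c e f + hcomp c e g"
  by (rule vec_eqI) (simp add: lookup_add)

lemma hcomp_sum: "hcomp c e (sum f A) = (\<Sum>i\<in>A. hcomp c e (f i))"
  by (induction A rule: infinite_finite_induct) (auto simp: hcomp_add)

lemma hcomp_in_part:
  assumes "f \<in> vecs V J" shows "hcomp c e f \<in> vpart V J c e"
proof -
  have "keys (hcomp c e f) \<subseteq> J"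
  proof
    fix j assume "j \<in> keys (hcomp c e f)"
    then have "hcomp c e f \<noteq> 0" "lookup (hcomp c e f) j \<noteq> 0" by (auto simp: in_keys_iff)
    then obtain m where "lookup (lookup (hcomp c e f) j) m \<noteq> 0"
      by (metis lookup_zero poly_mapping_eqI)
    then have "lookup (lookup f j) m \<noteq> 0" by (simp split: if_splits)
    then have "lookup f j \<noteq> 0" by auto
    then show "j \<in> J" using assms by (auto simp: vecs_iff in_keys_iff)
  qed
  then show ?thesis using assms by (auto simp: vpart_iff vecs_iff hpart_iff polys_iff)
qed

lemma hcomp_of_part:
  assumes "f \<in> vpart V J c e" shows "hcomp c e' f = (if e' = e then f else 0)"
proof (rule vec_eqI)
  fix j m
  have "lookup (lookup f j) m = 0 \<or> deg m = e - c j"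
    using assms by (auto simp: vpart_iff hpart_iff)
  then show "lookup (lookup (hcomp c e' f) j) m = lookup (lookup (if e' = e then f else 0) j) m"
    by auto
qed

text \<open>Every degree in which \<open>f\<close> has a nonzero component lies in this set, which
  makes the decomposition of \<open>f\<close> into components a finite sum.\<close>

definition degrees :: "(nat \<Rightarrow> int) \<Rightarrow> ('v, 'k::field) vec \<Rightarrow> int set" where
  "degrees c f = (\<Union>j\<in>keys f. (\<lambda>m. deg m + c j) ` keys (lookup f j))"

lemma finite_degrees [simp]: "finite (degrees c f)" by (simp add: degrees_def)

lemma hcomp_notin_degrees:
  assumes "e \<notin> degrees c f" shows "hcomp c e f = 0"
proof (rule vec_eqI)
  fix j m
  show "lookup (lookup (hcomp c e f) j) m = lookup (lookup 0 j) m"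
  proof (cases "deg m = e - c j \<and> lookup (lookup f j) m \<noteq> 0")
    case True
    then have "j \<in> keys f" "m \<in> keys (lookup f j)" "e = deg m + c j" by (auto simp: in_keys_iff)
    then show ?thesis using assms by (auto simp: degrees_def)
  qed auto
qed

lemma sum_hcomp: "(\<Sum>e\<in>degrees c f. hcomp c e f) = f"
proof (rule vec_eqI)
  fix j m
  have "lookup (lookup (\<Sum>e\<in>degrees c f. hcomp c e f) j) m =
    (\<Sum>e\<in>degrees c f. if e = deg m + c j then lookup (lookup f j) m else 0)"
    unfolding lookup_sum by (intro sum.cong) auto
  also have "\<dots> = (if deg m + c j \<in> degrees c f then lookup (lookup f j) m else 0)"
    by (simp add: sum.delta)
  also have "\<dots> = lookup (lookup f j) m"
  proof (cases "deg m + c j \<in> degrees c f")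
    case False
    have "lookup (lookup f j) m = lookup (lookup (hcomp c (deg m + c j) f) j) m" by simp
    also have "\<dots> = 0" by (simp add: hcomp_notin_degrees[OF False])
    finally show ?thesis using False by simp
  qed simp
  finally show "lookup (lookup (\<Sum>e\<in>degrees c f. hcomp c e f) j) m = lookup (lookup f j) m" .
qed

section \<open>Graded homomorphisms and graded submodules\<close>

definition graded_hom where
  "graded_hom V J' c' J c d \<longleftrightarrow>
    d \<in> Defs.module_hom (mpoly_ring V) (free_module V J') (free_module V J) \<and>
    (\<forall>e. d ` vpart V J' c' e \<subseteq> vpart V J c e)"

lemma
  assumes "graded_hom V J' c' J c d"
  shows graded_hom_closed: "f \<in> vecs V J' \<Longrightarrow> d f \<in> vecs V J"
    and graded_hom_add: "f \<in> vecs V J' \<Longrightarrow> g \<in> vecs V J' \<Longrightarrow> d (f + g) = d f + d g"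
    and graded_hom_smul: "r \<in> polys V \<Longrightarrow> f \<in> vecs V J' \<Longrightarrow> d (smul r f) = smul r (d f)"
    and graded_hom_part: "f \<in> vpart V J' c' e \<Longrightarrow> d f \<in> vpart V J c e"
  using assms by (auto simp: graded_hom_def Defs.module_hom_def) blast

lemma graded_hom_zero:
  assumes "graded_hom V J' c' J c d" shows "d 0 = 0" using graded_hom_smul[OF assms, of 0 0] by simp

lemma graded_hom_sum:
  assumes "graded_hom V J' c' J c d" "\<And>i. i \<in> A \<Longrightarrow> f i \<in> vecs V J'"
  shows "d (sum f A) = (\<Sum>i\<in>A. d (f i))" using assms(2)
  by (induction A rule: infinite_finite_induct)
    (auto simp: graded_hom_zero[OF assms(1)] graded_hom_add[OF assms(1)] vecs_sum)

lemma vpart_subset: "vpart V J c e \<subseteq> vecs V J" by (auto simp: vpart_iff)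

text \<open>Apply \<open>d\<close> to the finite decomposition of \<open>f\<close>: each image is
  homogeneous of the degree of its component, so a single term yields the component of degree
  \<open>e\<close>. This makes kernels graded and allows preimages to be replaced by homogeneous
  ones.\<close>

lemma graded_hom_hcomp:
  assumes d: "graded_hom V J' c' J c d" and f: "f \<in> vecs V J'"
  shows "d (hcomp c' e f) = hcomp c e (d f)"
proof -
  have cl: "hcomp c' e' f \<in> vpart V J' c' e'" for e' by (rule hcomp_in_part[OF f])
  have "d f = (\<Sum>e'\<in>degrees c' f. d (hcomp c' e' f))"
    by (subst (1) sum_hcomp[of c' f, symmetric], rule graded_hom_sum[OF d])
      (use cl vpart_subset in blast)
  then have "hcomp c e (d f) = (\<Sum>e'\<in>degrees c' f. hcomp c e (d (hcomp c' e' f)))"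
    by (simp add: hcomp_sum)
  also have "\<dots> = (\<Sum>e'\<in>degrees c' f. if e' = e then d (hcomp c' e' f) else 0)"
    by (intro sum.cong refl) (use hcomp_of_part[OF graded_hom_part[OF d cl], of e] in auto)
  also have "\<dots> = (if e \<in> degrees c' f then d (hcomp c' e f) else 0)"
    by (simp add: sum.delta)
  also have "\<dots> = d (hcomp c' e f)"
    using hcomp_notin_degrees[of e c' f] graded_hom_zero[OF d] by auto
  finally show ?thesis by simp
qed

definition graded_submodule where
  "graded_submodule V J c N \<longleftrightarrow> N \<subseteq> vecs V J \<and> 0 \<in> N \<and>
    (\<forall>f\<in>N. \<forall>g\<in>N. f + g \<in> N) \<and> (\<forall>r\<in>polys V. \<forall>f\<in>N. smul r f \<in> N) \<and>
    (\<forall>e. \<forall>f\<in>N. hcomp c e f \<in> N)"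

lemma graded_submodule_ker:
  assumes d: "graded_hom V J' c' J c d"
  shows "graded_submodule V J' c' {f \<in> vecs V J'. d f = 0}" unfolding graded_submodule_def
  using graded_hom_add[OF d] graded_hom_smul[OF d] graded_hom_zero[OF d] graded_hom_hcomp[OF d]
    subsetD[OF vpart_subset hcomp_in_part, of _ V J' c'] by (auto intro: vecs_add vecs_smul)

section \<open>Existence of minimal graded free resolutions\<close>

lemma finite_monomials:
  assumes "finite V" shows "finite {m. keys m \<subseteq> V \<and> monomial_degree m \<le> k}"
proof -
  let ?M = "{m. keys m \<subseteq> V \<and> monomial_degree m \<le> k}"
  have "lookup m x \<le> k" if "m \<in> ?M" "x \<in> V" for m x
    using member_le_sum[of x V "lookup m"] monomial_degree_superset[of V m] that assms by auto
  then have "lookup ` ?M \<subseteq> {f. \<forall>x. (x \<in> V \<longrightarrow> f x \<in> {..k}) \<and> (x \<notin> V \<longrightarrow> f x = 0)}"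
    by (auto simp: in_keys_iff)
  then have "finite (lookup ` ?M)"
    by (rule finite_subset) (intro finite_set_of_finite_funs assms finite_atMost)
  then show ?thesis by (rule finite_imageD) (auto intro: inj_onI poly_mapping_eqI)
qed

text \<open>Generator degrees are nonnegative and finitely many lie below any bound, so each graded
  piece is finite-dimensional. The spanning set collects all monomials of degree up to
  \<open>nat e\<close> on generators of degree at most \<open>e\<close>, not just those of total
  degree \<open>e\<close>; only its finiteness matters.\<close>

lemma vpart_span:
  assumes "finite V" "\<And>j. j \<in> J \<Longrightarrow> 0 \<le> c j" "\<And>e. finite {j \<in> J. c j \<le> e}"
  obtains M where "finite M" "vpart V J c e \<subseteq> fv.span M"
proof
  let ?M = "(\<lambda>(j, m). single j (single m 1)) `
    ({j \<in> J. c j \<le> e} \<times> {m. keys m \<subseteq> V \<and> monomial_degree m \<le> nat e})"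
  show "finite ?M" using assms(3)[of e] finite_monomials[OF assms(1)] by auto
  show "vpart V J c e \<subseteq> fv.span ?M"
  proof
    fix f assume f: "f \<in> vpart V J c e"
    have "f = (\<Sum>j\<in>keys f. \<Sum>m\<in>keys (lookup f j). fscale (lookup (lookup f j) m) (single j (single m 1)))"
    proof -
      have "smul (lookup f j) (single j 1) =
        (\<Sum>m\<in>keys (lookup f j). fscale (lookup (lookup f j) m) (single j (single m 1)))" for j
      proof (subst poly_mapping_sum_single[of "lookup f j", symmetric], 
          subst smul_sum_left, intro sum.cong refl)
        fix m
        show "smul (single m (lookup (lookup f j) m)) (single j 1) =
          fscale (lookup (lookup f j) m) (single j (single m 1))"
          by (rule poly_mapping_eqI) (simp add: fscale_def lookup_single when_def mult_single)
      qed
      then show ?thesis using vecs_decomp[of f] by simp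
    qed
    also have "\<dots> \<in> fv.span ?M"
    proof (intro fv.span_sum fv.span_scale fv.span_base)
      fix j m assume jm: "j \<in> keys f" "m \<in> keys (lookup f j)"
      then have j: "j \<in> J" and m: "keys m \<subseteq> V" "deg m = e - c j"
        using f by (auto simp: vpart_iff vecs_iff hpart_iff in_keys_iff)
      then show "single j (single m 1) \<in> ?M" using assms(2)[OF j] by force
    qed
    finally show "f \<in> fv.span ?M" .
  qed
qed

text \<open>Graded Nakayama: in each degree choose a basis of a complement of the part of
  \<open>N\<close> obtained from lower degrees by multiplication with variables. The chosen elements
  generate \<open>N\<close> by induction on the degree, and no relation among them has a nonzero
  constant coefficient. The last two conclusions reproduce the hypotheses on \<open>J\<close> and
  \<open>c\<close>, so that the cover can be iterated.\<close>

theorem graded_cover: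
  fixes V :: "'v set" and N :: "('v, 'k::field) vec set"
  assumes V: "finite V" and c: "\<And>j. j \<in> J \<Longrightarrow> 0 \<le> c j" and J: "\<And>e. finite {j \<in> J. c j \<le> e}"
    and N: "graded_submodule V J c N"
  shows "\<exists>J' c' d. graded_hom V J' c' J c d \<and> d ` vecs V J' = N \<and>
    (\<forall>f\<in>vecs V J'. d f = 0 \<longrightarrow> (\<forall>j. lookup f j \<in> irrelevant_ideal V)) \<and>
    (\<forall>j\<in>J'. 0 \<le> c' j) \<and> (\<forall>e. finite {j \<in> J'. c' j \<le> e})"
proof -
  have NV: "N \<subseteq> vecs V J" and N0: "0 \<in> N" and Nadd: "\<And>f g. f \<in> N \<Longrightarrow> g \<in> N \<Longrightarrow> f + g \<in> N"
    and Nsmul: "\<And>r f. r \<in> polys V \<Longrightarrow> f \<in> N \<Longrightarrow> smul r f \<in> N"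
    and Ncomp: "\<And>e f. f \<in> N \<Longrightarrow> hcomp c e f \<in> N"
    using N by (auto simp: graded_submodule_def)
  define Ne where "Ne e = N \<inter> vpart V J c e" for e
  \<comment> \<open>\<open>Q e\<close> spans the degree \<open>e\<close> part of the irrelevant
    ideal times \<open>N\<close>.\<close>
  define Q where "Q e = {smul (Var x) f | x f. x \<in> V \<and> f \<in> Ne (e - 1)}" for e
  have Ne_smul: "smul r f \<in> Ne (k + e)" if "r \<in> hpart V k" "f \<in> Ne e" for r f k e
    using that vpart_smul[OF that(1), of f J c e] Nsmul[of r f]
    by (auto simp: Ne_def homogeneous_part_def)
  have sub: "fv.subspace (Ne e)" for e unfolding fv.subspace_def
    using N0 Nadd vpart_add[of _ V J c e] Ne_smul[OF hpart_const, of _ e]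
    by (auto simp: Ne_def fscale_def)
  have QN: "Q e \<subseteq> Ne e" for e
    using Ne_smul[OF hpart_Var, of _ _ "e - 1"] by (auto simp: Q_def)
  \<comment> \<open>A monomial of positive degree contains a variable; its cofactor moves
    \<open>f\<close> into degree \<open>e - 1\<close> of \<open>N\<close>.\<close>
  have Q_smul: "smul r f \<in> fv.span (Q e)"
    if "r \<in> hpart V k" "k > 0" "f \<in> Ne (e - k)" for r f k e
  proof -
    have "smul r f = (\<Sum>m\<in>keys r. smul (single m (lookup r m)) f)"
      by (subst poly_mapping_sum_single[of r, symmetric]) (rule smul_sum_left)
    also have "\<dots> \<in> fv.span (Q e)"
    proof (rule fv.span_sum)
      fix m assume "m \<in> keys r"
      then have m: "keys m \<subseteq> V" "deg m = k" 
        using that(1) by (auto simp: hpart_iff in_keys_iff)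
      then have "m \<noteq> 0" using that(2) by auto
      then obtain x where x: "x \<in> keys m" by (metis ex_in_conv keys_eq_empty)
      define m' where "m' = m - single x 1"
      have mm: "m = single x 1 + m'" using single_plus_diff[OF x] by (simp add: m'_def)
      have m': "keys m' \<subseteq> V" "deg m' = k - 1"
        using m monomial_degree_add[of "single x 1" m'] by (auto simp: mm keys_add_nat)
      have eq: "single m (lookup r m) = single 0 (lookup r m) * (Var x * single m' 1)"
        by (simp add: mm Var_def mult_single)
      have "single m' 1 \<in> hpart V (k - 1)"
        using m' by (auto simp: hpart_iff lookup_single when_def)
      from Ne_smul[OF this that(3)] have "smul (single m' 1) f \<in> Ne (e - 1)" by simp
      then have "smul (Var x) (smul (single m' 1) f) \<in> Q e" using x m(1) by (auto simp: Q_def)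
      then have "fscale (lookup r m) (smul (Var x) (smul (single m' 1) f)) \<in> fv.span (Q e)"
        by (intro fv.span_scale fv.span_base)
      then show "smul (single m (lookup r m)) f \<in> fv.span (Q e)"
        by (simp add: fscale_def smul_smul eq)
    qed
    finally show ?thesis .
  qed
  \<comment> \<open>The last conjunct is independence modulo the span of \<open>Q e\<close>. A basis
    \<open>A\<close> of that span is extended to a basis \<open>C\<close> of \<open>Ne e\<close>,
    and \<open>B\<close> is \<open>C - A\<close>.\<close>
  have "\<forall>e. \<exists>B. finite B \<and> B \<subseteq> Ne e \<and> Ne e \<subseteq> fv.span (B \<union> Q e) \<and>
    (\<forall>a. (\<Sum>b\<in>B. fscale (a b) b) \<in> fv.span (Q e) \<longrightarrow> (\<forall>b\<in>B. a b = 0))"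
  proof
    fix e
    obtain A where A: "A \<subseteq> Q e" "fv.independent A" "Q e \<subseteq> fv.span A"
      using fv.maximal_independent_subset by blast
    have AN: "A \<subseteq> Ne e" using A(1) QN by blast
    obtain C where C: "A \<subseteq> C" "C \<subseteq> Ne e" "fv.independent C" "Ne e \<subseteq> fv.span C"
      using fv.maximal_independent_subset_extend[OF AN A(2)] by blast
    obtain M :: "('v, 'k) vec set" where M: "finite M" "vpart V J c e \<subseteq> fv.span M"
      by (rule vpart_span[OF V c J])
    have fC: "finite C"
      using fv.independent_span_bound[OF M(1) C(3)] C(2) M(2) by (auto simp: Ne_def)
    let ?B = "C - A"
    have fA: "finite A" using C(1) fC finite_subset by blast
    have spA: "fv.span (Q e) = fv.span A"
      using A fv.span_mono[of A "Q e"] fv.span_minimal[of "Q e" "fv.span A"] by auto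
    show "\<exists>B. finite B \<and> B \<subseteq> Ne e \<and> Ne e \<subseteq> fv.span (B \<union> Q e) \<and>
      (\<forall>a. (\<Sum>b\<in>B. fscale (a b) b) \<in> fv.span (Q e) \<longrightarrow> (\<forall>b\<in>B. a b = 0))"
    proof (intro exI[of _ ?B] conjI allI impI ballI)
      show "Ne e \<subseteq> fv.span (?B \<union> Q e)"
      proof -
        have "C \<subseteq> ?B \<union> Q e" using A(1) by blast
        then show ?thesis using C(4) fv.span_mono by blast
      qed
      fix a b assume a: "(\<Sum>b\<in>?B. fscale (a b) b) \<in> fv.span (Q e)" and b: "b \<in> ?B"
      then obtain u where u: "(\<Sum>b\<in>?B. fscale (a b) b) = (\<Sum>b\<in>A. fscale (u b) b)"
        using fv.span_finite[OF fA] by (auto simp: spA)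
      \<comment> \<open>A combination of \<open>C - A\<close> that lies in the span of
        \<open>A\<close> becomes a single vanishing combination of the independent set
        \<open>C\<close>.\<close>
      define w where "w x = (if x \<in> A then - u x else a x)" for x
      have "(\<Sum>x\<in>C. fscale (w x) x) = (\<Sum>x\<in>?B. fscale (w x) x) + (\<Sum>x\<in>A. fscale (w x) x)"
        by (rule sum.subset_diff[OF C(1) fC])
      also have "(\<Sum>x\<in>?B. fscale (w x) x) = (\<Sum>x\<in>?B. fscale (a x) x)"
        by (intro sum.cong) (auto simp: w_def)
      also have "(\<Sum>x\<in>A. fscale (w x) x) = - (\<Sum>x\<in>A. fscale (u x) x)"
        by (simp add: w_def fv.scale_minus_left sum_negf)
      finally have "(\<Sum>x\<in>C. fscale (w x) x) = 0" using u by simp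
      then have "w b = 0" using fv.independentD[OF C(3) fC subset_refl] b by auto
      then show "a b = 0" using b by (simp add: w_def)
    qed (use fC C(2) in auto)
  qed
  from choice[OF this] obtain B where B: "\<forall>e. finite (B e) \<and> B e \<subseteq> Ne e \<and>
    Ne e \<subseteq> fv.span (B e \<union> Q e) \<and>
    (\<forall>a. (\<Sum>b\<in>B e. fscale (a b) b) \<in> fv.span (Q e) \<longrightarrow> (\<forall>b\<in>B e. a b = 0))" ..
  have Bfin: "finite (B e)" and BN: "B e \<subseteq> Ne e"
    and Bgen: "Ne e \<subseteq> fv.span (B e \<union> Q e)" for e using B by auto
  have Bind: "a b = 0" if "(\<Sum>b\<in>B e. fscale (a b) b) \<in> fv.span (Q e)" "b \<in> B e" for e a b
    using B that by blast
  \<comment> \<open>Basis elements must be indexed by naturals, so the generators are enumerated;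
    the degree is stored with each so that \<open>c'\<close> can be read off from the index.
    Nonnegative degrees suffice because \<open>N\<close> is zero in negative ones.\<close>
  define X where "X = Sigma {0..} B"
  have "countable X" unfolding X_def
    by (intro countable_SIGMA) (use Bfin in \<open>auto intro: countable_finite\<close>)
  then have inj: "inj_on (to_nat_on X) X" and inv: "\<And>x. x \<in> X \<Longrightarrow> from_nat_into X (to_nat_on X x) = x"
    by auto
  define J' where "J' = to_nat_on X ` X"
  define c' where "c' j = fst (from_nat_into X j)" for j
  define g where "g j = snd (from_nat_into X j)" for j
  have g: "g j \<in> Ne (c' j)" and g_B: "g j \<in> B (c' j)" and c'0: "0 \<le> c' j"
    and to_nat_g: "to_nat_on X (c' j, g j) = j" if j: "j \<in> J'" for j
  proof -
    obtain x where x: "x \<in> X" "j = to_nat_on X x" using j by (auto simp: J'_def)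
    have "from_nat_into X j = x" using inv x by simp
    then show "g j \<in> B (c' j)" "0 \<le> c' j" "to_nat_on X (c' j, g j) = j"
      using x by (auto simp: X_def g_def c'_def)
    then show "g j \<in> Ne (c' j)" using BN by blast
  qed
  have idx: "to_nat_on X (e, b) \<in> J'" "c' (to_nat_on X (e, b)) = e" "g (to_nat_on X (e, b)) = b"
    if "b \<in> B e" "0 \<le> e" for e b
    using that inv[of "(e, b)"] by (auto simp: J'_def c'_def g_def X_def)
  define d where "d f = (\<Sum>j\<in>keys f. smul (lookup f j) (g j))" for f
  have d_sum: "d f = (\<Sum>j\<in>A. smul (lookup f j) (g j))" if "finite A" "keys f \<subseteq> A" for f A
    unfolding d_def by (rule sum.mono_neutral_left) (use that in \<open>auto simp: in_keys_iff\<close>)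
  have gN: "g j \<in> N" if "j \<in> J'" for j using g[OF that] by (simp add: Ne_def)
  have N_sum: "sum h A \<in> N" if "\<And>i. i \<in> A \<Longrightarrow> h i \<in> N" for h :: "nat \<Rightarrow> _" and A
    using that by (induction A rule: infinite_finite_induct) (auto intro: Nadd N0)
  have dN: "d f \<in> N" if "f \<in> vecs V J'" for f
    unfolding d_def by (rule N_sum) (use that gN in \<open>auto simp: vecs_iff intro!: Nsmul\<close>)
  have d_hom: "graded_hom V J' c' J c d" unfolding graded_hom_def Defs.module_hom_def
  proof (intro conjI CollectI allI ballI)
    show "d \<in> vecs V J' \<rightarrow> vecs V J" using dN NV by blast
    show "d (f \<oplus>\<^bsub>free_module V J'\<^esub> h) = d f \<oplus>\<^bsub>free_module V J\<^esub> d h" for f h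
    proof -
      let ?A = "keys f \<union> keys h"
      have "d (f + h) = (\<Sum>j\<in>?A. smul (lookup (f + h) j) (g j))"
        by (rule d_sum) (auto simp: keys_add)
      also have "\<dots> = (\<Sum>j\<in>?A. smul (lookup f j) (g j)) + (\<Sum>j\<in>?A. smul (lookup h j) (g j))"
        by (simp add: lookup_add smul_add_left sum.distrib)
      finally show ?thesis using d_sum[of ?A f] d_sum[of ?A h] by simp
    qed
    show "d (r \<odot>\<^bsub>free_module V J'\<^esub> f) = r \<odot>\<^bsub>free_module V J\<^esub> d f" for r f
    proof -
      have "keys (smul r f) \<subseteq> keys f" by (auto simp: in_keys_iff)
      then show ?thesis using d_sum[of "keys f" "smul r f"] by (simp add: d_def smul_sum smul_smul)
    qed
    show "d ` vpart V J' c' e \<subseteq> vpart V J c e" for e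
    proof safe
      fix f :: "('v, 'k) vec" assume f: "f \<in> vpart V J' c' e"
      show "d f \<in> vpart V J c e" unfolding d_def
      proof (rule vpart_sum)
        fix j assume "j \<in> keys f"
        then have j: "j \<in> J'" using f by (auto simp: vpart_iff vecs_iff)
        have "lookup f j \<in> hpart V (e - c' j)" using f by (simp add: vpart_iff)
        from vpart_smul[OF this, of "g j" J c "c' j"] g[OF j]
        show "smul (lookup f j) (g j) \<in> vpart V J c e" by (simp add: Ne_def)
      qed
    qed
  qed
  have im_sub: "fv.subspace (d ` vecs V J')" unfolding fv.subspace_def
  proof (intro conjI ballI allI)
    show "0 \<in> d ` vecs V J'" using graded_hom_zero[OF d_hom] vecs_zero by (metis image_eqI)
    fix x y and k :: 'k assume "x \<in> d ` vecs V J'"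
    then obtain f where f: "f \<in> vecs V J'" "x = d f" by blast
    have "fscale k x = d (smul (single 0 k) f)"
      using graded_hom_smul[OF d_hom _ f(1), of "single 0 k"] f(2) by (simp add: fscale_def)
    then show "fscale k x \<in> d ` vecs V J'" using vecs_smul[OF polys_const f(1)] by blast
    assume "y \<in> d ` vecs V J'"
    then obtain h where h: "h \<in> vecs V J'" "y = d h" by blast
    then show "x + y \<in> d ` vecs V J'"
      using f graded_hom_add[OF d_hom f(1) h(1)] vecs_add[OF f(1) h(1)] by (metis image_eqI)
  qed
  \<comment> \<open>Induction on a bound for the degree. It can start at 0 because the generators of
    the ambient module have nonnegative degree.\<close>
  have Ne_im: "\<forall>e. e < int k \<longrightarrow> Ne e \<subseteq> d ` vecs V J'" for k :: nat
  proof (induction k)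
    case 0
    have "f = 0" if "f \<in> Ne e" "e < 0" for f e
    proof (rule poly_mapping_eqI)
      fix j
      show "lookup f j = lookup 0 j"
      proof (cases "j \<in> J")
        case True
        then show ?thesis  using that c[OF True] hpart_neg[of "lookup f j" V "e - c j"]
          by (auto simp: Ne_def vpart_iff)
      next
        case False
        then show ?thesis using that by (auto simp: Ne_def vpart_iff vecs_iff in_keys_iff)
      qed
    qed
    then show ?case using fv.subspace_0[OF im_sub] by fastforce
  next
    case (Suc k)
    show ?case
    proof (intro allI impI)
      fix e assume e: "e < int (Suc k)"
      show "Ne e \<subseteq> d ` vecs V J'"
      proof (cases "e < 0")
        case False
        have "B e \<subseteq> d ` vecs V J'"
        proof
          fix b assume b: "b \<in> B e"
          let ?j = "to_nat_on X (e, b)"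
          have j: "?j \<in> J'" "g ?j = b" using idx[OF b] False by auto
          have "d (single ?j 1) = b" using j(2) by (simp add: d_def)
          then show "b \<in> d ` vecs V J'" using vecs_unit[OF j(1) polys_one] by (metis image_eqI)
        qed
        moreover have "Q e \<subseteq> d ` vecs V J'"
        proof
          fix q assume "q \<in> Q e"
          then obtain x f where xf: "x \<in> V" "f \<in> Ne (e - 1)" "q = smul (Var x) f"
            by (auto simp: Q_def)
          have "e - 1 < int k" using e by simp
          then obtain h where h: "h \<in> vecs V J'" "f = d h" using Suc.IH xf(2) by blast
          then have "q = d (smul (Var x) h)"
            using graded_hom_smul[OF d_hom polys_Var[OF xf(1)] h(1)] xf(3) by simp
          then show "q \<in> d ` vecs V J'" using vecs_smul[OF polys_Var[OF xf(1)] h(1)] by blast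
        qed
        ultimately have "fv.span (B e \<union> Q e) \<subseteq> d ` vecs V J'"
          by (intro fv.span_minimal im_sub) auto
        then show ?thesis using Bgen by blast
      next
        case True
        then show ?thesis using Suc.IH by auto
      qed
    qed
  qed
  have Ne_im: "Ne e \<subseteq> d ` vecs V J'" for e using Ne_im[of "nat (e + 1)"] by auto
  have image: "d ` vecs V J' = N"
  proof
    show "N \<subseteq> d ` vecs V J'"
    proof
      fix f assume f: "f \<in> N"
      have "(\<Sum>e\<in>degrees c f. hcomp c e f) \<in> d ` vecs V J'"
      proof (rule fv.subspace_sum[OF im_sub])
        fix e
        have "hcomp c e f \<in> Ne e" 
          using Ncomp[OF f] hcomp_in_part[of f V J c e] f NV by (auto simp: Ne_def)
        then show "hcomp c e f \<in> d ` vecs V J'" using Ne_im by blast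
      qed
      then show "f \<in> d ` vecs V J'" by (simp add: sum_hcomp)
    qed
  qed (use dN in blast)
  have fin: "finite {j \<in> J'. c' j \<le> e}" for e
  proof -
    have "{j \<in> J'. c' j \<le> e} \<subseteq> to_nat_on X ` Sigma {0..e} B"
    proof
      fix j assume j: "j \<in> {j \<in> J'. c' j \<le> e}"
      then have "(c' j, g j) \<in> Sigma {0..e} B" using g_B[of j] c'0[of j] by auto
      then have "to_nat_on X (c' j, g j) \<in> to_nat_on X ` Sigma {0..e} B" by (rule imageI)
      then show "j \<in> to_nat_on X ` Sigma {0..e} B" using to_nat_g[of j] j by simp
    qed
    then show ?thesis by (rule finite_subset) (use Bfin in auto)
  qed
  have ker: "lookup f j \<in> irrelevant_ideal V" if f: "f \<in> vecs V J'" and df: "d f = 0" for f j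
  proof (cases "j \<in> J'")
    case False
    then have "lookup f j = 0" using f by (auto simp: vecs_iff in_keys_iff)
    then show ?thesis by (simp add: irrelevant_ideal_eq)
  next
    case j: True
    \<comment> \<open>The constant coefficient at \<open>j\<close> sits in the component of degree
      \<open>c' j\<close>, so the relation may be replaced by its component of that degree.\<close>
    define e where "e = c' j"
    define h where "h = hcomp c' e f"
    have h: "h \<in> vpart V J' c' e" unfolding h_def by (rule hcomp_in_part[OF f])
    have dh: "d h = 0" unfolding h_def using graded_hom_hcomp[OF d_hom f] df by simp
    let ?T = "{k \<in> J'. c' k \<le> e}"
    let ?E = "{k \<in> J'. c' k = e}"
    have hk: "lookup h k \<in> hpart V (e - c' k)" for k using h by (simp add: vpart_iff)
    have "keys h \<subseteq> ?T"
    proof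
      fix k assume k: "k \<in> keys h"
      then have "k \<in> J'" using h by (auto simp: vpart_iff vecs_iff)
      moreover have "\<not> e - c' k < 0" using hpart_neg[OF hk[of k]] k by (auto simp: in_keys_iff)
      ultimately show "k \<in> ?T" by simp
    qed
    then have "0 = (\<Sum>k\<in>?T. smul (lookup h k) (g k))" using d_sum[of ?T h] fin dh by simp
    also have "\<dots> = (\<Sum>k\<in>?T - ?E. smul (lookup h k) (g k)) + (\<Sum>k\<in>?E. smul (lookup h k) (g k))"
      by (rule sum.subset_diff) (use fin in auto)
    finally have eq: "(\<Sum>k\<in>?E. smul (lookup h k) (g k)) = - (\<Sum>k\<in>?T - ?E. smul (lookup h k) (g k))"
      by (simp add: eq_neg_iff_add_eq_0 add.commute)
    \<comment> \<open>Generators of degree below \<open>e\<close> occur with coefficients of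
      positive degree, so their share lies in the span of \<open>Q e\<close>. Then so does the share
      of the generators of degree \<open>e\<close>, and \<open>Bind\<close> makes its constant
      coefficients vanish.\<close>
    have mem: "(\<Sum>k\<in>?T - ?E. smul (lookup h k) (g k)) \<in> fv.span (Q e)"
    proof (rule fv.span_sum)
      fix k assume k: "k \<in> ?T - ?E"
      then have "g k \<in> Ne (e - (e - c' k))" using g[of k] by auto
      then show "smul (lookup h k) (g k) \<in> fv.span (Q e)" using Q_smul[OF hk] k by auto
    qed
    have "(\<Sum>k\<in>?E. smul (lookup h k) (g k)) \<in> fv.span (Q e)"
      unfolding eq by (rule fv.span_neg[OF mem])
    also have "(\<Sum>k\<in>?E. smul (lookup h k) (g k)) =
      (\<Sum>b\<in>B e. fscale (lookup (lookup h (to_nat_on X (e, b))) 0) b)"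
    proof (rule sum.reindex_bij_witness[of _ "\<lambda>b. to_nat_on X (e, b)" g])
      fix k assume k: "k \<in> ?E"
      show "to_nat_on X (e, g k) = k" "g k \<in> B e" using to_nat_g[of k] g_B[of k] k by auto
      moreover have "lookup h k = single 0 (lookup (lookup h k) 0)"
        using hpart_0[of "lookup h k" V] hk[of k] k by simp
      ultimately
      show "fscale (lookup (lookup h (to_nat_on X (e, g k))) 0) (g k) = smul (lookup h k) (g k)"
        by (simp add: fscale_def)
    qed (use idx c'0[OF j] in \<open>auto simp: e_def\<close>)
    finally have "lookup (lookup h (to_nat_on X (e, g j))) 0 = 0"
      by (rule Bind) (use g_B[OF j] in \<open>simp add: e_def\<close>)
    then have "lookup (lookup f j) 0 = 0" using to_nat_g[OF j] by (simp add: e_def h_def)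
    then show ?thesis using f by (simp add: irrelevant_ideal_eq vecs_iff)
  qed
  show ?thesis
  proof (intro exI conjI ballI impI allI)
    show "graded_hom V J' c' J c d" by (rule d_hom)
    show "d ` vecs V J' = N" by (rule image)
  qed (use ker c'0 fin in blast)+
qed

section \<open>The residue class ring of a homogeneous ideal and its minimal resolution\<close>

lemma shows carrier_quotient_module: "carrier (quotient_module R I) = a_rcosets\<^bsub>R\<^esub> I"
    and add_quotient_module: "X \<oplus>\<^bsub>quotient_module R I\<^esub> Y = X <+>\<^bsub>R\<^esub> Y"
    and zero_quotient_module: "\<zero>\<^bsub>quotient_module R I\<^esub> = I"
    and smult_quotient_module: "r \<odot>\<^bsub>quotient_module R I\<^esub> X = rcoset_mult R I (I +>\<^bsub>R\<^esub> r) X"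
  by (simp_all add: quotient_module_def ring.defs module.defs FactRing_def)

text \<open>Homogeneous ideals without terms of degree below 2; despite the name, generation in
  degree 2 is not assumed. The bound makes \<open>i + 1\<close> the lowest possible degree of a
  generator in homological degree \<open>i \<ge> 1\<close>.\<close>

locale quadratic_ideal =
  fixes V :: "'v set" and I :: "('v, 'k::field) mpoly set"
  assumes finite_V: "finite V" and ideal: "ideal I (mpoly_ring V)"
    and homogeneous: "p \<in> I \<Longrightarrow> restrict_keys (\<lambda>m. deg m = e) p \<in> I"
    and quadratic: "p \<in> I \<Longrightarrow> lookup p m \<noteq> 0 \<Longrightarrow> 2 \<le> deg m"
begin

abbreviation "R \<equiv> mpoly_ring V :: ('v, 'k) mpoly ring"

abbreviation quot :: "(('v, 'k) mpoly, ('v, 'k) mpoly set) module" where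
  "quot \<equiv> quotient_module R I"

abbreviation quot_part :: "int \<Rightarrow> ('v, 'k) mpoly set set" where
  "quot_part e \<equiv> (\<lambda>p. I +>\<^bsub>R\<^esub> p) ` hpart V e"

sublocale ideal I R by (rule ideal)

lemma quot_add: "p \<in> polys V \<Longrightarrow> q \<in> polys V \<Longrightarrow>
    (I +>\<^bsub>R\<^esub> p) \<oplus>\<^bsub>quot\<^esub> (I +>\<^bsub>R\<^esub> q) = I +>\<^bsub>R\<^esub> (p + q)"
  using a_rcos_sum[of p q] by (simp add: add_quotient_module)

lemma quot_smult: "p \<in> polys V \<Longrightarrow> q \<in> polys V \<Longrightarrow>
    p \<odot>\<^bsub>quot\<^esub> (I +>\<^bsub>R\<^esub> q) = I +>\<^bsub>R\<^esub> (p * q)"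
  using rcoset_mult_add[of p q] by (simp add: smult_quotient_module)

lemma carrier_quot: "carrier quot = (\<lambda>p. I +>\<^bsub>R\<^esub> p) ` polys V"
  by (auto simp: carrier_quotient_module A_RCOSETS_def RCOSETS_def a_r_coset_def)

lemma quot_eq_zero_iff: "p \<in> polys V \<Longrightarrow> I +>\<^bsub>R\<^esub> p = \<zero>\<^bsub>quot\<^esub> \<longleftrightarrow> p \<in> I"
  using a_rcos_const[of p] rcos_const_imp_mem[of p] by (auto simp: zero_quotient_module)

lemma quot_eq_iff:
  assumes "p \<in> polys V" "q \<in> polys V"
  shows "I +>\<^bsub>R\<^esub> p = I +>\<^bsub>R\<^esub> q \<longleftrightarrow> p - q \<in> I"
proof -
  have "a_minus R p q = p - q"
  proof -
    have "a_inv R q = - q"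
      by (rule minus_equality) (use assms in \<open>auto intro: polys_uminus\<close>)
    then show ?thesis by (simp add: a_minus_def)
  qed
  then show ?thesis using quotient_eq_iff_same_a_r_cos[OF ideal, of p q] assms by simp
qed

lemma ideal_irrelevant: "p \<in> I \<Longrightarrow> p \<in> irrelevant_ideal V"
  using ideal_mpoly_ringD(1)[OF ideal] quadratic[of p 0] by (fastforce simp: irrelevant_ideal_eq)

text \<open>\<open>F 0\<close> is \<open>R\<close> itself, and each further module is a minimal
  cover of the kernel of the preceding map, beginning with \<open>I\<close> inside
  \<open>F 0\<close>. The differentials are minimal because the image of each is either
  \<open>I\<close> or the kernel of a minimal cover.\<close>

theorem minimal_resolution_exists:
  "\<exists>J c d \<epsilon>. minimal_graded_free_resolution V quot quot_part J c d \<epsilon>"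
proof -
  define \<epsilon> :: "('v, 'k) vec \<Rightarrow> ('v, 'k) mpoly set" where "\<epsilon> f = I +>\<^bsub>R\<^esub> lookup f 0" for f
  let ?F0 = "vecs V {0} :: ('v, 'k) vec set"
  let ?N = "{f \<in> ?F0. lookup f 0 \<in> I}"
  have kerN: "{x \<in> ?F0. \<epsilon> x = \<zero>\<^bsub>quot\<^esub>} = ?N"
    using quot_eq_zero_iff by (auto simp: \<epsilon>_def vecs_iff)
  have N: "graded_submodule V {0} (\<lambda>_. 0) ?N" unfolding graded_submodule_def
    using ideal_mpoly_ringD[OF ideal] homogeneous
      subsetD[OF vpart_subset hcomp_in_part, of _ V "{0}" "\<lambda>_. 0"]
    by (auto simp: lookup_add lookup_hcomp intro: vecs_add vecs_smul)
  \<comment> \<open>\<open>good\<close> retains what the next cover needs. Its existential part only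
    says that \<open>d\<close> is graded with respect to some target, which is enough to make the
    kernel graded.\<close>
  define good :: "nat set \<times> (nat \<Rightarrow> int) \<times> (('v, 'k) vec \<Rightarrow> ('v, 'k) vec) \<Rightarrow> bool"
    where "good x \<longleftrightarrow> (case x of (J', c', d) \<Rightarrow>
      (\<forall>f\<in>vecs V J'. d f = 0 \<longrightarrow> (\<forall>j. lookup f j \<in> irrelevant_ideal V)) \<and>
      (\<forall>j\<in>J'. 0 \<le> c' j) \<and> (\<forall>e. finite {j \<in> J'. c' j \<le> e}) \<and>
      (\<exists>J c. graded_hom V J' c' J c d))" for x
  define first where "first x \<longleftrightarrow> (case x of (J', c', d) \<Rightarrow>
      graded_hom V J' c' {0} (\<lambda>_. 0) d \<and> d ` vecs V J' = ?N)" for x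
  define step where "step x y \<longleftrightarrow> (case x of (J, c, d) \<Rightarrow> case y of (J', c', d') \<Rightarrow>
      graded_hom V J' c' J c d' \<and> d' ` vecs V J' = {f \<in> vecs V J. d f = 0})"
    for x y :: "nat set \<times> (nat \<Rightarrow> int) \<times> (('v, 'k) vec \<Rightarrow> ('v, 'k) vec)"
  have "\<exists>x. good x \<and> (0 = 0 \<longrightarrow> first x)"
  proof -
    obtain J' c' d where "graded_hom V J' c' {0} (\<lambda>_. 0) d" "d ` vecs V J' = ?N"
      "\<forall>f\<in>vecs V J'. d f = 0 \<longrightarrow> (\<forall>j. lookup f j \<in> irrelevant_ideal V)"
      "\<forall>j\<in>J'. 0 \<le> c' j" "\<forall>e. finite {j \<in> J'. c' j \<le> e}"
      using graded_cover[OF finite_V _ _ N] by auto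
    then have "good (J', c', d) \<and> first (J', c', d)" by (auto simp: good_def first_def)
    then show ?thesis by blast
  qed
  moreover have "\<exists>y. (good y \<and> (Suc n = 0 \<longrightarrow> first y)) \<and> step x y"
    if gx: "good x \<and> (n = 0 \<longrightarrow> first x)" for x n
  proof -
    obtain J c d where x: "x = (J, c, d)" by (cases x)
    obtain J0 c0 where "graded_hom V J c J0 c0 d" using gx by (auto simp: good_def x)
    then have K: "graded_submodule V J c {f \<in> vecs V J. d f = 0}" by (rule graded_submodule_ker)
    obtain J' c' d' where "graded_hom V J' c' J c d'" "d' ` vecs V J' = {f \<in> vecs V J. d f = 0}"
      "\<forall>f\<in>vecs V J'. d' f = 0 \<longrightarrow> (\<forall>j. lookup f j \<in> irrelevant_ideal V)"
      "\<forall>j\<in>J'. 0 \<le> c' j" "\<forall>e. finite {j \<in> J'. c' j \<le> e}"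
      using graded_cover[OF finite_V _ _ K] gx by (auto simp: good_def x)
    then have "good (J', c', d') \<and> step x (J', c', d')" by (auto simp: good_def step_def x)
    then show ?thesis by blast
  qed
  \<comment> \<open>Dependent choice; the condition \<open>first\<close> is imposed at index 0 and
    is vacuous afterwards.\<close>
  ultimately have "\<exists>s. \<forall>n. (good (s n) \<and> (n = 0 \<longrightarrow> first (s n))) \<and> step (s n) (s (Suc n))"
    by (rule dependent_nat_choice[where P = "\<lambda>n x. good x \<and> (n = 0 \<longrightarrow> first x)" and Q = "\<lambda>n. step"])
  then obtain s where s: "\<And>n. good (s n)" "first (s 0)" "\<And>n. step (s n) (s (Suc n))"
    by blast
  \<comment> \<open>Index shift: \<open>s n\<close> describes the module in homological degree
    \<open>n + 1\<close> together with its map to degree \<open>n\<close>.\<close>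
  define J where "J n = (case n of 0 \<Rightarrow> {0} | Suc m \<Rightarrow> fst (s m))" for n
  define c where "c n = (case n of 0 \<Rightarrow> (\<lambda>_. 0) | Suc m \<Rightarrow> fst (snd (s m)))" for n
  define d where "d n = snd (snd (s n))" for n
  have s_eq: "s n = (J (Suc n), c (Suc n), d n)" for n by (simp add: J_def c_def d_def)
  have J0: "J 0 = {0}" and c0: "c 0 = (\<lambda>_. 0)" by (simp_all add: J_def c_def)
  have dhom: "graded_hom V (J (Suc n)) (c (Suc n)) (J n) (c n) (d n)" for n
  proof (cases n)
    case 0
    then show ?thesis using s(2) by (simp add: first_def s_eq J0 c0)
  next
    case (Suc m)
    then show ?thesis using s(3)[of m] by (simp add: step_def s_eq)
  qed
  have im0: "d 0 ` vecs V (J (Suc 0)) = ?N" using s(2) by (simp add: first_def s_eq)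
  have imS: "d (Suc n) ` vecs V (J (Suc (Suc n))) = {f \<in> vecs V (J (Suc n)). d n f = 0}" for n
    using s(3)[of n] by (simp add: step_def s_eq)
  have "minimal_graded_free_resolution V quot quot_part J c d \<epsilon>"
  proof
    fix i e
    show "d i \<in> Defs.module_hom R (free_module V (J (i + 1))) (free_module V (J i))"
      "d i ` vpart V (J (i + 1)) (c (i + 1)) e \<subseteq> vpart V (J i) (c i) e"
      using dhom[of i] by (auto simp: graded_hom_def)
    show "d 0 ` vecs V (J 1) = {x \<in> vecs V (J 0). \<epsilon> x = \<zero>\<^bsub>quot\<^esub>}"
      using im0 kerN by (simp add: J0)
    show "d (i + 1) ` vecs V (J (i + 2)) = {x \<in> vecs V (J (i + 1)). d i x = 0}"
      using imS[of i] by simp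
    show "\<epsilon> \<in> Defs.module_hom R (free_module V (J 0)) quot"
      unfolding Defs.module_hom_def
      by (auto simp: J0 \<epsilon>_def carrier_quot lookup_add quot_add quot_smult vecs_iff)
    show "\<epsilon> ` vpart V (J 0) (c 0) e \<subseteq> quot_part e"
      by (auto simp: J0 c0 \<epsilon>_def vpart_iff)
    show "\<epsilon> ` vecs V (J 0) = carrier quot"
    proof
      show "carrier quot \<subseteq> \<epsilon> ` vecs V (J 0)"
      proof
        fix X assume "X \<in> carrier quot"
        then obtain p where p: "p \<in> polys V" "X = I +>\<^bsub>R\<^esub> p" by (auto simp: carrier_quot)
        then have "X = \<epsilon> (single 0 p)" "single 0 p \<in> vecs V (J 0)"
          by (auto simp: \<epsilon>_def J0 intro: vecs_unit)
        then show "X \<in> \<epsilon> ` vecs V (J 0)" by blast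
      qed
    qed (auto simp: \<epsilon>_def carrier_quot vecs_iff)
    fix x :: "('v, 'k) vec" and j
    assume x: "x \<in> vecs V (J (i + 1))"
    show "lookup (d i x) j \<in> irrelevant_ideal V"
    proof (cases i)
      case 0
      then have "d 0 x \<in> ?N" using im0 x by auto
      then have "lookup (d 0 x) 0 \<in> I" "j \<noteq> 0 \<Longrightarrow> j \<notin> keys (d 0 x)" by (auto simp: vecs_iff)
      then have "lookup (d 0 x) j \<in> I"
        using ideal_mpoly_ringD(2)[OF ideal] by (cases "j = 0") (auto simp: in_keys_iff)
      then show ?thesis using ideal_irrelevant 0 by simp
    next
      case (Suc m)
      then have "d i x \<in> vecs V (J (Suc m))" "d m (d i x) = 0" using imS[of m] x by auto
      moreover have "\<forall>f\<in>vecs V (J (Suc m)). d m f = 0 \<longrightarrow> (\<forall>j. lookup f j \<in> irrelevant_ideal V)"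
        using s(1)[of m] by (simp add: good_def s_eq)
      ultimately show ?thesis by blast
    qed
  qed
  then show ?thesis by blast
qed

end

section \<open>The linear strand of a minimal resolution\<close>

text \<open>For a vector with linear entries this is the cofactor of the variable \<open>x\<close>.
  It is kept as a vector of constant polynomials so that it lies in the same free module and the
  next differential can be applied to it.\<close>

definition linear_coeff :: "'v \<Rightarrow> ('v, 'k::field) vec \<Rightarrow> ('v, 'k) vec" where
  "linear_coeff x f = (\<Sum>j\<in>keys f. single j (single 0 (lookup (lookup f j) (single x 1))))"

lemma lookup_linear_coeff [simp]:
  "lookup (linear_coeff x f) j = single 0 (lookup (lookup f j) (single x 1))"
  by (auto simp: linear_coeff_def lookup_sum lookup_single when_def sum.delta in_keys_iff)

lemma linear_coeff_add: "linear_coeff x (f + g) = linear_coeff x f + linear_coeff x g"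
  by (rule vec_eqI) (simp add: lookup_add lookup_single when_def)

lemma linear_coeff_zero [simp]: "linear_coeff x 0 = 0" by (simp add: linear_coeff_def)

lemma linear_coeff_fscale: "linear_coeff x (fscale k f) = fscale k (linear_coeff x f)"
  by (rule vec_eqI) (simp add: fscale_def lookup_single when_def)

lemma vecs_singleton_eq_0:
  assumes "f \<in> vecs V {j}" "lookup f j = 0" shows "f = 0"
proof (rule poly_mapping_eqI)
  fix i show "lookup f i = lookup 0 i"
    using assms by (cases "i = j") (auto simp: vecs_iff in_keys_iff)
qed

definition constant_vec :: "('v, 'k::field) vec \<Rightarrow> bool" where
  "constant_vec f \<longleftrightarrow> (\<forall>j. lookup f j = single 0 (lookup (lookup f j) 0))"

lemma constant_vecD: "constant_vec f \<Longrightarrow> lookup f j = single 0 (lookup (lookup f j) 0)"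
  by (simp add: constant_vec_def)

lemma single_nat_eq_iff [simp]: "single x (Suc 0) = single y (Suc 0) \<longleftrightarrow> x = y"
  by (metis keys_single singleton_inject nat.distinct(1))

lemma single_add_single_eq_iff:
  "single x (Suc 0) + single y (Suc 0) = single a (Suc 0) + single b (Suc 0) \<longleftrightarrow>
    (x = a \<and> y = b) \<or> (x = b \<and> y = a)"
proof
  assume eq: "single x (Suc 0) + single y (Suc 0) = single a (Suc 0) + single b (Suc 0)"
  have "lookup (single x (Suc 0) + single y (Suc 0)) v =
    lookup (single a (Suc 0) + single b (Suc 0)) v" for v by (simp add: eq)
  from this[of x] this[of y] this[of a] this[of b]
  show "(x = a \<and> y = b) \<or> (x = b \<and> y = a)"
    by (auto simp: lookup_add lookup_single when_def split: if_splits)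
qed (auto simp: add.commute)

lemma lookup_smul_Var_constant:
  assumes "constant_vec f"
  shows "lookup (lookup (smul (Var x) f) j) m = (if m = single x 1 then lookup (lookup f j) 0 else 0)"
proof -
  obtain k where k: "lookup f j = single 0 k" using constant_vecD[OF assms, of j] by blast
  show ?thesis by (simp add: k Var_def mult_single lookup_single when_def)
qed

lemma lookup_smul_Var_Var_constant:
  assumes "constant_vec f" shows "lookup (lookup (smul (Var x) (smul (Var y) f)) j) m =
    (if m = single x 1 + single y 1 then lookup (lookup f j) 0 else 0)"
proof -
  obtain k where k: "lookup f j = single 0 k" using constant_vecD[OF assms, of j] by blast
  show ?thesis by (simp add: k Var_def mult_single lookup_single when_def)
qed

lemma linear_expansion:
  assumes V: "finite V" and f: "\<And>j m. lookup (lookup f j) m \<noteq> 0 \<Longrightarrow> deg m = 1 \<and> keys m \<subseteq> V"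
  shows "f = (\<Sum>x\<in>V. smul (Var x) (linear_coeff x f))"
proof (rule vec_eqI)
  fix j m
  have *: "constant_vec (linear_coeff x f)" for x by (simp add: constant_vec_def)
  have "lookup (lookup (\<Sum>x\<in>V. smul (Var x) (linear_coeff x f)) j) m =
    (\<Sum>x\<in>V. if m = single x 1 then lookup (lookup f j) m else 0)"
    by (simp only: lookup_sum lookup_smul_Var_constant[OF *]) (auto intro!: sum.cong)
  also have "\<dots> = lookup (lookup f j) m"
  proof (cases "lookup (lookup f j) m = 0")
    case False
    then obtain y where y: "m = single y 1" using f degree_one_monomial[of m] by blast
    moreover have "y \<in> V" using f[OF False] y by simp
    ultimately have "(\<Sum>x\<in>V. if m = single x 1 then lookup (lookup f j) m else 0) =
      (\<Sum>x\<in>V. if x = y then lookup (lookup f j) m else 0)" by (intro sum.cong) auto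
    then show ?thesis using V \<open>y \<in> V\<close> by (simp add: sum.delta)
  qed (auto intro!: sum.neutral)
  finally show "lookup (lookup f j) m = lookup (lookup (\<Sum>x\<in>V. smul (Var x) (linear_coeff x f)) j) m" ..
qed

lemma linear_coeff_sum_Var:
  assumes V: "finite V" and w: "\<And>y. y \<in> V \<Longrightarrow> constant_vec (w y)" and x: "x \<in> V"
  shows "linear_coeff x (\<Sum>y\<in>V. smul (Var y) (w y)) = w x"
proof (rule poly_mapping_eqI)
  fix j
  have "lookup (lookup (\<Sum>y\<in>V. smul (Var y) (w y)) j) (single x 1) =
    (\<Sum>y\<in>V. if y = x then lookup (lookup (w y) j) 0 else 0)" unfolding lookup_sum
    by (intro sum.cong refl) (simp only: lookup_smul_Var_constant[OF w], auto)
  also have "\<dots> = lookup (lookup (w x) j) 0" using V x by (simp add: sum.delta)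
  finally show "lookup (linear_coeff x (\<Sum>y\<in>V. smul (Var y) (w y))) j = lookup (w x) j"
    using constant_vecD[OF w[OF x], of j] by simp
qed

text \<open>Compare coefficients at the monomials \<open>a b\<close> and \<open>a^2\<close>. The
  vanishing of \<open>w a a\<close> is a separate conclusion because antisymmetry does not imply it
  in characteristic 2.\<close>

lemma quadratic_relation:
  assumes V: "finite V" and w: "\<And>x y. x \<in> V \<Longrightarrow> y \<in> V \<Longrightarrow> constant_vec (w x y)"
    and 0: "(\<Sum>x\<in>V. smul (Var x) (\<Sum>y\<in>V. smul (Var y) (w x y))) = 0" and a: "a \<in> V" and b: "b \<in> V"
  shows "w a b = - w b a" and "w a a = 0"
proof -
  have "constant_vec (- w b a)" using w[OF b a] by (simp add: constant_vec_def single_uminus)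
  have coeff: "(\<Sum>x\<in>V. \<Sum>y\<in>V. if single p 1 + single q 1 = single x (1::nat) + single y 1
      then lookup (lookup (w x y) j) 0 else 0) = 0" (is "(\<Sum>x\<in>V. \<Sum>y\<in>V. ?t p q j x y) = 0") for p q j
  proof -
    have "0 = lookup (lookup (\<Sum>x\<in>V. smul (Var x) (\<Sum>y\<in>V. smul (Var y) (w x y))) j) (single p 1 + single q 1)"
      by (simp add: 0)
    also have "\<dots> = (\<Sum>x\<in>V. \<Sum>y\<in>V. lookup (lookup (smul (Var x) (smul (Var y) (w x y))) j) (single p 1 + single q 1))"
      by (simp only: smul_sum lookup_sum)
    also have "\<dots> = (\<Sum>x\<in>V. \<Sum>y\<in>V. ?t p q j x y)"
      by (intro sum.cong refl) (simp only: lookup_smul_Var_Var_constant[OF w])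
    finally show ?thesis by simp
  qed
  have diag: "w a a = 0" if a: "a \<in> V" for a
  proof (rule poly_mapping_eqI)
    fix j
    have "(\<Sum>x\<in>V. \<Sum>y\<in>V. ?t a a j x y) =
      (\<Sum>x\<in>V. if x = a then (\<Sum>y\<in>V. if y = a then lookup (lookup (w a a) j) 0 else 0) else 0)"
      by (intro sum.cong refl) (auto simp: single_add_single_eq_iff intro!: sum.cong sum.neutral)
    also have "\<dots> = lookup (lookup (w a a) j) 0" using V a by (simp add: sum.delta)
    finally show "lookup (w a a) j = lookup 0 j"
      using coeff[of a a j] constant_vecD[OF w[OF a a], of j] by simp
  qed
  show "w a a = 0" by (rule diag[OF a])
  show "w a b = - w b a"
  proof (cases "a = b")
    case True
    then show ?thesis using diag[OF a] by simp
  next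
    case False
    show ?thesis
    proof (rule poly_mapping_eqI)
      fix j
      have "(\<Sum>x\<in>V. \<Sum>y\<in>V. ?t a b j x y) =
        (\<Sum>x\<in>V. (if x = a then (\<Sum>y\<in>V. if y = b then lookup (lookup (w a b) j) 0 else 0) else 0)
          + (if x = b then (\<Sum>y\<in>V. if y = a then lookup (lookup (w b a) j) 0 else 0) else 0))"
        using False
        by (intro sum.cong refl) (auto simp: single_add_single_eq_iff intro!: sum.cong sum.neutral)
      also have "\<dots> = lookup (lookup (w a b) j) 0 + lookup (lookup (w b a) j) 0"
        using V a b by (simp add: sum.delta sum.distrib)
      finally have "lookup (lookup (w a b) j) 0 = - lookup (lookup (w b a) j) 0"
        using coeff[of a b j] by (simp add: eq_neg_iff_add_eq_0)
      then show "lookup (w a b) j = lookup (- w b a) j"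
        using constant_vecD[OF w[OF a b], of j] constant_vecD[OF w[OF b a], of j]
        by (metis lookup_uminus single_uminus)
    qed
  qed
qed

text \<open>Off the diagonal the terms cancel in pairs; the diagonal is assumed to vanish, since
  antisymmetry alone does not force this in characteristic 2.\<close>

lemma alternating_sum_eq_0:
  fixes g :: "'a \<Rightarrow> 'a \<Rightarrow> 'b::ab_group_add"
  assumes "finite A" "\<And>x y. x \<in> A \<Longrightarrow> y \<in> A \<Longrightarrow> g x y = - g y x" "\<And>x. x \<in> A \<Longrightarrow> g x x = 0"
  shows "(\<Sum>x\<in>A. \<Sum>y\<in>A. g x y) = 0" using assms
proof (induction A rule: finite_induct)
  case (insert a A)
  have "(\<Sum>x\<in>insert a A. \<Sum>y\<in>insert a A. g x y) =
    g a a + (\<Sum>y\<in>A. g a y) + ((\<Sum>x\<in>A. g x a) + (\<Sum>x\<in>A. \<Sum>y\<in>A. g x y))"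
    using insert.hyps by (simp add: sum.distrib)
  also have "(\<Sum>x\<in>A. g x a) = (\<Sum>x\<in>A. - g a x)"
    by (intro sum.cong refl) (use insert.prems(1) in blast)
  also have "(\<Sum>x\<in>A. \<Sum>y\<in>A. g x y) = 0" by (rule insert.IH; rule insert.prems; simp)
  finally show ?case using insert.prems(2)[of a] by (simp add: sum_negf)
qed simp

text \<open>
  \<open>strand V I n\<close> describes the cycles of the Koszul complex of \<open>I\<close> in homological degree \<open>n\<close> and
  internal degree \<open>n + 2\<close>: a function on the lists of \<open>n\<close> variables stands for an element of
  \<open>\<And>\<^sup>n R\<^sub>1 \<otimes> I\<^sub>2\<close>.
\<close>

fun strand :: "'v set \<Rightarrow> ('v, 'k::field) mpoly set \<Rightarrow> nat \<Rightarrow> ('v list \<Rightarrow> ('v, 'k) mpoly) \<Rightarrow> bool" where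
  "strand V I 0 \<phi> \<longleftrightarrow> \<phi> [] \<in> I \<inter> hpart V 2"
| "strand V I (Suc 0) \<phi> \<longleftrightarrow>
    (\<forall>x\<in>V. strand V I 0 (\<lambda>xs. \<phi> (x # xs))) \<and> (\<Sum>x\<in>V. Var x * \<phi> [x]) = 0"
| "strand V I (Suc (Suc n)) \<phi> \<longleftrightarrow>
    (\<forall>x\<in>V. strand V I (Suc n) (\<lambda>xs. \<phi> (x # xs))) \<and>
    (\<forall>x\<in>V. \<forall>y\<in>V. \<forall>xs. length xs = n \<and> set xs \<subseteq> V \<longrightarrow>
      \<phi> (x # y # xs) = - \<phi> (y # x # xs) \<and> \<phi> (x # x # xs) = 0)"

lemma strand_Suc: "strand V I (Suc n) \<phi> \<Longrightarrow> x \<in> V \<Longrightarrow> strand V I n (\<lambda>xs. \<phi> (x # xs))"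
  by (cases n) auto

section \<open>The lowest-degree part of an arbitrary minimal resolution\<close>

locale quadratic_resolution = quadratic_ideal V I +
  minimal_graded_free_resolution V "quotient_module (mpoly_ring V) I"
    "\<lambda>e. (\<lambda>p. I +>\<^bsub>mpoly_ring V\<^esub> p) ` hpart V e" J c d \<epsilon>
  for V :: "'v set" and I :: "('v, 'k::field) mpoly set" and J c d \<epsilon>
begin

lemma d_hom: "graded_hom V (J (Suc i)) (c (Suc i)) (J i) (c i) (d i)"
  using differential_hom[of i] differential_graded[of i] by (simp add: graded_hom_def)

lemma d_minimal: "x \<in> vecs V (J (Suc i)) \<Longrightarrow> lookup (lookup (d i x) j) 0 = 0"
  using minimal[of x i j] by (simp add: irrelevant_ideal_eq)

lemma ker_d:
  assumes "x \<in> vecs V (J (Suc i))" "d i x = 0"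
  obtains y where "y \<in> vecs V (J (Suc (Suc i)))" "d (Suc i) y = x"
proof -
  have "x \<in> d (Suc i) ` vecs V (J (Suc (Suc i)))" using exact_at_Suc[of i] assms by simp
  then show ?thesis using that by blast
qed

lemma d_d: "y \<in> vecs V (J (Suc (Suc i))) \<Longrightarrow> d i (d (Suc i) y) = 0"
  using exact_at_Suc[of i] by auto

text \<open>A cycle is an image under the next differential, hence lies in the irrelevant ideal
  times the module.\<close>

lemma ker_d_constant: "x \<in> vecs V (J (Suc i)) \<Longrightarrow> d i x = 0 \<Longrightarrow> lookup (lookup x j) 0 = 0"
  using ker_d[of x i] d_minimal[of _ "Suc i" j] by metis

lemma ker_\<epsilon>_constant: "x \<in> vecs V (J 0) \<Longrightarrow> \<epsilon> x = \<zero>\<^bsub>quot\<^esub> \<Longrightarrow> lookup (lookup x j) 0 = 0"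
  using exact_at_0 d_minimal[of _ 0 j] by fastforce

text \<open>Every minimal resolution begins with \<open>R\<close>. Since 1 is in the image and
  elements of \<open>I\<close> have no constant term, some generator maps to the class of a nonzero
  constant. A second generator could be corrected by a multiple of the first to a kernel element
  with coefficient 1, against minimality.\<close>

lemma F0:
  obtains j where "J 0 = {j}" "c 0 j = 0"
    "\<And>f. f \<in> vecs V (J 0) \<Longrightarrow> \<epsilon> f = \<zero>\<^bsub>quot\<^esub> \<longleftrightarrow> lookup f j \<in> I"
proof -
  have \<epsilon>_add: "\<epsilon> (f + g) = \<epsilon> f \<oplus>\<^bsub>quot\<^esub> \<epsilon> g" if "f \<in> vecs V (J 0)" "g \<in> vecs V (J 0)" for f g
    using augmentation_hom that by (auto simp: Defs.module_hom_def)
  have \<epsilon>_smul: "\<epsilon> (smul r f) = r \<odot>\<^bsub>quot\<^esub> \<epsilon> f" if "r \<in> polys V" "f \<in> vecs V (J 0)" for f r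
    using augmentation_hom that by (auto simp: Defs.module_hom_def)
  have \<epsilon>_cl: "\<epsilon> f \<in> carrier quot" if "f \<in> vecs V (J 0)" for f
    using exact_at_module that by blast
  have "\<exists>p. p \<in> hpart V (c 0 j) \<and> \<epsilon> (single j 1) = I +>\<^bsub>R\<^esub> p" if "j \<in> J 0" for j
    using augmentation_graded[of "c 0 j"] vpart_unit[OF that, of 1 V 0 "c 0"]
      hpart_const[of 1 V] by auto
  then obtain p where p: "\<And>j. j \<in> J 0 \<Longrightarrow> p j \<in> hpart V (c 0 j)"
    "\<And>j. j \<in> J 0 \<Longrightarrow> \<epsilon> (single j 1) = I +>\<^bsub>R\<^esub> p j"
    by metis
  have pV: "p j \<in> polys V" if "j \<in> J 0" for j using p(1)[OF that] by (simp add: homogeneous_part_def)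
  have \<epsilon>0: "\<epsilon> 0 = I +>\<^bsub>R\<^esub> 0"
  proof -
    obtain q where "q \<in> polys V" "\<epsilon> 0 = I +>\<^bsub>R\<^esub> q"
      using \<epsilon>_cl[OF vecs_zero] by (auto simp: carrier_quot)
    then show ?thesis using \<epsilon>_smul[OF polys_zero vecs_zero] quot_smult[OF polys_zero, of q] by simp
  qed
  have \<epsilon>_sum: "\<epsilon> (\<Sum>j\<in>A. smul (r j) (single j 1)) = I +>\<^bsub>R\<^esub> (\<Sum>j\<in>A. r j * p j)"
    if "finite A" "A \<subseteq> J 0" "\<And>j. j \<in> A \<Longrightarrow> r j \<in> polys V" for A r
    using that
  proof (induction A rule: finite_induct)
    case (insert j A)
    have v: "single j 1 \<in> vecs V (J 0)" using insert.prems(1) by (auto intro: vecs_unit)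
    have j: "j \<in> J 0" and rj: "r j \<in> polys V" using insert.prems by auto
    have s: "(\<Sum>j\<in>A. smul (r j) (single j 1)) \<in> vecs V (J 0)"
      by (intro vecs_sum vecs_smul vecs_unit) (use insert.prems in auto)
    have rp: "(\<Sum>j\<in>A. r j * p j) \<in> polys V"
      by (intro polys_sum polys_mult) (use insert.prems pV in auto)
    have IH: "\<epsilon> (\<Sum>j\<in>A. smul (r j) (single j 1)) = I +>\<^bsub>R\<^esub> (\<Sum>j\<in>A. r j * p j)"
      by (rule insert.IH) (use insert.prems in auto)
    have "\<epsilon> (\<Sum>j\<in>insert j A. smul (r j) (single j 1)) =
      (I +>\<^bsub>R\<^esub> (r j * p j)) \<oplus>\<^bsub>quot\<^esub> (I +>\<^bsub>R\<^esub> (\<Sum>j\<in>A. r j * p j))"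
      unfolding sum.insert[OF insert.hyps(1,2)] \<epsilon>_add[OF vecs_smul[OF rj v] s] IH
        \<epsilon>_smul[OF rj v] p(2)[OF j] quot_smult[OF rj pV[OF j]] ..
    also have "\<dots> = I +>\<^bsub>R\<^esub> (\<Sum>j\<in>insert j A. r j * p j)"
      unfolding sum.insert[OF insert.hyps(1,2)] by (rule quot_add[OF polys_mult[OF rj pV[OF j]] rp])
    finally show ?case .
  qed (use \<epsilon>0 in simp)
  have "I +>\<^bsub>R\<^esub> 1 \<in> \<epsilon> ` vecs V (J 0)"
    unfolding exact_at_module carrier_quot by (rule imageI[OF polys_one])
  then obtain f where f: "f \<in> vecs V (J 0)" "\<epsilon> f = I +>\<^bsub>R\<^esub> 1" by auto
  have "\<epsilon> f = I +>\<^bsub>R\<^esub> (\<Sum>j\<in>keys f. lookup f j * p j)"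
    by (subst vecs_decomp[of f], rule \<epsilon>_sum) (use f(1) in \<open>auto simp: vecs_iff\<close>)
  moreover have "(\<Sum>j\<in>keys f. lookup f j * p j) \<in> polys V"
    by (intro polys_sum polys_mult) (use f(1) pV in \<open>auto simp: vecs_iff\<close>)
  ultimately have "1 - (\<Sum>j\<in>keys f. lookup f j * p j) \<in> I"
    using f(2) quot_eq_iff[OF polys_one] by simp
  from quadratic[OF this, of 0] have "(\<Sum>j\<in>keys f. lookup (lookup f j) 0 * lookup (p j) 0) = 1"
    by (auto simp: lookup_minus lookup_sum lookup_times_zero)
  then obtain j where j: "j \<in> keys f" "lookup (p j) 0 \<noteq> 0"
    by (metis (no_types, lifting) mult_zero_right sum.neutral zero_neq_one)
  have jJ: "j \<in> J 0" using f(1) j(1) by (auto simp: vecs_iff)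
  have cj: "c 0 j = 0" using p(1)[OF jJ] j(2) by (force simp: hpart_iff)
  define \<kappa> where "\<kappa> = lookup (p j) 0"
  have pj: "p j = single 0 \<kappa>"
    unfolding \<kappa>_def by (rule hpart_0) (use p(1)[OF jJ] cj in simp)
  have J0: "J 0 = {j}"
  proof (rule ccontr)
    assume "J 0 \<noteq> {j}"
    then obtain k where k: "k \<in> J 0" "k \<noteq> j" using jJ by blast
    \<comment> \<open>Coefficients of the kernel element: generator \<open>k\<close> minus
      \<open>p k / \<kappa>\<close> times generator \<open>j\<close>.\<close>
    define r where "r l = (if l = k then 1 else - (single 0 (1 / \<kappa>) * p k))" for l
    let ?g = "\<Sum>l\<in>{k, j}. smul (r l) (single l 1)"
    have r: "r l \<in> polys V" for l by (auto simp: r_def intro!: polys_uminus polys_mult pV k)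
    have "\<epsilon> ?g = I +>\<^bsub>R\<^esub> (\<Sum>l\<in>{k, j}. r l * p l)"
      by (rule \<epsilon>_sum) (use k jJ r in auto)
    also have "(\<Sum>l\<in>{k, j}. r l * p l) = p k - single 0 (1 / \<kappa>) * single 0 \<kappa> * p k"
      using k(2) by (simp add: r_def pj mult_ac)
    also have "\<dots> = 0" using j(2) by (simp add: mult_single \<kappa>_def)
    finally have "\<epsilon> ?g = \<zero>\<^bsub>quot\<^esub>"
      using quot_eq_zero_iff[OF polys_zero] ideal_mpoly_ringD(2)[OF ideal] by simp
    moreover have "?g \<in> vecs V (J 0)"
      by (intro vecs_sum vecs_smul vecs_unit r) (use k jJ in auto)
    ultimately have "lookup (lookup ?g k) 0 = 0" by (rule ker_\<epsilon>_constant[rotated])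
    then show False using k(2) by (simp add: r_def lookup_add lookup_single)
  qed
  show ?thesis
  proof (rule that[OF J0 cj])
    fix g :: "('v, 'k) vec" assume g: "g \<in> vecs V (J 0)"
    have gj: "lookup g j \<in> polys V" using g by (simp add: vecs_iff)
    have "g = (\<Sum>l\<in>{j}. smul (lookup g l) (single l 1))"
    proof (rule poly_mapping_eqI)
      fix l
      have "lookup g l = 0" if "l \<noteq> j" using g that by (auto simp: vecs_iff J0 in_keys_iff)
      then show "lookup g l = lookup (\<Sum>l\<in>{j}. smul (lookup g l) (single l 1)) l"
        by (auto simp: lookup_single when_def)
    qed
    then have "\<epsilon> g = \<epsilon> (\<Sum>l\<in>{j}. smul (lookup g l) (single l 1))" by simp
    also have "\<dots> = I +>\<^bsub>R\<^esub> (\<Sum>l\<in>{j}. lookup g l * p l)"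
      by (rule \<epsilon>_sum) (use jJ gj in auto)
    finally have "\<epsilon> g = I +>\<^bsub>R\<^esub> (lookup g j * p j)" by simp
    then have "\<epsilon> g = \<zero>\<^bsub>quot\<^esub> \<longleftrightarrow> lookup g j * p j \<in> I"
      using quot_eq_zero_iff[of "lookup g j * p j"] polys_mult[OF gj pV[OF jJ]] by simp
    also have "\<dots> \<longleftrightarrow> lookup g j \<in> I"
    proof
      assume "lookup g j * p j \<in> I"
      from ideal_mpoly_ringD(4)[OF ideal polys_const this, of "1 / \<kappa>"]
      have "(single 0 (1 / \<kappa>) * single 0 \<kappa>) * lookup g j \<in> I" by (simp add: pj mult_ac)
      then show "lookup g j \<in> I" using j(2) by (simp add: mult_single \<kappa>_def)
    qed (use ideal_mpoly_ringD(4)[OF ideal pV[OF jJ]] in \<open>metis mult.commute\<close>)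
    finally show "\<epsilon> g = \<zero>\<^bsub>quot\<^esub> \<longleftrightarrow> lookup g j \<in> I" .
  qed
qed

definition "j0 = the_elem (J 0)"

lemma J_0: "J 0 = {j0}" and c_0: "c 0 j0 = 0"
  and \<epsilon>_eq_0_iff: "f \<in> vecs V (J 0) \<Longrightarrow> \<epsilon> f = \<zero>\<^bsub>quot\<^esub> \<longleftrightarrow> lookup f j0 \<in> I"
  by (rule F0; simp add: j0_def)+

lemma d_0_image: "f \<in> vecs V (J (Suc 0)) \<Longrightarrow> lookup (d 0 f) j0 \<in> I"
  using exact_at_0 \<epsilon>_eq_0_iff by fastforce

text \<open>Minimality makes generator degrees grow: the image of a basis element is nonzero and has
  only coefficients of positive degree. The start at 2 is the bound on the terms of
  \<open>I\<close>.\<close>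

lemma c_ge: "j \<in> J (Suc i) \<Longrightarrow> int i + 2 \<le> c (Suc i) j"
proof (induction i arbitrary: j)
  case (0 j)
  let ?x = "d 0 (single j 1)"
  have v: "single j 1 \<in> vecs V (J (Suc 0))" using 0 by (auto intro: vecs_unit)
  have "?x \<in> vpart V (J 0) (c 0) (c (Suc 0) j)" by (rule graded_hom_part[OF d_hom])
      (use vpart_unit[OF 0 hpart_const[of 1], of V "c (Suc 0)"] in simp)
  then have x: "?x \<in> vecs V (J 0)" "lookup ?x j0 \<in> hpart V (c (Suc 0) j)"
    using c_0 by (auto simp: vpart_iff dest: spec[of _ j0])
  \<comment> \<open>Otherwise the basis element would be a cycle with constant coefficient
    1.\<close>
  have "?x \<noteq> 0" using ker_d_constant[OF v, of j] by auto
  then have "lookup ?x j0 \<noteq> 0" using x(1) vecs_singleton_eq_0[of ?x V j0] J_0 by auto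
  then obtain m where m: "lookup (lookup ?x j0) m \<noteq> 0" by (metis lookup_zero poly_mapping_eqI)
  show ?case using quadratic[OF d_0_image[OF v] m] x(2) m by (auto simp: hpart_iff)
next
  case (Suc i j)
  let ?x = "d (Suc i) (single j 1)"
  have v: "single j 1 \<in> vecs V (J (Suc (Suc i)))" using Suc.prems by (auto intro: vecs_unit)
  have x: "?x \<in> vpart V (J (Suc i)) (c (Suc i)) (c (Suc (Suc i)) j)"
    by (rule graded_hom_part[OF d_hom])
      (use vpart_unit[OF Suc.prems hpart_const[of 1], of V "c (Suc (Suc i))"] in simp)
  have "?x \<noteq> 0" using ker_d_constant[OF v, of j] by auto
  then obtain k m where km: "lookup (lookup ?x k) m \<noteq> 0" by (metis lookup_zero vec_eqI)
  have "k \<in> J (Suc i)"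
    using x km by (auto simp: vpart_iff vecs_iff in_keys_iff) (metis lookup_zero in_keys_iff subsetD)
  then have "int i + 2 \<le> c (Suc i) k" by (rule Suc.IH)
  moreover have "deg m = c (Suc (Suc i)) j - c (Suc i) k"
    using x km by (auto simp: vpart_iff hpart_iff)
  moreover have "m \<noteq> 0" using d_minimal[OF v] km by auto
  then have "deg m \<ge> 1" using monomial_degree_eq_0_iff[of m] by linarith
  ultimately show ?case by simp
qed

text \<open>By \<open>c_ge\<close> this is the lowest degree in which the module in homological
  degree \<open>n + 1\<close> can be nonzero, so \<open>L n\<close> is the span over the field of
  the generators that the Betti number counts.\<close>

abbreviation "L n \<equiv> vpart V (J (Suc n)) (c (Suc n)) (int n + 2)"

lemma L_vecs: "u \<in> L n \<Longrightarrow> u \<in> vecs V (J (Suc n))" by (simp add: vpart_iff)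

lemma L_constant:
  assumes "u \<in> L n" shows "constant_vec u" unfolding constant_vec_def
proof
  fix j
  have h: "lookup u j \<in> hpart V (int n + 2 - c (Suc n) j)" using assms by (simp add: vpart_iff)
  show "lookup u j = single 0 (lookup (lookup u j) 0)"
  proof (cases "j \<in> J (Suc n) \<and> c (Suc n) j = int n + 2")
    case True
    then show ?thesis using hpart_0 h by simp
  next
    case False
    have "lookup u j = 0"
    proof (cases "j \<in> J (Suc n)")
      case True
      then show ?thesis using hpart_neg[OF h] c_ge[OF True] False by simp
    qed (use L_vecs[OF assms] in \<open>auto simp: vecs_iff in_keys_iff\<close>)
    then show ?thesis by simp
  qed
qed

text \<open>Cycles have no constant coefficients, while elements of \<open>L n\<close> have no
  others.\<close>

lemma L_inj:
  assumes "u \<in> L n" "d n u = 0" shows "u = 0"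
proof (rule poly_mapping_eqI)
  fix j show "lookup u j = lookup 0 j"
    using ker_d_constant[OF L_vecs[OF assms(1)] assms(2), of j] constant_vecD[OF L_constant[OF assms(1)], of j]
    by simp
qed

lemma L_fscale: "u \<in> L n \<Longrightarrow> fscale k u \<in> L n"
  using vpart_smul[OF hpart_const, of u V "J (Suc n)"] by (simp add: fscale_def)

lemma L_uminus: "u \<in> L n \<Longrightarrow> - u \<in> L n" using L_fscale[of u n "-1"] by simp

lemma d_fscale: "u \<in> vecs V (J (Suc n)) \<Longrightarrow> d n (fscale k u) = fscale k (d n u)"
  unfolding fscale_def by (rule graded_hom_smul[OF d_hom polys_const])

text \<open>The image of \<open>u\<close> has degree \<open>n + 3\<close> in a module whose
  generators have degree at least \<open>n + 2\<close>, and minimality excludes constant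
  coefficients. Only linear coefficients at generators of degree exactly \<open>n + 2\<close>
  remain.\<close>

lemma
  assumes "u \<in> L (Suc n)"
  shows linear_coeff_d: "x \<in> V \<Longrightarrow> linear_coeff x (d (Suc n) u) \<in> L n"
    and d_expansion: "d (Suc n) u = (\<Sum>x\<in>V. smul (Var x) (linear_coeff x (d (Suc n) u)))"
proof -
  let ?f = "d (Suc n) u"
  have f: "?f \<in> vpart V (J (Suc n)) (c (Suc n)) (int n + 3)"
    using graded_hom_part[OF d_hom assms] by (simp add: algebra_simps)
  have key: "deg m = 1 \<and> keys m \<subseteq> V \<and> c (Suc n) j = int n + 2 \<and> j \<in> J (Suc n)"
    if "lookup (lookup ?f j) m \<noteq> 0" for j m
  proof -
    have m: "deg m = int n + 3 - c (Suc n) j" "keys m \<subseteq> V"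
      using f that by (auto simp: vpart_iff hpart_iff)
    have "lookup ?f j \<noteq> 0" using that by auto
    then have j: "j \<in> J (Suc n)" using f by (auto simp: vpart_iff vecs_iff in_keys_iff)
    have "m \<noteq> 0" using d_minimal[OF L_vecs[OF assms], of j] that by auto
    then have "deg m \<ge> 1" using monomial_degree_eq_0_iff[of m] by linarith
    then show ?thesis using m j c_ge[OF j] by auto
  qed
  show "?f = (\<Sum>x\<in>V. smul (Var x) (linear_coeff x ?f))"
    by (rule linear_expansion[OF finite_V]) (use key in blast)
  show "linear_coeff x ?f \<in> L n" if "x \<in> V"
  proof -
    have "lookup (linear_coeff x ?f) j \<in> hpart V (int n + 2 - c (Suc n) j)" for j
      using key[of j "single x 1"] by (cases "lookup (lookup ?f j) (single x 1) = 0") auto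
    moreover have "keys (linear_coeff x ?f) \<subseteq> J (Suc n)"
      using key[of _ "single x 1"] by (auto simp: in_keys_iff)
    ultimately show ?thesis by (auto simp: vpart_iff vecs_iff)
  qed
qed

text \<open>The head of the list is the variable split off at the highest differential. After
  \<open>length xs\<close> steps the element has reached \<open>L 0\<close>, whose image in
  \<open>R\<close> is a quadric of \<open>I\<close>; this quadric is the value at \<open>xs\<close>
  of the Koszul cycle belonging to \<open>u\<close>.\<close>

primrec strand_map :: "'v list \<Rightarrow> ('v, 'k) vec \<Rightarrow> ('v, 'k) mpoly" where
  "strand_map [] u = lookup (d 0 u) j0"
| "strand_map (x # xs) u = strand_map xs (linear_coeff x (d (Suc (length xs)) u))"

lemma strand_map_add:
  "u \<in> L (length xs) \<Longrightarrow> v \<in> L (length xs) \<Longrightarrow> set xs \<subseteq> V \<Longrightarrow>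
    strand_map xs (u + v) = strand_map xs u + strand_map xs v"
proof (induction xs arbitrary: u v)
  case Nil
  then show ?case using graded_hom_add[OF d_hom L_vecs L_vecs] by (simp add: lookup_add)
next
  case (Cons x xs)
  then have "d (Suc (length xs)) (u + v) = d (Suc (length xs)) u + d (Suc (length xs)) v"
    by (intro graded_hom_add[OF d_hom L_vecs L_vecs]) auto
  then show ?case using Cons by (simp add: linear_coeff_add linear_coeff_d)
qed

lemma strand_map_fscale:
  "u \<in> L (length xs) \<Longrightarrow> set xs \<subseteq> V \<Longrightarrow> strand_map xs (fscale k u) = single 0 k * strand_map xs u"
proof (induction xs arbitrary: u)
  case Nil
  then show ?case using d_fscale[OF L_vecs, of u 0 k] by (simp add: fscale_def)
next
  case (Cons x xs)
  then have "d (Suc (length xs)) (fscale k u) = fscale k (d (Suc (length xs)) u)"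
    by (intro d_fscale L_vecs) auto
  then show ?case using Cons by (simp add: linear_coeff_fscale linear_coeff_d)
qed

lemma strand_map_zero: "set xs \<subseteq> V \<Longrightarrow> strand_map xs 0 = 0"
  using strand_map_fscale[of 0 xs 0] by simp

lemma strand_map_uminus:
  assumes "u \<in> L (length xs)" "set xs \<subseteq> V"
  shows "strand_map xs (- u) = - strand_map xs u"
proof -
  have "strand_map xs (- u) + strand_map xs u = strand_map xs (- u + u)"
    using assms by (intro strand_map_add[symmetric] L_uminus)
  then show ?thesis using strand_map_zero[OF assms(2)] by (simp add: eq_neg_iff_add_eq_0)
qed

lemma strand_map_sum:
  assumes "finite A" "\<And>i. i \<in> A \<Longrightarrow> f i \<in> L (length xs)" "set xs \<subseteq> V"
  shows "strand_map xs (sum f A) = (\<Sum>i\<in>A. strand_map xs (f i))"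
  using assms by (induction A rule: finite_induct)
    (auto simp: strand_map_zero strand_map_add vpart_sum)

text \<open>Vanishing propagates upward: if all linear coefficients are zero then
  \<open>d n u = 0\<close>, and the differential is injective on \<open>L n\<close>.\<close>

lemma strand_map_inj:
  assumes "u \<in> L n" "\<And>xs. length xs = n \<Longrightarrow> set xs \<subseteq> V \<Longrightarrow> strand_map xs u = 0"
  shows "u = 0" using assms
proof (induction n arbitrary: u)
  case 0
  have x: "lookup (d 0 u) j0 = 0" "d 0 u \<in> vecs V {j0}"
    using 0 graded_hom_closed[OF d_hom L_vecs[OF 0(1)]] J_0 by auto
  have "d 0 u = 0" by (rule vecs_singleton_eq_0[OF x(2,1)])
  then show ?case by (rule L_inj[OF 0(1)])
next
  case (Suc n)
  have "linear_coeff x (d (Suc n) u) = 0" if x: "x \<in> V" for x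
  proof (rule Suc.IH[OF linear_coeff_d[OF Suc.prems(1) x]])
    fix xs :: "'v list" assume "length xs = n" "set xs \<subseteq> V"
    then show "strand_map xs (linear_coeff x (d (Suc n) u)) = 0"
      using Suc.prems(2)[of "x # xs"] x by simp
  qed
  then have "d (Suc n) u = 0" using d_expansion[OF Suc.prems(1)] by simp
  then show ?case by (rule L_inj[OF Suc.prems(1)])
qed

lemma d_sum_Var:
  assumes "\<And>x. x \<in> V \<Longrightarrow> w x \<in> vecs V (J (Suc n))"
  shows "d n (\<Sum>x\<in>V. smul (Var x) (w x)) = (\<Sum>x\<in>V. smul (Var x) (d n (w x)))"
proof -
  have "d n (\<Sum>x\<in>V. smul (Var x) (w x)) = (\<Sum>x\<in>V. d n (smul (Var x) (w x)))"
    by (rule graded_hom_sum[OF d_hom]) (use assms in \<open>auto intro: vecs_smul polys_Var\<close>)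
  also have "\<dots> = (\<Sum>x\<in>V. smul (Var x) (d n (w x)))"
    by (intro sum.cong refl graded_hom_smul[OF d_hom]) (use assms in \<open>auto intro: polys_Var\<close>)
  finally show ?thesis .
qed

text \<open>Consecutive differentials compose to zero; expanding both into linear coefficients turns
  this into an instance of \<open>quadratic_relation\<close>.\<close>

lemma second_coeff:
  assumes u: "u \<in> L (Suc (Suc n))" and x: "x \<in> V" and y: "y \<in> V"
  defines "w \<equiv> \<lambda>x y. linear_coeff y (d (Suc n) (linear_coeff x (d (Suc (Suc n)) u)))"
  shows "w x y = - w y x" and "w x x = 0"
proof -
  let ?v = "\<lambda>x. linear_coeff x (d (Suc (Suc n)) u)"
  have v: "?v x \<in> L (Suc n)" if "x \<in> V" for x by (rule linear_coeff_d[OF u that])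
  have w: "constant_vec (w x y)" for x y by (simp add: w_def constant_vec_def)
  have "0 = d (Suc n) (d (Suc (Suc n)) u)" using d_d[OF L_vecs[OF u]] by simp
  also have "\<dots> = d (Suc n) (\<Sum>x\<in>V. smul (Var x) (?v x))" by (simp only: d_expansion[OF u, symmetric])
  also have "\<dots> = (\<Sum>x\<in>V. smul (Var x) (d (Suc n) (?v x)))" by (rule d_sum_Var) (rule L_vecs[OF v])
  also have "\<dots> = (\<Sum>x\<in>V. smul (Var x) (\<Sum>y\<in>V. smul (Var y) (w x y)))"
    unfolding w_def by (intro sum.cong refl) (simp only: d_expansion[OF v, symmetric])
  finally have 0: "(\<Sum>x\<in>V. smul (Var x) (\<Sum>y\<in>V. smul (Var y) (w x y))) = 0" ..
  show "w x y = - w y x" "w x x = 0" by (rule quadratic_relation[OF finite_V w 0 x y])+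
qed

text \<open>Beyond membership in \<open>I\<close> and the degree, all conditions in
  \<open>strand\<close> come from consecutive differentials composing to zero: at the bottom this is
  the cycle condition in \<open>R\<close>, higher up it is alternation in the two leading
  variables.\<close>

lemma strand_strand_map: "u \<in> L n \<Longrightarrow> strand V I n (\<lambda>xs. strand_map xs u)"
proof (induction n arbitrary: u)
  case 0
  have "d 0 u \<in> vpart V (J 0) (c 0) 2" using graded_hom_part[OF d_hom 0] by simp
  then have "lookup (d 0 u) j0 \<in> hpart V 2"
    using c_0 by (auto simp: vpart_iff dest: spec[of _ j0])
  then show ?case using d_0_image[OF L_vecs[OF 0]] by simp
next
  case (Suc n u)
  have step: "strand V I n (\<lambda>xs. strand_map xs (linear_coeff x (d (Suc n) u)))" if "x \<in> V" for x
    by (rule Suc.IH[OF linear_coeff_d[OF Suc.prems that]])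
  \<comment> \<open>\<open>strand V I n\<close> reads its function only on lists of length
    \<open>n\<close>. This matters because \<open>strand_map\<close> selects the differential by the
    length of the list.\<close>
  have cong: "strand V I n \<phi> = strand V I n \<psi>"
    if "\<And>xs. length xs = n \<Longrightarrow> \<phi> xs = \<psi> xs" for \<phi> \<psi> :: "'v list \<Rightarrow> ('v, 'k) mpoly" and n
    using that
  proof (induction V I n \<phi> arbitrary: \<psi> rule: strand.induct)
    case (2 V I \<phi>)
    show ?case using 2(1)[of _ "\<lambda>xs. \<psi> (_ # xs)"] 2(2) by simp
  next
    case (3 V I n \<phi>)
    have "strand V I (Suc n) (\<lambda>xs. \<phi> (x # xs)) = strand V I (Suc n) (\<lambda>xs. \<psi> (x # xs))" if "x \<in> V" for x
      by (rule 3(1)[OF that]) (use 3(2) in auto)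
    then show ?case using 3(2) by simp
  qed simp
  have step': "strand V I n (\<lambda>xs. strand_map (x # xs) u)" if "x \<in> V" for x
    by (subst cong[of n _ "\<lambda>xs. strand_map xs (linear_coeff x (d (Suc n) u))"])
      (use step[OF that] in auto)
  show ?case
  proof (cases n)
    case 0
    have u: "u \<in> L (Suc 0)" using Suc.prems 0 by simp
    let ?v = "\<lambda>x. linear_coeff x (d (Suc 0) u)"
    have "0 = lookup (d 0 (d (Suc 0) u)) j0" using d_d[OF L_vecs[OF u]] by simp
    also have "\<dots> = lookup (d 0 (\<Sum>x\<in>V. smul (Var x) (?v x))) j0" 
      by (simp only: d_expansion[OF u, symmetric])
    also have "d 0 (\<Sum>x\<in>V. smul (Var x) (?v x)) = (\<Sum>x\<in>V. smul (Var x) (d 0 (?v x)))"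
      by (rule d_sum_Var) (rule L_vecs[OF linear_coeff_d[OF u]])
    finally show ?thesis using step' 0 by (simp add: lookup_sum)
  next
    case (Suc m)
    have u: "u \<in> L (Suc (Suc m))" using Suc.prems Suc by simp
    let ?w = "\<lambda>x y. linear_coeff y (d (Suc m) (linear_coeff x (d (Suc (Suc m)) u)))"
    have "strand_map (x # y # xs) u = - strand_map (y # x # xs) u \<and> strand_map (x # x # xs) u = 0"
      if xy: "x \<in> V" "y \<in> V" and xs: "length xs = m" "set xs \<subseteq> V" for x y xs
    proof
      have "strand_map (x # y # xs) u = strand_map xs (?w x y)" using xs by simp
      also have "\<dots> = strand_map xs (- ?w y x)" by (rule arg_cong[OF second_coeff(1)[OF u xy]])
      also have "\<dots> = - strand_map xs (?w y x)"
        using linear_coeff_d[OF linear_coeff_d[OF u xy(2)] xy(1)] xs by (intro strand_map_uminus) auto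
      finally show "strand_map (x # y # xs) u = - strand_map (y # x # xs) u" using xs by simp
      have "strand_map (x # x # xs) u = strand_map xs (?w x x)" using xs by simp
      also have "?w x x = 0" by (rule second_coeff(2)[OF u xy])
      finally show "strand_map (x # x # xs) u = 0" using strand_map_zero[OF xs(2)] by simp
    qed
    then show ?thesis using step' unfolding Suc strand.simps(3) by blast
  qed
qed

text \<open>Exactness within a single degree: the homogeneous component of a preimage is again a
  preimage.\<close>

lemma d_surj:
  assumes "x \<in> vpart V (J (Suc n)) (c (Suc n)) e" "d n x = 0"
  obtains u where "u \<in> vpart V (J (Suc (Suc n))) (c (Suc (Suc n))) e" "d (Suc n) u = x"
proof -
  have "x \<in> vecs V (J (Suc n))" using assms(1) by (simp add: vpart_iff)
  then obtain y where y: "y \<in> vecs V (J (Suc (Suc n)))" "d (Suc n) y = x"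
    using ker_d[OF _ assms(2)] by blast
  show ?thesis
  proof (rule that)
    show "hcomp (c (Suc (Suc n))) e y \<in> vpart V (J (Suc (Suc n))) (c (Suc (Suc n))) e"
      by (rule hcomp_in_part[OF y(1)])
    show "d (Suc n) (hcomp (c (Suc (Suc n))) e y) = x"
      using graded_hom_hcomp[OF d_hom y(1)] hcomp_of_part[OF assms(1), of e] y(2) by simp
  qed
qed

text \<open>The element is rebuilt from its linear coefficients \<open>u x\<close>, which the
  induction supplies: the sum of the \<open>u x\<close> times their variables is a cycle of degree
  \<open>n + 3\<close>, and exactness lifts it one step up.\<close>

lemma strand_map_surj:
  "strand V I n \<phi> \<Longrightarrow> \<exists>u\<in>L n. \<forall>xs. length xs = n \<and> set xs \<subseteq> V \<longrightarrow> strand_map xs u = \<phi> xs"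
proof (induction n arbitrary: \<phi>)
  case 0
  let ?x = "single j0 (\<phi> [])"
  have p: "\<phi> [] \<in> I" "\<phi> [] \<in> hpart V 2" using 0 by auto
  have x: "?x \<in> vpart V (J 0) (c 0) 2"
    using vpart_unit[of j0 "J 0" "\<phi> []" V 2 "c 0"] p J_0 c_0 by simp
  have xv: "?x \<in> vecs V (J 0)" using x by (simp add: vpart_iff)
  have "?x \<in> {x \<in> vecs V (J 0). \<epsilon> x = \<zero>\<^bsub>quot\<^esub>}" using xv \<epsilon>_eq_0_iff[OF xv] p by simp
  then obtain y where y: "y \<in> vecs V (J (Suc 0))" "d 0 y = ?x"
    unfolding exact_at_0[symmetric] by auto
  let ?u = "hcomp (c (Suc 0)) 2 y"
  have "?u \<in> L 0" using hcomp_in_part[OF y(1)] by simp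
  moreover have "d 0 ?u = ?x" using graded_hom_hcomp[OF d_hom y(1)] hcomp_of_part[OF x, of 2] y(2) by simp
  ultimately show ?case by (intro bexI[of _ ?u]) auto
next
  case (Suc n)
  have "\<exists>u. x \<in> V \<longrightarrow> u \<in> L n \<and> (\<forall>xs. length xs = n \<and> set xs \<subseteq> V \<longrightarrow> strand_map xs u = \<phi> (x # xs))" for x
    using Suc.IH[OF strand_Suc[OF Suc.prems, of x]] by blast
  then obtain u where u: "\<And>x. x \<in> V \<Longrightarrow> u x \<in> L n"
    "\<And>x xs. x \<in> V \<Longrightarrow> length xs = n \<Longrightarrow> set xs \<subseteq> V \<Longrightarrow> strand_map xs (u x) = \<phi> (x # xs)"
    by metis
  let ?w = "\<Sum>x\<in>V. smul (Var x) (u x)"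
  have w: "?w \<in> vpart V (J (Suc n)) (c (Suc n)) (int n + 3)"
  proof (rule vpart_sum)
    fix x assume x: "x \<in> V"
    show "smul (Var x) (u x) \<in> vpart V (J (Suc n)) (c (Suc n)) (int n + 3)"
      using vpart_smul[OF hpart_Var[OF x] u(1)[OF x]] by (simp add: algebra_simps)
  qed
  have dw: "d n ?w = (\<Sum>x\<in>V. smul (Var x) (d n (u x)))"
    by (rule d_sum_Var) (rule L_vecs[OF u(1)])
  have "d n ?w = 0"
  proof (cases n)
    case 0
    have "d n ?w \<in> vecs V (J 0)"
      using graded_hom_closed[OF d_hom, of ?w n] w 0 by (simp add: vpart_iff)
    moreover have "lookup (d n ?w) j0 = (\<Sum>x\<in>V. Var x * \<phi> [x])"
      unfolding dw lookup_sum using u(2)[of _ "[]"] 0 by (intro sum.cong) auto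
    moreover have "\<dots> = 0" using Suc.prems 0 by simp
    ultimately have z: "lookup (d n ?w) j0 = 0" "d n ?w \<in> vecs V {j0}" using J_0 by simp_all
    show ?thesis by (rule vecs_singleton_eq_0[OF z(2,1)])
  next
    case (Suc m)
    let ?v = "\<lambda>x y. linear_coeff y (d (Suc m) (u x))"
    have uL: "u x \<in> L (Suc m)" if "x \<in> V" for x using u(1)[OF that] Suc by simp
    have vL: "?v x y \<in> L m" if "x \<in> V" "y \<in> V" for x y by (rule linear_coeff_d[OF uL[OF that(1)] that(2)])
    have v: "strand_map xs (?v x y) = \<phi> (x # y # xs)"
      if "x \<in> V" "y \<in> V" "length xs = m" "set xs \<subseteq> V" for x y xs
      using u(2)[of x "y # xs"] that Suc by simp
    have alt: "\<phi> (x # y # xs) = - \<phi> (y # x # xs) \<and> \<phi> (x # x # xs) = 0"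
      if "x \<in> V" "y \<in> V" "length xs = m" "set xs \<subseteq> V" for x y xs
      using Suc.prems that unfolding Suc strand.simps(3) by blast
    \<comment> \<open>Injectivity of \<open>strand_map\<close> transfers alternation from the values
      of \<open>\<phi>\<close> to the second coefficients themselves.\<close>
    have anti: "?v x y = - ?v y x" if xy: "x \<in> V" "y \<in> V" for x y
    proof -
      have "?v x y + ?v y x = 0"
      proof (rule strand_map_inj)
        show "?v x y + ?v y x \<in> L m" by (intro vpart_add vL xy)
        fix xs :: "'v list" assume xs: "length xs = m" "set xs \<subseteq> V"
        have "strand_map xs (?v x y + ?v y x) = strand_map xs (?v x y) + strand_map xs (?v y x)"
          using vL[OF xy] vL[OF xy(2,1)] xs by (intro strand_map_add) auto
        also have "\<dots> = \<phi> (x # y # xs) + \<phi> (y # x # xs)"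
          unfolding v[OF xy xs] v[OF xy(2,1) xs] ..
        finally show "strand_map xs (?v x y + ?v y x) = 0"
          using alt[OF xy xs] by (metis add.left_inverse)
      qed
      then show ?thesis by (simp add: eq_neg_iff_add_eq_0)
    qed
    have diag: "?v x x = 0" if x: "x \<in> V" for x
    proof (rule strand_map_inj[OF vL[OF x x]])
      fix xs :: "'v list" assume xs: "length xs = m" "set xs \<subseteq> V"
      show "strand_map xs (?v x x) = 0" unfolding v[OF x x xs] using alt[OF x x xs] by blast
    qed
    have "d n ?w = (\<Sum>x\<in>V. smul (Var x) (\<Sum>y\<in>V. smul (Var y) (?v x y)))"
      unfolding dw unfolding Suc
      by (intro sum.cong refl arg_cong[where f = "smul _"]) (rule d_expansion[OF uL])
    also have "\<dots> = (\<Sum>x\<in>V. \<Sum>y\<in>V. smul (Var x * Var y) (?v x y))"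
      by (simp add: smul_sum smul_smul)
    also have "\<dots> = 0"
    proof (rule alternating_sum_eq_0[OF finite_V])
      fix x y assume xy: "x \<in> V" "y \<in> V"
      have "smul (Var x * Var y) (?v x y) + smul (Var y * Var x) (?v y x) = 0"
        unfolding mult.commute[of "Var y" "Var x"] smul_add[symmetric] using anti[OF xy] by simp
      then show "smul (Var x * Var y) (?v x y) = - smul (Var y * Var x) (?v y x)"
        by (simp add: eq_neg_iff_add_eq_0)
    next
      fix x assume "x \<in> V"
      then show "smul (Var x * Var x) (?v x x) = 0" using diag by simp
    qed
    finally show ?thesis .
  qed
  with w obtain z where z: "z \<in> vpart V (J (Suc (Suc n))) (c (Suc (Suc n))) (int n + 3)"
    "d (Suc n) z = ?w" by (rule d_surj)
  have "linear_coeff x (d (Suc n) z) = u x" if "x \<in> V" for x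
    unfolding z(2) by (rule linear_coeff_sum_Var[OF finite_V L_constant[OF u(1)] that])
  then have "strand_map xs z = \<phi> xs" if xs: "length xs = Suc n" "set xs \<subseteq> V" for xs
    using xs u(2) by (cases xs) auto
  then show ?case using z(1) by (intro bexI[of _ z]) (auto simp: algebra_simps)
qed

end

context quadratic_resolution
begin

text \<open>The coordinates indexed by \<open>P\<close> separate strand elements and have dual
  strand elements, so \<open>L n\<close> has dimension \<open>card P\<close>. The unit vectors of
  the generators of degree \<open>n + 2\<close> form another basis of \<open>L n\<close>. The
  coordinates do not refer to the resolution, which is why every minimal resolution gives the same
  count.\<close>

theorem strand_rank:
  assumes P: "finite P" and xl: "\<And>p. p \<in> P \<Longrightarrow> length (xl p) = n \<and> set (xl p) \<subseteq> V"
    and inj: "\<And>\<phi> xs. strand V I n \<phi> \<Longrightarrow> (\<And>p. p \<in> P \<Longrightarrow> lookup (\<phi> (xl p)) (ml p) = 0) \<Longrightarrow>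
      length xs = n \<Longrightarrow> set xs \<subseteq> V \<Longrightarrow> \<phi> xs = 0"
    and surj: "\<And>p. p \<in> P \<Longrightarrow> \<exists>\<phi>. strand V I n \<phi> \<and>
      (\<forall>q\<in>P. lookup (\<phi> (xl q)) (ml q) = (if q = p then 1 else 0))"
  shows "finite {j \<in> J (Suc n). c (Suc n) j = int n + 2} \<and>
    card {j \<in> J (Suc n). c (Suc n) j = int n + 2} = card P"
proof -
  define T where "T p u = lookup (strand_map (xl p) u) (ml p)" for p u
  have T_fscale: "T p (fscale k u) = k * T p u" if "p \<in> P" "u \<in> L n" for p k u
    using strand_map_fscale[of u "xl p" k] xl[OF that(1)] that(2) by (simp add: T_def)
  have T_add: "T p (u + v) = T p u + T p v" if "p \<in> P" "u \<in> L n" "v \<in> L n" for p u v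
    using strand_map_add[of u "xl p" v] xl[OF that(1)] that(2,3) by (simp add: T_def lookup_add)
  have T_sum: "T p (sum f A) = (\<Sum>i\<in>A. T p (f i))"
    if "p \<in> P" "finite A" "\<And>i. i \<in> A \<Longrightarrow> f i \<in> L n" for p A and f :: "'b \<Rightarrow> _"
    using strand_map_sum[of A f "xl p"] xl[OF that(1)] that by (simp add: T_def lookup_sum)
  have T_inj: "u = 0" if u: "u \<in> L n" and 0: "\<And>p. p \<in> P \<Longrightarrow> T p u = 0" for u
    by (rule strand_map_inj[OF u], rule inj[OF strand_strand_map[OF u]]) (use 0 in \<open>auto simp: T_def\<close>)
  have "\<exists>u\<in>L n. \<forall>q\<in>P. T q u = (if q = p then 1 else 0)" if p: "p \<in> P" for p
  proof -
    obtain \<phi> where \<phi>: "strand V I n \<phi>" "\<forall>q\<in>P. lookup (\<phi> (xl q)) (ml q) = (if q = p then 1 else 0)"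
      using surj[OF p] by blast
    obtain u where u: "u \<in> L n" "\<forall>xs. length xs = n \<and> set xs \<subseteq> V \<longrightarrow> strand_map xs u = \<phi> xs"
      using strand_map_surj[OF \<phi>(1)] by blast
    have "T q u = (if q = p then 1 else 0)" if "q \<in> P" for q
      using u(2) xl[OF that] \<phi>(2) that by (simp add: T_def)
    then show ?thesis using u(1) by blast
  qed
  \<comment> \<open>Preimages of the dual strand elements; they turn out to be a basis of
    \<open>L n\<close>.\<close>
  then obtain w where w: "\<And>p. p \<in> P \<Longrightarrow> w p \<in> L n"
    "\<And>p q. p \<in> P \<Longrightarrow> q \<in> P \<Longrightarrow> T q (w p) = (if q = p then 1 else 0)"
    by metis
  have T_comb: "T q (\<Sum>p\<in>P. fscale (a p) (w p)) = a q" if q: "q \<in> P" for a q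
  proof -
    have "T q (\<Sum>p\<in>P. fscale (a p) (w p)) = (\<Sum>p\<in>P. T q (fscale (a p) (w p)))"
      by (rule T_sum[OF q P]) (use w(1) L_fscale in auto)
    also have "\<dots> = (\<Sum>p\<in>P. if q = p then a p else 0)"
      by (intro sum.cong refl) (use T_fscale[OF q] w q in auto)
    also have "\<dots> = a q" using P q by simp
    finally show ?thesis .
  qed
  have expand: "u = (\<Sum>p\<in>P. fscale (T p u) (w p))" if u: "u \<in> L n" for u
  proof -
    let ?s = "\<Sum>p\<in>P. fscale (T p u) (w p)"
    have s: "?s \<in> L n" by (intro vpart_sum L_fscale w(1))
    have "u + fscale (- 1) ?s = 0"
    proof (rule T_inj)
      show "u + fscale (- 1) ?s \<in> L n" by (intro vpart_add u L_fscale s)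
      fix p assume p: "p \<in> P"
      have "T p (u + fscale (- 1) ?s) = T p u + T p (fscale (- 1) ?s)"
        by (rule T_add[OF p u L_fscale[OF s]])
      then show "T p (u + fscale (- 1) ?s) = 0"
        using T_fscale[OF p s, of "- 1"] T_comb[OF p, of "\<lambda>p. T p u"] by simp
    qed
    then show ?thesis by simp
  qed
  define JL where "JL = {j \<in> J (Suc n). c (Suc n) j = int n + 2}"
  define E where "E = (\<lambda>j. single j (1 :: ('v, 'k) mpoly)) ` JL"
  have injE: "inj_on (\<lambda>j. single j (1 :: ('v, 'k) mpoly)) JL"
    by (rule inj_onI) (metis keys_single singleton_inject zero_neq_one)
  have EL: "E \<subseteq> L n"
  proof
    fix v assume "v \<in> E"
    then obtain j where j: "v = single j 1" "j \<in> J (Suc n)" "c (Suc n) j = int n + 2"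
      by (auto simp: E_def JL_def)
    show "v \<in> L n" using vpart_unit[OF j(2) hpart_const[of 1], of V "c (Suc n)"] j by simp
  qed
  have LE: "L n \<subseteq> fv.span E"
  proof
    fix u :: "('v, 'k) vec" assume u: "u \<in> L n"
    have "u = (\<Sum>j\<in>keys u. smul (lookup u j) (single j 1))" by (rule vecs_decomp)
    also have "\<dots> = (\<Sum>j\<in>keys u. fscale (lookup (lookup u j) 0) (single j 1))"
      unfolding fscale_def by (intro sum.cong refl arg_cong2[where f = smul])
        (rule constant_vecD[OF L_constant[OF u]])
    also have "\<dots> \<in> fv.span E"
    proof (intro fv.span_sum fv.span_scale fv.span_base)
      fix j assume j: "j \<in> keys u"
      then have jJ: "j \<in> J (Suc n)" using L_vecs[OF u] by (auto simp: vecs_iff)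
      moreover have "\<not> c (Suc n) j > int n + 2"
        using hpart_neg[of "lookup u j" V "int n + 2 - c (Suc n) j"] u j
        by (auto simp: vpart_iff in_keys_iff)
      ultimately have "j \<in> JL" using c_ge[OF jJ] by (simp add: JL_def)
      then show "single j 1 \<in> E" by (simp add: E_def)
    qed
    finally show "u \<in> fv.span E" .
  qed
  have indE: "fv.independent E" unfolding fv.dependent_explicit
  proof safe
    fix t u v assume t: "finite t" "t \<subseteq> E" "(\<Sum>v\<in>t. fscale (u v) v) = 0" and v: "v \<in> t" "u v \<noteq> 0"
    obtain j where j: "v = single j 1" using v t by (auto simp: E_def)
    have "0 = lookup (lookup (\<Sum>v\<in>t. fscale (u v) v) j) 0" using t(3) by simp
    also have "\<dots> = (\<Sum>x\<in>t. u x * lookup (lookup x j) 0)" by (simp add: lookup_sum fscale_def)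
    also have "\<dots> = (\<Sum>x\<in>t. if x = v then u v else 0)"
    proof (intro sum.cong refl)
      fix x assume "x \<in> t"
      then obtain l where "x = single l 1" using t by (auto simp: E_def)
      then show "u x * lookup (lookup x j) 0 = (if x = v then u v else 0)"
        using j by (cases "l = j") (auto simp: lookup_single dest: arg_cong[of _ _ "\<lambda>x. lookup x j"])
    qed
    also have "\<dots> = u v" using t v by simp
    finally show False using v(2) by simp
  qed
  have injw: "inj_on w P" by (rule inj_onI) (metis w(2) zero_neq_one)
  have indW: "fv.independent (w ` P)"
  proof (rule fv.independent_if_scalars_zero)
    show "finite (w ` P)" using P by simp
    fix f x assume f: "(\<Sum>x\<in>w ` P. fscale (f x) x) = 0" and "x \<in> w ` P"
    then obtain p where p: "p \<in> P" "x = w p" by blast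
    have "(\<Sum>p\<in>P. fscale (f (w p)) (w p)) = 0" using f by (simp add: sum.reindex[OF injw])
    then have "f (w p) = T p 0" using T_comb[OF p(1), of "\<lambda>p. f (w p)"] by simp
    also have "\<dots> = 0" using strand_map_zero xl[OF p(1)] by (simp add: T_def)
    finally show "f x = 0" using p by simp
  qed
  have LW: "L n \<subseteq> fv.span (w ` P)"
  proof
    fix u :: "('v, 'k) vec" assume "u \<in> L n"
    then have "u = (\<Sum>p\<in>P. fscale (T p u) (w p))" by (rule expand)
    also have "\<dots> \<in> fv.span (w ` P)" by (intro fv.span_sum fv.span_scale fv.span_base) auto
    finally show "u \<in> fv.span (w ` P)" .
  qed
  have E: "finite E \<and> card E \<le> card (w ` P)"
    by (rule fv.independent_span_bound[OF _ indE]) (use P EL LW in auto)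
  have "card (w ` P) \<le> card E"
    using fv.independent_span_bound[OF _ indW, of E] E w(1) LE by auto
  then have "card E = card P" using E card_image[OF injw] by simp
  then have "finite JL \<and> card JL = card P"
    using E card_image[OF injE] finite_imageD[OF _ injE] by (simp add: E_def)
  then show ?thesis by (simp add: JL_def)
qed

end

section \<open>Symmetries of strand elements\<close>

lemma strand_values:
  "strand V I n \<phi> \<Longrightarrow> length xs = n \<Longrightarrow> set xs \<subseteq> V \<Longrightarrow> \<phi> xs \<in> I \<inter> hpart V 2"
proof (induction xs arbitrary: n \<phi>)
  case (Cons x xs)
  then obtain m where "n = Suc m" by auto
  then show ?case using Cons.IH[OF strand_Suc[of V I m \<phi> x]] Cons.prems by auto
qed auto

text \<open>The definition asserts alternation for the two leading entries only; peeling off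
  \<open>us\<close> moves it to any adjacent position.\<close>

lemma strand_swap:
  "strand V I n \<phi> \<Longrightarrow> length us + length vs + 2 = n \<Longrightarrow> set us \<subseteq> V \<Longrightarrow> set vs \<subseteq> V \<Longrightarrow> x \<in> V \<Longrightarrow> y \<in> V \<Longrightarrow>
    \<phi> (us @ x # y # vs) = - \<phi> (us @ y # x # vs) \<and> \<phi> (us @ x # x # vs) = 0"
proof (induction us arbitrary: n \<phi>)
  case Nil
  then have n: "n = Suc (Suc (length vs))" by simp
  show ?case using Nil.prems unfolding n strand.simps(3) append_Nil by blast
next
  case (Cons u us)
  then obtain m where m: "n = Suc m" by auto
  have "\<phi> (u # us @ x # y # vs) = - \<phi> (u # us @ y # x # vs) \<and> \<phi> (u # us @ x # x # vs) = 0"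
    by (rule Cons.IH[OF strand_Suc[of V I m \<phi> u]]) (use Cons.prems m in simp_all)
  then show ?case unfolding append_Cons .
qed

text \<open>The recursion reaches the sum condition when one argument is left, so the condition
  always concerns the last entry of the list.\<close>

lemma strand_cycle:
  "strand V I (Suc n) \<phi> \<Longrightarrow> length ys = n \<Longrightarrow> set ys \<subseteq> V \<Longrightarrow> (\<Sum>x\<in>V. Var x * \<phi> (ys @ [x])) = 0"
proof (induction ys arbitrary: n \<phi>)
  case (Cons y ys)
  then obtain m where m: "n = Suc m" by auto
  have "strand V I (Suc m) (\<lambda>xs. \<phi> (y # xs))" using strand_Suc[of V I n \<phi> y] Cons.prems m by simp
  then have "(\<Sum>x\<in>V. Var x * \<phi> (y # ys @ [x])) = 0" by (rule Cons.IH) (use Cons.prems m in simp_all)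
  then show ?case by simp
qed auto

text \<open>Converse to the facts on values, alternation and cycles: a description without
  recursion, by which explicitly given elements are recognised.\<close>

lemma strandI:
  assumes "\<And>xs. length xs = n \<Longrightarrow> set xs \<subseteq> V \<Longrightarrow> \<phi> xs \<in> I \<inter> hpart V 2"
    and "\<And>us x y vs. length us + length vs + 2 = n \<Longrightarrow> \<phi> (us @ x # y # vs) = - \<phi> (us @ y # x # vs)"
    and "\<And>us x vs. length us + length vs + 2 = n \<Longrightarrow> \<phi> (us @ x # x # vs) = 0"
    and "\<And>ys. Suc (length ys) = n \<Longrightarrow> set ys \<subseteq> V \<Longrightarrow> (\<Sum>x\<in>V. Var x * \<phi> (ys @ [x])) = 0"
  shows "strand V I n \<phi>" using assms
proof (induction n arbitrary: \<phi>)
  case (Suc n)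
  have step: "strand V I n (\<lambda>xs. \<phi> (x # xs))" if "x \<in> V" for x
  proof (rule Suc.IH)
    show "\<phi> (x # xs) \<in> I \<inter> hpart V 2" if "length xs = n" "set xs \<subseteq> V" for xs
      by (rule Suc.prems(1)) (use that \<open>x \<in> V\<close> in simp_all)
    show "\<phi> (x # us @ p # q # vs) = - \<phi> (x # us @ q # p # vs)"
      if "length us + length vs + 2 = n" for us p q vs
      unfolding append_Cons[symmetric] by (rule Suc.prems(2)) (use that in simp)
    show "\<phi> (x # us @ p # p # vs) = 0" if "length us + length vs + 2 = n" for us p vs
      unfolding append_Cons[symmetric] by (rule Suc.prems(3)) (use that in simp)
    show "(\<Sum>p\<in>V. Var p * \<phi> (x # ys @ [p])) = 0" if "Suc (length ys) = n" "set ys \<subseteq> V" for ys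
      using Suc.prems(4)[of "x # ys"] that \<open>x \<in> V\<close> by simp
  qed
  show ?case
  proof (cases n)
    case 0
    then show ?thesis using step Suc.prems(4)[of "[]"] by simp
  next
    case (Suc m)
    have "\<phi> (x # y # xs) = - \<phi> (y # x # xs) \<and> \<phi> (x # x # xs) = 0" if "length xs = m" for x y xs
      using Suc.prems(2)[of "[]" xs x y] Suc.prems(3)[of "[]" xs x] that Suc by simp
    then show ?thesis using step unfolding Suc strand.simps(3) by blast
  qed
qed simp

text \<open>Adjacent transpositions connect all arrangements of a multiset: the tail is arranged by
  induction, and \<open>move\<close> then carries the head past a block to its place.\<close>

lemma adjacent_swaps_mset:
  assumes swap: "\<And>us x y vs. mset (us @ x # y # vs) = M \<Longrightarrow> P (us @ x # y # vs) \<Longrightarrow> P (us @ y # x # vs)"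
    and "P xs" "mset xs = M" "mset ys = M" shows "P ys"
proof -
  have move: "P (ws @ x # us @ vs) \<Longrightarrow> mset (ws @ x # us @ vs) = M \<Longrightarrow> P (ws @ us @ x # vs)" for ws x us vs
  proof (induction us arbitrary: ws)
    case (Cons u us)
    have "P (ws @ u # x # us @ vs)" using swap[of ws x u "us @ vs"] Cons.prems by simp
    then show ?case using Cons.IH[of "ws @ [u]"] Cons.prems by (simp add: add_mset_commute)
  qed simp
  have "P (ws @ xs) \<Longrightarrow> mset (ws @ xs) = M \<Longrightarrow> mset xs = mset ys \<Longrightarrow> P (ws @ ys)" for ws xs ys
  proof (induction xs arbitrary: ws ys)
    case (Cons x xs)
    then have "x \<in> set ys" by (metis list.set_intros(1) set_mset_mset)
    then obtain us vs where ys: "ys = us @ x # vs" by (meson split_list)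
    have "P ((ws @ [x]) @ us @ vs)" by (rule Cons.IH) (use Cons.prems ys in auto)
    then show ?case using move[of ws x us vs] Cons.prems ys by simp
  qed simp
  from this[of "[]" xs ys] show ?thesis using assms by simp
qed

text \<open>Only vanishing is transported, so the sign of the permutation never has to be
  computed.\<close>

lemma strand_perm:
  assumes \<phi>: "strand V I n \<phi>" and "length xs = n" "set xs \<subseteq> V" "mset xs = mset ys"
    and 0: "lookup (\<phi> xs) m = 0" shows "lookup (\<phi> ys) m = 0"
proof (rule adjacent_swaps_mset[where P = "\<lambda>xs. lookup (\<phi> xs) m = 0" and M = "mset xs" and xs = xs])
  fix us x y vs assume M: "mset (us @ x # y # vs) = mset xs" and 0: "lookup (\<phi> (us @ x # y # vs)) m = 0"
  have "length us + length vs + 2 = n" using arg_cong[OF M, of size] assms(2) by simp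
  moreover have "set (us @ x # y # vs) \<subseteq> V" using mset_eq_setD[OF M] assms(3) by simp
  ultimately have "\<phi> (us @ y # x # vs) = - \<phi> (us @ x # y # vs)"
    using strand_swap[OF \<phi>, of us vs y x] by simp
  then show "lookup (\<phi> (us @ y # x # vs)) m = 0" using 0 by simp
qed (use assms in simp_all)

lemma strand_not_distinct:
  assumes \<phi>: "strand V I n \<phi>" and xs: "length xs = n" "set xs \<subseteq> V" "\<not> distinct xs"
  shows "lookup (\<phi> xs) m = 0"
proof -
  obtain us x vs ws where d: "xs = us @ [x] @ vs @ [x] @ ws" using not_distinct_decomp[OF xs(3)] by blast
  let ?ys = "x # x # us @ vs @ ws"
  have "\<phi> ([] @ ?ys) = - \<phi> ([] @ ?ys) \<and> \<phi> ([] @ ?ys) = 0"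
    by (rule strand_swap[OF \<phi>]) (use xs d in simp_all)
  then have 0: "lookup (\<phi> ?ys) m = 0" by simp
  show ?thesis by (rule strand_perm[OF \<phi> _ _ _ 0]) (use xs d in simp_all)
qed

section \<open>Edge ideals\<close>

locale simple_graph =
  fixes G :: "'v graph"
  assumes finite_verts: "finite (verts G)"
    and edgesD: "e \<in> edges G \<Longrightarrow> \<exists>x y. x \<noteq> y \<and> e = {x, y} \<and> x \<in> verts G \<and> y \<in> verts G"
begin

abbreviation "V \<equiv> verts G"

abbreviation "I \<equiv> edge_ideal G :: ('v, 'k::field) mpoly set"

lemma edge_in_verts: "{x, y} \<in> edges G \<Longrightarrow> x \<in> V \<and> y \<in> V \<and> x \<noteq> y"
  using edgesD[of "{x, y}"] by (auto simp: doubleton_eq_iff)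

text \<open>A monomial ideal contains a polynomial exactly when it contains each of its terms, so
  membership can be tested on the coefficients.\<close>

lemma edge_ideal_eq: "(I :: ('v, 'k::field) mpoly set) = {p \<in> polys V. \<forall>m. lookup p m \<noteq> 0 \<longrightarrow>
    (\<exists>x y m'. {x, y} \<in> edges G \<and> m = single x 1 + single y 1 + m')}" (is "_ = ?I")
proof
  interpret cring "mpoly_ring V :: ('v, 'k) mpoly ring" by (rule cring_mpoly_ring)
  let ?gens = "{Var x * Var y | x y. {x, y} \<in> edges G} :: ('v, 'k) mpoly set"
  have V: "?gens \<subseteq> polys V" using edge_in_verts by (auto intro!: polys_mult polys_Var)
  have I: "ideal ?I (mpoly_ring V)"
  proof (rule ideal_mpoly_ringI)
    fix p q :: "('v, 'k) mpoly" assume pq: "p \<in> ?I" "q \<in> ?I"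
    have "\<exists>x y m'. {x, y} \<in> edges G \<and> m = single x 1 + single y 1 + m'" if "lookup (p + q) m \<noteq> 0" for m
    proof -
      have "lookup p m \<noteq> 0 \<or> lookup q m \<noteq> 0" using that by (auto simp: lookup_add)
      then show ?thesis using pq by blast
    qed
    then show "p + q \<in> ?I" using pq polys_add[of p V q] by blast
  next
    fix r p :: "('v, 'k) mpoly" assume r: "r \<in> polys V" and p: "p \<in> ?I"
    have "\<exists>x y m'. {x, y} \<in> edges G \<and> m = single x 1 + single y 1 + m'" if "lookup (r * p) m \<noteq> 0" for m
    proof -
      have "m \<in> keys (r * p)" using that by (simp add: in_keys_iff)
      then obtain k l where kl: "m = k + l" "l \<in> keys p" using keys_mult[of r p] by blast
      then obtain x y m' where xy: "{x, y} \<in> edges G" "l = single x 1 + single y 1 + m'"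
        using p by (auto simp: in_keys_iff)
      have "m = single x 1 + single y 1 + (m' + k)" using xy kl by (simp add: algebra_simps)
      then show ?thesis using xy(1) by blast
    qed
    then show "r * p \<in> ?I" using polys_mult[OF r] p by auto
  qed auto
  have "?gens \<subseteq> ?I"
  proof
    fix g assume "g \<in> ?gens"
    then obtain x y where xy: "g = Var x * Var y" "{x, y} \<in> edges G" by blast
    have "lookup g m \<noteq> 0 \<Longrightarrow> m = single x 1 + single y 1 + 0" for m
      by (simp add: xy(1) Var_def mult_single lookup_single when_def split: if_splits)
    then show "g \<in> ?I" using V \<open>g \<in> ?gens\<close> xy(2) by blast
  qed
  then show "edge_ideal G \<subseteq> ?I" unfolding edge_ideal_def by (rule genideal_minimal[OF I])
  show "?I \<subseteq> edge_ideal G"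
  proof
    fix p assume p: "p \<in> ?I"
    have J: "ideal (edge_ideal G) (mpoly_ring V :: ('v, 'k) mpoly ring)"
      unfolding edge_ideal_def by (rule genideal_ideal[OF V])
    have "single m (lookup p m) \<in> edge_ideal G" if m: "m \<in> keys p" for m
    proof -
      obtain x y m' where xy: "{x, y} \<in> edges G" "m = single x 1 + single y 1 + m'"
        using p m by (auto simp: in_keys_iff)
      have "keys m \<subseteq> V" using p m by (auto simp: polys_iff in_keys_iff)
      then have m': "keys m' \<subseteq> V" by (auto simp: xy(2) keys_add_nat)
      have "(Var x * Var y :: ('v, 'k) mpoly) \<in> edge_ideal G"
        using genideal_self[OF V] xy(1) unfolding edge_ideal_def by blast
      then have "single (single x 1 + single y 1) (1 :: 'k) \<in> edge_ideal G"
        by (simp add: Var_def mult_single)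
      then show ?thesis unfolding xy(2) by (rule monomial_in_ideal[OF J _ m'])
    qed
    then have "(\<Sum>m\<in>keys p. single m (lookup p m)) \<in> edge_ideal G"
      by (rule ideal_mpoly_ring_sum[OF J])
    then show "p \<in> edge_ideal G" by (simp add: poly_mapping_sum_single)
  qed
qed

lemma edge_ideal_quadratic: "quadratic_ideal V (I :: ('v, 'k::field) mpoly set)"
proof (rule quadratic_ideal.intro)
  interpret cring "mpoly_ring V :: ('v, 'k) mpoly ring" by (rule cring_mpoly_ring)
  show "ideal (I :: ('v, 'k) mpoly set) (mpoly_ring V)" unfolding edge_ideal_def
    by (rule genideal_ideal) (use edge_in_verts in \<open>auto intro!: polys_mult polys_Var\<close>)
  fix p :: "('v, 'k) mpoly" assume p: "p \<in> I"
  show "restrict_keys (\<lambda>m. deg m = e) p \<in> I" for e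
    using p unfolding edge_ideal_eq by (auto simp: polys_iff)
  fix m assume "lookup p m \<noteq> 0"
  then obtain x y m' where "m = single x 1 + single y 1 + m'"
    using p unfolding edge_ideal_eq by blast
  then show "2 \<le> deg m" by (simp add: monomial_degree_add)
qed (rule finite_verts)

lemma edge_ideal_2:
  "p \<in> I \<inter> hpart V 2 \<longleftrightarrow>
    (\<forall>m. lookup p m \<noteq> 0 \<longrightarrow> (\<exists>x y. {x, y} \<in> edges G \<and> m = single x 1 + single y 1))"
proof
  assume p: "p \<in> I \<inter> hpart V 2"
  show "\<forall>m. lookup p m \<noteq> 0 \<longrightarrow> (\<exists>x y. {x, y} \<in> edges G \<and> m = single x 1 + single y 1)"
  proof (intro allI impI)
    fix m assume m: "lookup p m \<noteq> 0"
    obtain x y m' where xy: "{x, y} \<in> edges G" "m = single x 1 + single y 1 + m'"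
      using p m unfolding edge_ideal_eq by blast
    moreover have "deg m = 2" using p m by (simp add: hpart_iff)
    ultimately have "m' = 0" by (simp add: monomial_degree_add)
    then show "\<exists>x y. {x, y} \<in> edges G \<and> m = single x 1 + single y 1" using xy by auto
  qed
next
  assume p: "\<forall>m. lookup p m \<noteq> 0 \<longrightarrow> (\<exists>x y. {x, y} \<in> edges G \<and> m = single x 1 + single y 1)"
  have h: "p \<in> hpart V 2" unfolding hpart_iff
  proof (intro allI impI)
    fix m assume "lookup p m \<noteq> 0"
    then obtain x y where "{x, y} \<in> edges G" "m = single x 1 + single y 1" using p by blast
    then show "keys m \<subseteq> V \<and> deg m = 2"
      using edge_in_verts[of x y] by (simp add: keys_add_nat monomial_degree_add)
  qed
  moreover have "p \<in> polys V" using h by (simp add: homogeneous_part_def)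
  moreover have "\<exists>x y m'. {x, y} \<in> edges G \<and> m = single x 1 + single y 1 + m'" if "lookup p m \<noteq> 0" for m
    using p that by (metis add.right_neutral)
  ultimately show "p \<in> I \<inter> hpart V 2" unfolding edge_ideal_eq by blast
qed

end

section \<open>A basis of the linear strand\<close>

text \<open>The sign of the permutation that sorts the list by \<open>r\<close>, written as a
  product over pairs of positions and equal to 0 at a tie. In this form alternation follows by
  induction on the list, without any permutations.\<close>

fun order_sign :: "('v \<Rightarrow> nat) \<Rightarrow> 'v list \<Rightarrow> 'k::field" where
  "order_sign r [] = 1"
| "order_sign r (x # xs) =
    prod_list (map (\<lambda>y. if r x < r y then 1 else if r x = r y then 0 else - 1) xs) * order_sign r xs"

lemma order_sign_swap: "(order_sign r (us @ x # y # vs) :: 'b::field) = - order_sign r (us @ y # x # vs)"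
  by (induction us) (auto simp: mult_ac)

lemma order_sign_repeat: "(order_sign r (us @ x # x # vs) :: 'b::field) = 0" by (induction us) auto

text \<open>In the cycle condition for \<open>cut_element\<close> the entries to be exchanged may be
  separated by a third one; three adjacent swaps exchange them.\<close>

lemma order_sign_reverse3:
  "(order_sign r (us @ [x, y, z]) :: 'k::field) = - order_sign r (us @ [z, y, x])"
proof -
  have "(order_sign r (us @ [x, y, z]) :: 'k) = - order_sign r (us @ [y, x, z])"
    by (rule order_sign_swap)
  also have "(order_sign r (us @ [y, x, z]) :: 'k) = - order_sign r (us @ [y, z, x])"
    by (rule order_sign_swap[of r "us @ [y]" x z "[]", simplified])
  also have "(order_sign r (us @ [y, z, x]) :: 'k) = - order_sign r (us @ [z, y, x])"
    by (rule order_sign_swap)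
  finally show ?thesis by simp
qed

lemma order_sign_repeat3: "(order_sign r (us @ [x, y, x]) :: 'k::field) = 0"
proof -
  have "(order_sign r (us @ [x, y, x]) :: 'k) = - order_sign r (us @ [y, x, x])"
    by (rule order_sign_swap)
  also have "(order_sign r (us @ [y, x, x]) :: 'k) = 0"
    by (rule order_sign_repeat[of r "us @ [y]" x "[]", simplified])
  finally show ?thesis by simp
qed

lemma order_sign_nonzero:
  "inj_on r (set xs) \<Longrightarrow> distinct xs \<Longrightarrow> order_sign r xs \<noteq> 0"
  by (induction xs) (auto simp: inj_on_def prod_list_zero_iff split: if_splits)

section \<open>Non-adjacency and the index set of the coordinates\<close>

definition nonadj :: "'v graph \<Rightarrow> 'v set \<Rightarrow> ('v \<times> 'v) set" where
  "nonadj G S = {(x, y). x \<in> S \<and> y \<in> S \<and> {x, y} \<notin> edges G}"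

text \<open>The components of the complement of the subgraph induced on \<open>S\<close>.\<close>

definition co_comps :: "'v graph \<Rightarrow> 'v set \<Rightarrow> 'v set set" where
  "co_comps G S = (\<lambda>x. (nonadj G S)\<^sup>* `` {x}) ` S"

lemma nonadj_rtrancl_sym: "(x, y) \<in> (nonadj G S)\<^sup>* \<Longrightarrow> (y, x) \<in> (nonadj G S)\<^sup>*"
  by (rule symD[OF sym_rtrancl]) (auto simp: nonadj_def sym_def insert_commute)

lemma nonadj_rtrancl_closed: "(x, y) \<in> (nonadj G S)\<^sup>* \<Longrightarrow> x \<in> S \<Longrightarrow> y \<in> S"
  by (induction rule: rtrancl_induct) (auto simp: nonadj_def)

lemma co_comp_subset: "C \<in> co_comps G S \<Longrightarrow> C \<subseteq> S"
  by (auto simp: co_comps_def dest: nonadj_rtrancl_closed)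

lemma co_comp_nonempty: "C \<in> co_comps G S \<Longrightarrow> C \<noteq> {}"
  by (auto simp: co_comps_def)

lemma nonadj_rtrancl_eq:
  "(x, y) \<in> (nonadj G S)\<^sup>* \<Longrightarrow> (nonadj G S)\<^sup>* `` {x} = (nonadj G S)\<^sup>* `` {y}"
  using nonadj_rtrancl_sym by (fastforce intro: rtrancl_trans)

lemma co_comp_eq: "C \<in> co_comps G S \<Longrightarrow> x \<in> C \<Longrightarrow> C = (nonadj G S)\<^sup>* `` {x}"
  using nonadj_rtrancl_eq by (fastforce simp: co_comps_def)

lemma co_comp_edge:
  assumes "C \<in> co_comps G S" "x \<in> C" "y \<in> S - C" shows "{x, y} \<in> edges G"
proof (rule ccontr)
  assume "{x, y} \<notin> edges G"
  then have "(x, y) \<in> nonadj G S" using assms co_comp_subset[OF assms(1)] by (auto simp: nonadj_def)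
  then have "y \<in> C" using co_comp_eq[OF assms(1,2)] by auto
  then show False using assms(3) by simp
qed

text \<open>An arbitrary choice, used both for the base vertex of a vertex set and for the
  representative of a component.\<close>

definition root :: "'v set \<Rightarrow> 'v" where
  "root S = (SOME x. x \<in> S)"

lemma root_in: "S \<noteq> {} \<Longrightarrow> root S \<in> S" by (simp add: root_def some_in_eq)

text \<open>A list of \<open>n\<close> variables together with a quadric has a multidegree of size
  \<open>n + 2\<close>. The component of the root carries no coordinate, since a potential can be
  normalised to 0 there.\<close>

definition strand_basis :: "'v graph \<Rightarrow> nat \<Rightarrow> ('v set \<times> 'v set) set" where
  "strand_basis G n = Sigma {S. S \<subseteq> verts G \<and> card S = n + 2} (\<lambda>S. {C \<in> co_comps G S. root S \<notin> C})"

text \<open>An arbitrary listing; another order would change a coordinate by a sign only.\<close>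

definition rest :: "'v set \<Rightarrow> 'v list" where
  "rest S = (SOME xs. distinct xs \<and> set xs = S)"

lemma rest: "finite S \<Longrightarrow> distinct (rest S) \<and> set (rest S) = S"
  unfolding rest_def by (rule someI_ex) (metis finite_distinct_list)

context simple_graph
begin

text \<open>Exactly one component contains the root, which accounts for the
  \<open>- 1\<close>.\<close>

lemma basis_card:
  "finite (strand_basis G n)"
  "card (strand_basis G n) = (\<Sum>S | S \<subseteq> V \<and> card S = n + 2. card (co_comps G S) - 1)"
proof -
  have fin: "finite {S. S \<subseteq> V \<and> card S = n + 2}"
    by (rule finite_subset[of _ "Pow V"]) (use finite_verts in auto)
  have fc: "finite (co_comps G S)" if "S \<subseteq> V" for S
    using finite_subset[OF that finite_verts] by (simp add: co_comps_def)
  have fin': "finite {C \<in> co_comps G S. root S \<notin> C}" if "S \<subseteq> V" for S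
    using fc[OF that] by simp
  have "card {C \<in> co_comps G S. root S \<notin> C} = card (co_comps G S) - 1"
    if S: "S \<subseteq> V" "card S = n + 2" for S
  proof -
    have "S \<noteq> {}" using S(2) by auto
    then have r: "root S \<in> S" by (rule root_in)
    let ?R = "(nonadj G S)\<^sup>* `` {root S}"
    have "{C \<in> co_comps G S. root S \<notin> C} = co_comps G S - {?R}"
    proof
      show "co_comps G S - {?R} \<subseteq> {C \<in> co_comps G S. root S \<notin> C}"
        using co_comp_eq by fastforce
    qed auto
    moreover have "?R \<in> co_comps G S" using r by (auto simp: co_comps_def)
    ultimately show ?thesis by simp
  qed
  then show "card (strand_basis G n) = (\<Sum>S | S \<subseteq> V \<and> card S = n + 2. card (co_comps G S) - 1)"
    unfolding strand_basis_def using fin fin' by (subst card_SigmaI) auto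
  show "finite (strand_basis G n)" unfolding strand_basis_def
    using fin fin' by (intro finite_SigmaI) auto
qed

abbreviation quadric :: "'v \<Rightarrow> 'v \<Rightarrow> 'v \<Rightarrow>\<^sub>0 nat" where
  "quadric x y \<equiv> single x 1 + single y 1"

lemma quadric_eq_iff: "quadric x y = quadric a b \<longleftrightarrow> (x = a \<and> y = b) \<or> (x = b \<and> y = a)"
  using single_add_single_eq_iff[of x y a b] by simp

lemma strand_nonedge:
  fixes \<phi> :: "'v list \<Rightarrow> ('v, 'k::field) mpoly"
  assumes "strand V I n \<phi>" "length xs = n" "set xs \<subseteq> V" "{p, q} \<notin> edges G"
  shows "lookup (\<phi> xs) (quadric p q) = 0"
proof (rule ccontr)
  assume "lookup (\<phi> xs) (quadric p q) \<noteq> 0"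
  moreover have "\<phi> xs \<in> I \<inter> hpart V 2" by (rule strand_values[OF assms(1-3)])
  ultimately obtain x y where "{x, y} \<in> edges G" "quadric p q = quadric x y"
    using edge_ideal_2 by blast
  then show False using assms(4) quadric_eq_iff[of p q x y] by (auto simp: insert_commute)
qed

lemma strand_coeff_cycle:
  fixes \<phi> :: "'v list \<Rightarrow> ('v, 'k::field) mpoly"
  assumes \<phi>: "strand V I (Suc n) \<phi>" and ys: "length ys = n" "set ys \<subseteq> V" and m: "keys m \<subseteq> V"
  shows "(\<Sum>x\<in>keys m. lookup (\<phi> (ys @ [x])) (m - single x 1)) = 0"
proof -
  have "0 = lookup (\<Sum>x\<in>V. Var x * \<phi> (ys @ [x])) m" using strand_cycle[OF \<phi> ys] by simp
  also have "\<dots> = (\<Sum>x\<in>V. if x \<in> keys m then lookup (\<phi> (ys @ [x])) (m - single x 1) else 0)"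
    by (simp add: lookup_sum lookup_Var_times)
  also have "\<dots> = (\<Sum>x\<in>keys m. lookup (\<phi> (ys @ [x])) (m - single x 1))"
    using m finite_verts by (simp add: sum.If_cases Int_absorb1)
  finally show ?thesis by simp
qed

text \<open>The cycle condition at the squarefree monomial \<open>p q r\<close>, to which only the
  three variables dividing it contribute. With the signs absorbed by alternation in the list, this
  is the 1-cocycle condition on a triangle.\<close>

lemma strand_cocycle:
  fixes \<phi> :: "'v list \<Rightarrow> ('v, 'k::field) mpoly"
  assumes \<phi>: "strand V I (Suc n) \<phi>" and ys: "length ys = n" "set ys \<subseteq> V"
    and pqr: "p \<in> V" "q \<in> V" "r \<in> V" "p \<noteq> q" "p \<noteq> r" "q \<noteq> r"
  shows "lookup (\<phi> (ys @ [p])) (quadric q r) + lookup (\<phi> (ys @ [q])) (quadric p r) +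
    lookup (\<phi> (ys @ [r])) (quadric p q) = 0"
proof -
  let ?m = "single p 1 + single q 1 + single r (1::nat)"
  have k: "keys ?m = {p, q, r}" by (auto simp: keys_add_nat)
  have d: "?m - single p 1 = quadric q r" "?m - single q 1 = quadric p r" "?m - single r 1 = quadric p q"
    using add_diff_cancel_left'[of "single p 1" "quadric q r"]
      add_diff_cancel_left'[of "single q 1" "quadric p r"]
      add_diff_cancel_left'[of "single r 1" "quadric p q"] by (simp_all only: ac_simps)
  have "(\<Sum>x\<in>{p, q, r}. lookup (\<phi> (ys @ [x])) (?m - single x 1)) = 0"
    by (rule strand_coeff_cycle[OF \<phi> ys, of ?m, unfolded k]) (use pqr in simp)
  then have "lookup (\<phi> (ys @ [p])) (?m - single p 1) + (lookup (\<phi> (ys @ [q])) (?m - single q 1) +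
    lookup (\<phi> (ys @ [r])) (?m - single r 1)) = 0" using pqr by (simp del: One_nat_def)
  then show ?thesis unfolding d by (simp only: add.assoc)
qed

text \<open>This disposes of the multidegrees that are not squarefree: at \<open>p^2 q\<close> the
  cycle condition has two terms, and the one with the quadric \<open>p^2\<close> vanishes because
  there are no loops.\<close>

lemma strand_square:
  fixes \<phi> :: "'v list \<Rightarrow> ('v, 'k::field) mpoly"
  assumes \<phi>: "strand V I n \<phi>" and xs: "length xs = n" "set xs \<subseteq> V" and p: "p \<in> set xs"
  shows "lookup (\<phi> xs) (quadric p q) = 0"
proof (cases "{p, q} \<in> edges G")
  case True
  then have pq: "p \<in> V" "q \<in> V" "p \<noteq> q" using edge_in_verts by auto
  obtain us vs where d: "xs = us @ p # vs" using split_list[OF p] by blast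
  let ?ys = "us @ vs"
  obtain n' where n: "n = Suc n'" "length ?ys = n'" using xs d by auto
  let ?m = "single p 1 + quadric p q"
  have k: "keys ?m = {p, q}" by (auto simp: keys_add_nat)
  have "lookup (\<phi> (?ys @ [p])) (?m - single p 1) + lookup (\<phi> (?ys @ [q])) (?m - single q 1) = 0"
    using strand_coeff_cycle[of n' \<phi> ?ys ?m, unfolded k] \<phi> n xs d pq by simp
  moreover have "?m - single p 1 = quadric p q" by (metis add_diff_cancel_left')
  moreover have "?m - single q 1 = quadric p p" by (metis add.assoc add_diff_cancel_right')
  moreover have "lookup (\<phi> (?ys @ [q])) (quadric p p) = 0"
    by (rule strand_nonedge[OF \<phi>]) (use n xs d pq edge_in_verts[of p p] in auto)
  ultimately have "lookup (\<phi> (?ys @ [p])) (quadric p q) = 0" by simp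
  then show ?thesis by (rule strand_perm[OF \<phi>, rotated 3]) (use n xs d in auto)
qed (rule strand_nonedge[OF \<phi> xs])

text \<open>
  The coefficients of a strand element on the subsets of \<open>S\<close> form a 1-cocycle on the simplex with
  vertex set \<open>S\<close> which vanishes on the non-edges of \<open>G\<close>.  It is the coboundary of a function that
  is constant on the components of the complement, hence is determined by its values on the pairs
  consisting of the root and one vertex of each other component.
\<close>

lemma strand_coordinates_inj:
  fixes \<phi> :: "'v list \<Rightarrow> ('v, 'k::field) mpoly"
  assumes \<phi>: "strand V I n \<phi>"
    and coord: "\<And>S C. (S, C) \<in> strand_basis G n \<Longrightarrow>
      lookup (\<phi> (rest (S - {root S, root C}))) (quadric (root S) (root C)) = 0"
    and xs: "length xs = n" "set xs \<subseteq> V" shows "\<phi> xs = 0"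
proof -
  have from_root: "lookup (\<phi> zs) (quadric (root S) q) = 0"
    if S: "S \<subseteq> V" "card S = n + 2" and q: "q \<in> S" "q \<noteq> root S"
      and zs: "distinct zs" "set zs = S - {root S, q}" for S q zs
  proof -
    define r where "r = root S"
    have fS: "finite S" by (rule finite_subset[OF S(1) finite_verts])
    have r: "r \<in> S" unfolding r_def by (rule root_in) (use q in auto)
    have len: "length zs = n" if "distinct zs" "set zs = S - {r, q}" "q \<in> S" "q \<noteq> r" for zs q
    proof -
      have "card (S - {r, q}) = card S - card {r, q}" by (rule card_Diff_subset) (use that r in auto)
      then show ?thesis using distinct_card[OF that(1)] that S by simp
    qed
    \<comment> \<open>For a potential normalised to 0 at the root \<open>r\<close>,
      \<open>good q\<close> says that it vanishes at \<open>q\<close>, whatever the order of the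
      remaining vertices.\<close>
    define good where "good q \<longleftrightarrow> q = r \<or>
      (\<forall>zs. distinct zs \<longrightarrow> set zs = S - {r, q} \<longrightarrow> lookup (\<phi> zs) (quadric r q) = 0)" for q
    have step: "good q'" if qq: "(q, q') \<in> nonadj G S" and "good q" for q q'
    proof (cases "q' = r \<or> q = q'")
      case False
      have qS: "q \<in> S" "q' \<in> S" "{q, q'} \<notin> edges G" using qq by (auto simp: nonadj_def)
      have "lookup (\<phi> zs) (quadric r q') = 0" if zs: "distinct zs" "set zs = S - {r, q'}" for zs
      proof (cases "q = r")
        case True
        show ?thesis by (rule strand_nonedge[OF \<phi> len[OF zs]]) (use qS True zs False S in auto)
      next
        case qr: False
        have "q \<in> set zs" using qS qr False zs by auto
        then obtain us vs where d: "zs = us @ q # vs" by (meson split_list)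
        let ?ys = "us @ vs"
        have ys: "distinct ?ys" "set ?ys = S - {r, q, q'}" using zs d by auto
        obtain n' where n: "n = Suc n'" "length ?ys = n'" using len[OF zs qS(2)] False d by auto
        have 1: "lookup (\<phi> (?ys @ [q'])) (quadric r q) = 0"
        proof -
          have "distinct (?ys @ [q'])" "set (?ys @ [q']) = S - {r, q}" using ys qS False by auto
          then show ?thesis using \<open>good q\<close> qr unfolding good_def by blast
        qed
        have 2: "lookup (\<phi> (?ys @ [r])) (quadric q q') = 0"
          by (rule strand_nonedge[OF \<phi>]) (use n ys qS S r in auto)
        \<comment> \<open>In the cocycle relation on \<open>r\<close>, \<open>q\<close>,
          \<open>q'\<close> the non-edge between \<open>q\<close> and \<open>q'\<close> kills one
          term and \<open>good q\<close> kills another.\<close>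
        have "lookup (\<phi> (?ys @ [r])) (quadric q q') + lookup (\<phi> (?ys @ [q])) (quadric r q') +
          lookup (\<phi> (?ys @ [q'])) (quadric r q) = 0"
          by (rule strand_cocycle[of n']) (use \<phi> n ys qS S r False qr in auto)
        then have 3: "lookup (\<phi> (?ys @ [q])) (quadric r q') = 0" using 1 2 by simp
        show ?thesis by (rule strand_perm[OF \<phi> _ _ _ 3]) (use n ys qS S d in auto)
      qed
      then show ?thesis by (simp add: good_def)
    qed (use \<open>good q\<close> in \<open>auto simp: good_def\<close>)
    have path: "good q'" if "(q, q') \<in> (nonadj G S)\<^sup>*" "good q" for q q'
      using that by (induction rule: rtrancl_induct) (auto intro: step)
    \<comment> \<open>In the component of the root, paths start at \<open>r\<close>, where
      \<open>good\<close> is trivial; in any other component the hypothesis \<open>coord\<close>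
      supplies the starting vertex \<open>root ?C\<close>.\<close>
    let ?C = "(nonadj G S)\<^sup>* `` {q}"
    have C: "?C \<in> co_comps G S" using q(1) by (auto simp: co_comps_def)
    have "good q"
    proof (cases "r \<in> ?C")
      case True
      then have "(r, q) \<in> (nonadj G S)\<^sup>*" using nonadj_rtrancl_sym by auto
      then show ?thesis by (rule path) (simp add: good_def)
    next
      case False
      define c where "c = root ?C"
      have c: "c \<in> ?C" unfolding c_def by (rule root_in) auto
      have cS: "c \<in> S" "c \<noteq> r" using c co_comp_subset[OF C] False by auto
      have "(S, ?C) \<in> strand_basis G n" using S C False by (simp add: strand_basis_def r_def)
      from coord[OF this] have 0: "lookup (\<phi> (rest (S - {r, c}))) (quadric r c) = 0"
        by (simp add: r_def c_def)
      have rs: "distinct (rest (S - {r, c}))" "set (rest (S - {r, c})) = S - {r, c}"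
        using rest[of "S - {r, c}"] fS by auto
      have "good c" unfolding good_def
      proof (intro disjI2 allI impI)
        fix zs assume zs: "distinct zs" "set zs = S - {r, c}"
        show "lookup (\<phi> zs) (quadric r c) = 0" by (rule strand_perm[OF \<phi> _ _ _ 0])
            (use len[OF rs cS] rs zs S set_eq_iff_mset_eq_distinct[OF rs(1) zs(1)] in auto)
      qed
      moreover have "(c, q) \<in> (nonadj G S)\<^sup>*" using nonadj_rtrancl_sym[of q c] c by simp
      ultimately show ?thesis using path by blast
    qed
    then show ?thesis using q zs unfolding good_def r_def by blast
  qed
  have edge: "lookup (\<phi> xs) (quadric p q) = 0" if pq: "{p, q} \<in> edges G" for p q
  proof (cases "distinct (p # q # xs)")
    case True
    define S where "S = set (p # q # xs)"
    define r where "r = root S"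
    have pqV: "p \<in> V" "q \<in> V" "p \<noteq> q" using edge_in_verts pq by auto
    have S: "S \<subseteq> V" "card S = n + 2" using distinct_card[OF True] xs pqV by (auto simp: S_def)
    have from_r: "lookup (\<phi> zs) (quadric r q) = 0"
      if "q \<in> S" "q \<noteq> r" "distinct zs" "set zs = S - {r, q}" for q zs
      unfolding r_def by (rule from_root[OF S]) (use that in \<open>simp_all add: r_def\<close>)
    have Sx: "p \<in> S" "q \<in> S" "set xs = S - {p, q}" using True by (auto simp: S_def)
    have "r \<in> S" unfolding r_def by (rule root_in) (auto simp: S_def)
    then consider "r = p" | "r = q" | "r \<in> set xs" "r \<noteq> p" "r \<noteq> q" by (auto simp: S_def)
    then show ?thesis
    proof cases
      case 1
      show ?thesis using from_r[of q xs] Sx pqV 1 True by simp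
    next
      case 2
      show ?thesis using from_r[of p xs] Sx pqV 2 True by (simp add: add.commute insert_commute)
    next
      case 3
      then obtain us vs where d: "xs = us @ r # vs" by (meson split_list)
      let ?ys = "us @ vs"
      obtain n' where n: "n = Suc n'" "length ?ys = n'" using xs d by auto
      have 1: "lookup (\<phi> (?ys @ [p])) (quadric r q) = 0" "lookup (\<phi> (?ys @ [q])) (quadric r p) = 0"
        by (rule from_r; use True d 3 in \<open>auto simp: S_def\<close>)+
      \<comment> \<open>An edge that avoids the root is reached by the cocycle relation with the
        root as third vertex.\<close>
      have "lookup (\<phi> (?ys @ [p])) (quadric q r) + lookup (\<phi> (?ys @ [q])) (quadric p r) +
          lookup (\<phi> (?ys @ [r])) (quadric p q) = 0"
        by (rule strand_cocycle[of n']) (use \<phi> n xs d pqV 3 in auto)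
      then have 0: "lookup (\<phi> (?ys @ [r])) (quadric p q) = 0"
        using 1 by (simp add: add.commute)
      show ?thesis by (rule strand_perm[OF \<phi> _ _ _ 0]) (use n xs d in auto)
    qed
  next
    case False
    then consider "\<not> distinct xs" | "p \<in> set xs" | "q \<in> set xs" using edge_in_verts[OF pq] by auto
    then show ?thesis
    proof cases
      case 1
      then show ?thesis by (rule strand_not_distinct[OF \<phi> xs])
    next
      case 2
      then show ?thesis by (rule strand_square[OF \<phi> xs])
    next
      case 3
      then show ?thesis using strand_square[OF \<phi> xs, of q p] by (simp add: add.commute)
    qed
  qed
  show ?thesis
  proof (rule poly_mapping_eqI)
    fix m
    have "\<phi> xs \<in> I \<inter> hpart V 2" by (rule strand_values[OF \<phi> xs])
    then show "lookup (\<phi> xs) m = lookup 0 m" using edge_ideal_2 edge by fastforce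
  qed
qed

text \<open>The cocycle of the indicator function of the component \<open>C\<close>.\<close>

definition cut_element :: "('v \<Rightarrow> nat) \<Rightarrow> 'v set \<Rightarrow> 'v set \<Rightarrow> 'k::field \<Rightarrow> 'v list \<Rightarrow> ('v, 'k) mpoly" where
  "cut_element r S C k xs = (\<Sum>p\<in>C. \<Sum>q\<in>S - C. single (quadric p q)
    (if set (xs @ [q, p]) = S then k * order_sign r (xs @ [q, p]) else 0))"

text \<open>All pairs between a component and the rest of \<open>S\<close> are edges, so the values
  lie in the edge ideal; alternation is inherited from \<open>order_sign\<close>. In the cycle
  condition the terms with \<open>x\<close> in \<open>S - C\<close> cancel by exchanging
  \<open>x\<close> and \<open>q\<close>, those with \<open>x\<close> in \<open>C\<close> by
  exchanging \<open>x\<close> and \<open>p\<close>.\<close>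

lemma cut_element_strand:
  assumes S: "S \<subseteq> V" and C: "C \<in> co_comps G S"
  shows "strand V I n (cut_element r S C (k :: 'k::field))"
proof (rule strandI)
  have CS: "C \<subseteq> S" by (rule co_comp_subset[OF C])
  have fS: "finite S" by (rule finite_subset[OF S finite_verts])
  have fC: "finite C" by (rule finite_subset[OF CS fS])
  have neg: "single m (if B then k * - a else 0) = - single m (if B then k * a else 0)"
    for m :: "'v \<Rightarrow>\<^sub>0 nat" and B a by (simp add: single_uminus)
  show "cut_element r S C k xs \<in> I \<inter> hpart V 2" for xs unfolding edge_ideal_2
  proof (intro allI impI)
    fix m assume m: "lookup (cut_element r S C k xs) m \<noteq> 0"
    show "\<exists>x y. {x, y} \<in> edges G \<and> m = quadric x y"
    proof (rule ccontr)
      assume no: "\<not> ?thesis"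
      have "lookup (cut_element r S C k xs) m = 0" unfolding cut_element_def lookup_sum
      proof (intro sum.neutral ballI)
        fix p q assume "p \<in> C" "q \<in> S - C"
        then have "quadric p q \<noteq> m" using co_comp_edge[OF C] no by blast
        then show "lookup (single (quadric p q) 
          (if set (xs @ [q, p]) = S then k * order_sign r (xs @ [q, p]) else 0)) m = 0"
          by (simp add: lookup_single when_def)
      qed
      then show False using m by simp
    qed
  qed
  show "cut_element r S C k (us @ x # y # vs) = - cut_element r S C k (us @ y # x # vs)" for us x y vs
    unfolding cut_element_def sum_negf[symmetric]
  proof (intro sum.cong refl)
    fix p q
    have os: "(order_sign r ((us @ x # y # vs) @ [q, p]) :: 'k) = - order_sign r ((us @ y # x # vs) @ [q, p])"
      using order_sign_swap[of r us x y "vs @ [q, p]", where ?'b = 'k] by simp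
    have set: "set ((us @ x # y # vs) @ [q, p]) = set ((us @ y # x # vs) @ [q, p])" by auto
    show "single (quadric p q) (if set ((us @ x # y # vs) @ [q, p]) = S
        then k * order_sign r ((us @ x # y # vs) @ [q, p]) else 0) =
      - single (quadric p q) (if set ((us @ y # x # vs) @ [q, p]) = S
        then k * order_sign r ((us @ y # x # vs) @ [q, p]) else 0)" unfolding os set by (rule neg)
  qed
  show "cut_element r S C k (us @ x # x # vs) = 0" for us x vs unfolding cut_element_def
  proof (intro sum.neutral ballI)
    fix p q
    have "(order_sign r ((us @ x # x # vs) @ [q, p]) :: 'k) = 0"
      using order_sign_repeat[of r us x "vs @ [q, p]", where ?'b = 'k] by simp
    then show "single (quadric p q) (if set ((us @ x # x # vs) @ [q, p]) = S
        then k * order_sign r ((us @ x # x # vs) @ [q, p]) else 0) = 0" by simp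
  qed
  show "(\<Sum>x\<in>V. Var x * cut_element r S C k (ys @ [x])) = 0" for ys
  proof -
    define T where "T x p q = (single (single x 1 + quadric p q)
      (if set (ys @ [x, q, p]) = S then k * order_sign r (ys @ [x, q, p]) else 0) :: ('v, 'k) mpoly)" for x p q
    have "(\<Sum>x\<in>V. Var x * cut_element r S C k (ys @ [x])) = (\<Sum>x\<in>V. \<Sum>p\<in>C. \<Sum>q\<in>S - C. T x p q)"
      by (simp add: cut_element_def sum_distrib_left Var_def mult_single T_def cong: if_cong)
    \<comment> \<open>The condition that the entries exhaust \<open>S\<close> excludes every
      \<open>x\<close> outside \<open>S\<close>.\<close>
    also have "\<dots> = (\<Sum>x\<in>S. \<Sum>p\<in>C. \<Sum>q\<in>S - C. T x p q)"
      by (rule sum.mono_neutral_right[OF finite_verts S]) (auto simp: T_def intro!: sum.neutral)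
    also have "\<dots> = (\<Sum>x\<in>S - C. \<Sum>p\<in>C. \<Sum>q\<in>S - C. T x p q) + (\<Sum>x\<in>C. \<Sum>p\<in>C. \<Sum>q\<in>S - C. T x p q)"
      by (rule sum.subset_diff[OF CS fS])
    also have "(\<Sum>x\<in>C. \<Sum>p\<in>C. \<Sum>q\<in>S - C. T x p q) = 0"
    proof (rule alternating_sum_eq_0[OF fC])
      show "(\<Sum>q\<in>S - C. T x p q) = - (\<Sum>q\<in>S - C. T p x q)" for x p
      proof -
        have "T x p q = - T p x q" for q
        proof -
          have set: "set (ys @ [x, q, p]) = set (ys @ [p, q, x])" by auto
          have mon: "single x 1 + quadric p q = single p 1 + quadric x q" by (simp add: add.left_commute)
          show ?thesis unfolding T_def set mon order_sign_reverse3[of r ys x q p] by (rule neg)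
        qed
        then show ?thesis by (simp add: sum_negf)
      qed
      show "(\<Sum>q\<in>S - C. T x x q) = 0" for x
        by (simp add: T_def order_sign_repeat3 cong: if_cong)
    qed
    also have "(\<Sum>x\<in>S - C. \<Sum>p\<in>C. \<Sum>q\<in>S - C. T x p q) = (\<Sum>p\<in>C. \<Sum>x\<in>S - C. \<Sum>q\<in>S - C. T x p q)"
      by (rule sum.swap)
    also have "\<dots> = 0"
    proof (rule sum.neutral, rule ballI, rule alternating_sum_eq_0)
      fix p
      show "finite (S - C)" using fS by simp
      show "T x p q = - T q p x" for x q
      proof -
        have set: "set (ys @ [x, q, p]) = set (ys @ [q, x, p])" by auto
        have mon: "single x 1 + quadric p q = single q 1 + quadric p x" by (simp add: ac_simps)
        show ?thesis unfolding T_def set mon order_sign_swap[of r ys x q "[p]"] by (rule neg)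
      qed
      show "T x p x = 0" for x
        using order_sign_repeat[of r ys x "[p]", where ?'b = 'k] by (simp add: T_def)
    qed
    finally show ?thesis by simp
  qed
qed

lemma strand_basisD:
  assumes "(S, C) \<in> strand_basis G n"
  defines "xs \<equiv> rest (S - {root S, root C})"
  shows "S \<subseteq> V" "C \<in> co_comps G S" "root S \<notin> C" "root C \<in> C" "C \<subseteq> S" "finite S"
    "root S \<in> S" "distinct xs" "set xs = S - {root S, root C}" "length xs = n"
proof -
  show *: "S \<subseteq> V" "C \<in> co_comps G S" "root S \<notin> C"
    using assms by (auto simp: strand_basis_def)
  show c: "root C \<in> C" "C \<subseteq> S" by (rule root_in[OF co_comp_nonempty[OF *(2)]], rule co_comp_subset[OF *(2)])
  show fS: "finite S" by (rule finite_subset[OF *(1) finite_verts])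
  show r: "root S \<in> S" using root_in[of S] c by auto
  show xs: "distinct xs" "set xs = S - {root S, root C}"
    unfolding xs_def using rest[of "S - {root S, root C}"] fS by auto
  have "card (S - {root S, root C}) = card S - card {root S, root C}"
    by (rule card_Diff_subset) (use c r in auto)
  moreover have "root S \<noteq> root C" "card S = n + 2" using c * assms by (auto simp: strand_basis_def)
  ultimately show "length xs = n" using xs distinct_card[OF xs(1)] by simp
qed

text \<open>The cut element of \<open>C\<close>, divided by the sign it takes at its own coordinate,
  is dual to \<open>(S, C)\<close>: a coordinate sees it only if its vertex set is \<open>S\<close>
  and exactly one of its two roots lies in \<open>C\<close>. As the root of \<open>S\<close> does
  not, it is the root of the component, which is then \<open>C\<close>.\<close>

lemma strand_coordinates_surj:
  assumes SC: "(S, C) \<in> strand_basis G n"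
  shows "\<exists>\<phi> :: 'v list \<Rightarrow> ('v, 'k::field) mpoly. strand V I n \<phi> \<and>
    (\<forall>(S', C')\<in>strand_basis G n. lookup (\<phi> (rest (S' - {root S', root C'}))) (quadric (root S') (root C')) =
      (if (S', C') = (S, C) then 1 else 0))"
proof -
  note SC_D = strand_basisD[OF SC]
  note S = SC_D(1) and C = SC_D(2) and rC = SC_D(3) and cC = SC_D(4) and CS = SC_D(5) and fS = SC_D(6)
    and rS = SC_D(7) and xs = SC_D(8,9)
  obtain r :: "'v \<Rightarrow> nat" where r: "inj_on r V" using finite_imp_inj_to_nat_seg[OF finite_verts] by blast
  have fC: "finite C" by (rule finite_subset[OF CS fS])
  let ?xs = "rest (S - {root S, root C})"
  define \<kappa> :: 'k where "\<kappa> = order_sign r (?xs @ [root S, root C])"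
  have "root S \<noteq> root C" using rC cC by auto
  then have \<kappa>: "\<kappa> \<noteq> 0" unfolding \<kappa>_def
    by (intro order_sign_nonzero inj_on_subset[OF r]) (use xs S rS cC CS in auto)
  let ?\<phi> = "cut_element r S C (1 / \<kappa>)"
  have "lookup (?\<phi> (rest (S' - {root S', root C'}))) (quadric (root S') (root C')) =
      (if S' = S \<and> C' = C then 1 else 0)" if SC': "(S', C') \<in> strand_basis G n" for S' C'
  proof -
    note D = strand_basisD[OF SC']
    note C' = D(2) and cC' = D(4) and rS' = D(7)
    have cS': "root C' \<in> S'" using D(4,5) by auto
    let ?ys = "rest (S' - {root S', root C'})"
    have ys: "set ?ys = S' - {root S', root C'}" by (rule D(9))
    have "lookup (single (quadric p q)
        (if set (?ys @ [q, p]) = S then 1 / \<kappa> * order_sign r (?ys @ [q, p]) else 0)) (quadric (root S') (root C')) =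
      (if p = root C then if q = root S then if S' = S \<and> C' = C then 1 else 0 else 0 else 0)"
      if pq: "p \<in> C" "q \<in> S - C" for p q
    proof (cases "quadric p q = quadric (root S') (root C') \<and> set (?ys @ [q, p]) = S")
      case True
      then have pq': "(p = root S' \<and> q = root C') \<or> (p = root C' \<and> q = root S')"
        using quadric_eq_iff by blast
      then have "set (?ys @ [q, p]) = S'" using ys rS' cS' by auto
      then have eq: "S' = S" using True by simp
      then have pq'': "p = root C'" "q = root S'" using pq' rC pq by auto
      have "C' = C" using co_comp_eq[OF C pq(1)] co_comp_eq[OF C'[unfolded eq], of p] cC' pq'' by simp
      then show ?thesis using True eq pq'' \<kappa> by (simp add: \<kappa>_def)
    next
      case False
      have no: "\<not> (p = root C \<and> q = root S \<and> S' = S \<and> C' = C)"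
      proof
        assume *: "p = root C \<and> q = root S \<and> S' = S \<and> C' = C"
        then have "set (?ys @ [q, p]) = S" using ys rS' cS' by auto
        moreover have "quadric p q = quadric (root S') (root C')" using * by (simp add: add.commute)
        ultimately show False using False by blast
      qed
      have "lookup (single (quadric p q) (if set (?ys @ [q, p]) = S then a else 0))
        (quadric (root S') (root C')) = 0" for a :: 'k
        using False by (cases "set (?ys @ [q, p]) = S") (simp_all only: lookup_single when_def if_True if_False
          simp_thms single_zero lookup_zero)
      moreover have "(if p = root C then if q = root S then if S' = S \<and> C' = C then 1 else 0 else 0 else 0) = (0 :: 'k)"
        using no by auto
      ultimately show ?thesis by simp
    qed
    then have "lookup (?\<phi> ?ys) (quadric (root S') (root C')) =
      (\<Sum>p\<in>C. \<Sum>q\<in>S - C. if p = root C then if q = root S then if S' = S \<and> C' = C then 1 else 0 else 0 else 0)"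
      unfolding cut_element_def lookup_sum by (intro sum.cong refl)
    also have "\<dots> = (\<Sum>p\<in>C. if p = root C then \<Sum>q\<in>S - C. if q = root S then
        if S' = S \<and> C' = C then 1 else 0 else 0 else 0)" by (intro sum.cong refl) auto
    also have "\<dots> = (if S' = S \<and> C' = C then 1 else 0)"
      using fS fC cC rS rC by (simp add: sum.delta)
    finally show ?thesis .
  qed
  note coord = this
  show ?thesis
  proof (intro exI[of _ ?\<phi>] conjI ballI)
    show "strand V I n ?\<phi>" by (rule cut_element_strand[OF S C])
    fix x assume x: "x \<in> strand_basis G n"
    obtain S' C' where "x = (S', C')" by (cases x)
    then show "case x of (S', C') \<Rightarrow> lookup (?\<phi> (rest (S' - {root S', root C'}))) (quadric (root S') (root C')) =
      (if (S', C') = (S, C) then 1 else 0)" using coord[of S' C'] x by simp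
  qed
qed

lemma edge_ring_part_eq:
  "edge_ring_part G = (\<lambda>e. (\<lambda>p. edge_ideal G +>\<^bsub>mpoly_ring V\<^esub> p) ` hpart V e)"
  by (rule ext) (simp add: edge_ring_part_def)

lemma edge_ring_resolution:
  assumes "minimal_graded_free_resolution V (edge_ring_module G) (edge_ring_part G) J c d
    (\<epsilon> :: ('v, 'k::field) vec \<Rightarrow> _)"
  shows "finite {j \<in> J (Suc n). c (Suc n) j = int n + 2} \<and>
    card {j \<in> J (Suc n). c (Suc n) j = int n + 2} = card (strand_basis G n)"
proof -
  interpret Q: quadratic_ideal V "I :: ('v, 'k) mpoly set" by (rule edge_ideal_quadratic)
  interpret quadratic_resolution V "I :: ('v, 'k) mpoly set" J c d \<epsilon>
    using assms Q.quadratic_ideal_axioms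
    unfolding edge_ring_module_def edge_ring_part_eq by (intro quadratic_resolution.intro)
  show ?thesis
  proof (rule strand_rank[where xl = "\<lambda>(S, C). rest (S - {root S, root C})"
        and ml = "\<lambda>(S, C). quadric (root S) (root C)"])
    show "finite (strand_basis G n)" by (rule basis_card)
    fix p assume p: "p \<in> strand_basis G n"
    obtain S C where SC: "p = (S, C)" by (cases p)
    show "length (case p of (S, C) \<Rightarrow> rest (S - {root S, root C})) = n \<and>
      set (case p of (S, C) \<Rightarrow> rest (S - {root S, root C})) \<subseteq> V"
      using strand_basisD[of S C n] p SC by auto
    show "\<exists>\<phi> :: 'v list \<Rightarrow> ('v, 'k) mpoly. strand V I n \<phi> \<and>
      (\<forall>q\<in>strand_basis G n. lookup (\<phi> (case q of (S, C) \<Rightarrow> rest (S - {root S, root C})))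
        (case q of (S, C) \<Rightarrow> quadric (root S) (root C)) = (if q = p then 1 else 0))"
    proof -
      obtain \<phi> :: "'v list \<Rightarrow> ('v, 'k) mpoly" where "strand V I n \<phi>"
        and "\<forall>(S', C')\<in>strand_basis G n. lookup (\<phi> (rest (S' - {root S', root C'})))
          (quadric (root S') (root C')) = (if (S', C') = (S, C) then 1 else 0)"
        using strand_coordinates_surj[of S C n] p SC by blast
      note \<phi> = this
      show ?thesis unfolding SC
      proof (intro exI[of _ \<phi>] conjI ballI \<phi>(1))
        fix q assume q: "q \<in> strand_basis G n"
        obtain S' C' where "q = (S', C')" by (cases q)
        then show "lookup (\<phi> (case q of (S, C) \<Rightarrow> rest (S - {root S, root C})))
          (case q of (S, C) \<Rightarrow> quadric (root S) (root C)) = (if q = (S, C) then 1 else 0)"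
          using bspec[OF \<phi>(2) q] by simp
      qed
    qed
  next
    fix \<phi> :: "'v list \<Rightarrow> ('v, 'k) mpoly" and xs
    assume \<phi>: "strand V I n \<phi>" and xs: "length xs = n" "set xs \<subseteq> V"
      and 0: "\<And>p. p \<in> strand_basis G n \<Longrightarrow> lookup (\<phi> (case p of (S, C) \<Rightarrow> rest (S - {root S, root C})))
        (case p of (S, C) \<Rightarrow> quadric (root S) (root C)) = 0"
    show "\<phi> xs = 0" by (rule strand_coordinates_inj[OF \<phi> _ xs]) (use 0 in fastforce)
  qed
qed

text \<open>Resolves the definite description: a minimal resolution exists, and
  \<open>edge_ring_resolution\<close> applies to each one. The shift by one keeps the homological
  degree \<open>n + 1\<close> positive.\<close>

theorem linear_betti:
  "graph_betti TYPE('k::field) G (Suc n) (int n + 2) =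
    (\<Sum>S | S \<subseteq> V \<and> card S = n + 2. card (co_comps G S) - 1)"
proof -
  let ?M = "edge_ring_module G :: (('v, 'k) mpoly, ('v, 'k) mpoly set) module"
  interpret Q: quadratic_ideal V "I :: ('v, 'k) mpoly set" by (rule edge_ideal_quadratic)
  obtain J c d \<epsilon> where res: "minimal_graded_free_resolution V ?M (edge_ring_part G) J c d \<epsilon>"
    using Q.minimal_resolution_exists unfolding edge_ring_module_def edge_ring_part_eq by blast
  show ?thesis unfolding graph_betti_def betti_number_def basis_card(2)[symmetric]
  proof (rule the_equality)
    show "\<exists>J c d \<epsilon>. minimal_graded_free_resolution V ?M (edge_ring_part G) J c d \<epsilon> \<and>
      finite {j \<in> J (Suc n). c (Suc n) j = int n + 2} \<and>
      card (strand_basis G n) = card {j \<in> J (Suc n). c (Suc n) j = int n + 2}"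
      using edge_ring_resolution[OF res, of n]
      by (intro exI[of _ J] exI[of _ c] exI[of _ d] exI[of _ \<epsilon>] conjI res) simp_all
    fix m
    assume "\<exists>J c d \<epsilon>. minimal_graded_free_resolution V ?M (edge_ring_part G) J c d \<epsilon> \<and>
      finite {j \<in> J (Suc n). c (Suc n) j = int n + 2} \<and> m = card {j \<in> J (Suc n). c (Suc n) j = int n + 2}"
    then obtain J c d \<epsilon> where res: "minimal_graded_free_resolution V ?M (edge_ring_part G) J c d \<epsilon>"
      and m: "m = card {j \<in> J (Suc n). c (Suc n) j = int n + 2}" by blast
    show "m = card (strand_basis G n)" using edge_ring_resolution[OF res] m by simp
  qed
qed

end

section \<open>Counting components of complements\<close>

text \<open>Hochster's formula for the linear strand: the complement on \<open>S\<close> is the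
  1-skeleton of the independence complex of the induced subgraph, and the summand is the dimension
  of its reduced homology in degree 0. Truncated subtraction gives 0 for empty
  \<open>S\<close>.\<close>

definition linear_count :: "'v graph \<Rightarrow> nat \<Rightarrow> nat" where
  "linear_count G s = (\<Sum>S | S \<subseteq> verts G \<and> card S = s. card (co_comps G S) - 1)"

lemma card_image_eq_card_image:
  assumes "\<And>x y. x \<in> S \<Longrightarrow> y \<in> S \<Longrightarrow> f x = f y \<longleftrightarrow> g x = g y"
  shows "card (f ` S) = card (g ` S)"
proof -
  have eq: "f (inv_into S g (g x)) = f x" if "x \<in> S" for x
    using assms[of "inv_into S g (g x)" x] that f_inv_into_f[of "g x" g S] inv_into_into[of "g x" g S] by auto
  have "f ` S = (\<lambda>l. f (inv_into S g l)) ` g ` S" using eq by (auto simp: image_image)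
  moreover have "inj_on (\<lambda>l. f (inv_into S g l)) (g ` S)"
    by (rule inj_onI) (use assms eq in auto)
  ultimately show ?thesis by (simp add: card_image)
qed

text \<open>The counting device for the graphs below: a label that cannot change along a non-edge
  and whose fibres are connected enumerates the components.\<close>

lemma card_co_comps:
  assumes "\<And>x y. x \<in> S \<Longrightarrow> y \<in> S \<Longrightarrow> {x, y} \<notin> edges G \<Longrightarrow> l x = l y"
    and "\<And>x y. x \<in> S \<Longrightarrow> y \<in> S \<Longrightarrow> l x = l y \<Longrightarrow> (x, y) \<in> (nonadj G S)\<^sup>*"
  shows "card (co_comps G S) = card (l ` S)" unfolding co_comps_def
proof (rule card_image_eq_card_image)
  fix x y assume xy: "x \<in> S" "y \<in> S"
  have l: "(x, z) \<in> (nonadj G S)\<^sup>* \<Longrightarrow> l x = l z" for z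
    by (induction rule: rtrancl_induct) (auto simp: nonadj_def dest: assms(1))
  show "(nonadj G S)\<^sup>* `` {x} = (nonadj G S)\<^sup>* `` {y} \<longleftrightarrow> l x = l y"
  proof
    assume "(nonadj G S)\<^sup>* `` {x} = (nonadj G S)\<^sup>* `` {y}"
    then have "(x, y) \<in> (nonadj G S)\<^sup>*" by auto
    then show "l x = l y" by (rule l)
  next
    assume "l x = l y"
    then have "(x, y) \<in> (nonadj G S)\<^sup>*" using assms(2) xy by blast
    then show "(nonadj G S)\<^sup>* `` {x} = (nonadj G S)\<^sup>* `` {y}" by (rule nonadj_rtrancl_eq)
  qed
qed

lemma card_co_comps_connected:
  assumes "S \<noteq> {}" "\<And>x y. x \<in> S \<Longrightarrow> y \<in> S \<Longrightarrow> (x, y) \<in> (nonadj G S)\<^sup>*"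
  shows "card (co_comps G S) = 1"
proof -
  have "card (co_comps G S) = card ((\<lambda>_. 0 :: nat) ` S)" by (rule card_co_comps) (use assms(2) in auto)
  also have "(\<lambda>_. 0 :: nat) ` S = {0}" using assms(1) by auto
  finally show ?thesis by simp
qed

lemma card_co_comps_two:
  assumes "x \<in> S" "x \<in> C" "y \<in> S" "y \<notin> C" and C: "\<And>u v. (u, v) \<in> nonadj G S \<Longrightarrow> u \<in> C \<longleftrightarrow> v \<in> C"
    and x: "\<And>u. u \<in> S \<inter> C \<Longrightarrow> (u, x) \<in> (nonadj G S)\<^sup>*"
    and y: "\<And>u. u \<in> S - C \<Longrightarrow> (u, y) \<in> (nonadj G S)\<^sup>*"
  shows "card (co_comps G S) = 2"
proof -
  have "card (co_comps G S) = card ((\<lambda>u. u \<in> C) ` S)"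
  proof (rule card_co_comps)
    fix u v assume uv: "u \<in> S" "v \<in> S"
    show "(u \<in> C) = (v \<in> C)" if "{u, v} \<notin> edges G"
      by (rule C) (use uv that in \<open>simp add: nonadj_def\<close>)
    show "(u, v) \<in> (nonadj G S)\<^sup>*" if uv': "(u \<in> C) = (v \<in> C)"
    proof (cases "u \<in> C")
      case True
      show ?thesis by (rule rtrancl_trans[OF x nonadj_rtrancl_sym[OF x]]) (use uv uv' True in auto)
    next
      case False
      show ?thesis by (rule rtrancl_trans[OF y nonadj_rtrancl_sym[OF y]]) (use uv uv' False in auto)
    qed
  qed
  also have "(\<lambda>u. u \<in> C) ` S = {True, False}" using assms(1-4) by auto
  finally show ?thesis by simp
qed

lemma co_comps_empty [simp]: "co_comps G {} = {}" by (simp add: co_comps_def)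

lemma rtrancl_image:
  assumes "(x, y) \<in> r\<^sup>*" "\<And>x y. (x, y) \<in> r \<Longrightarrow> (f x, f y) \<in> r'"
  shows "(f x, f y) \<in> r'\<^sup>*"
  using assms(1) by (induction rule: rtrancl_induct) (auto intro: assms(2) rtrancl_into_rtrancl)

section \<open>Vertex sets in a join\<close>

lemma sum_subsets_Plus:
  fixes F :: "('u + 'w) set \<Rightarrow> nat"
  assumes U: "finite U" and W: "finite W"
  shows "(\<Sum>S | S \<subseteq> Inl ` U \<union> Inr ` W \<and> card S = s. F S) =
    (\<Sum>j\<le>s. \<Sum>A | A \<subseteq> U \<and> card A = j. \<Sum>B | B \<subseteq> W \<and> card B = s - j. F (Inl ` A \<union> Inr ` B))"
proof -
  have fU: "finite {A. A \<subseteq> U \<and> card A = j}" for j by (rule finite_subset[of _ "Pow U"]) (use U in auto)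
  have fW: "finite {B. B \<subseteq> W \<and> card B = j}" for j by (rule finite_subset[of _ "Pow W"]) (use W in auto)
  let ?T = "Sigma {..s} (\<lambda>j. {A. A \<subseteq> U \<and> card A = j} \<times> {B. B \<subseteq> W \<and> card B = s - j})"
  have card: "card (Inl ` A \<union> Inr ` B) = card A + card B" if "A \<subseteq> U" "B \<subseteq> W" for A B
    using that finite_subset[OF that(1) U] finite_subset[OF that(2) W]
    by (subst card_Un_disjoint) (auto simp: card_image)
  have split: "Inl ` (Inl -` S) \<union> Inr ` (Inr -` S) = S" for S :: "('u + 'w) set"
    by (auto simp: image_iff) (metis obj_sumE)
  have "(\<Sum>j\<le>s. \<Sum>A | A \<subseteq> U \<and> card A = j. \<Sum>B | B \<subseteq> W \<and> card B = s - j. F (Inl ` A \<union> Inr ` B)) =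
    (\<Sum>(j, A, B)\<in>?T. F (Inl ` A \<union> Inr ` B))"
    using fU fW by (simp add: sum.Sigma sum.cartesian_product)
  also have "\<dots> = (\<Sum>S | S \<subseteq> Inl ` U \<union> Inr ` W \<and> card S = s. F S)"
  proof (rule sum.reindex_bij_witness[of _ "\<lambda>S. (card (Inl -` S), Inl -` S, Inr -` S)" "\<lambda>(j, A, B). Inl ` A \<union> Inr ` B"])
    fix S assume S: "S \<in> {S. S \<subseteq> Inl ` U \<union> Inr ` W \<and> card S = s}"
    have sub: "Inl -` S \<subseteq> U" "Inr -` S \<subseteq> W" using S by auto
    have "card (Inl -` S) + card (Inr -` S) = s" using card[OF sub] split[of S] S by simp
    then show "(card (Inl -` S), Inl -` S, Inr -` S) \<in> ?T" using sub by auto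
    show "(case (card (Inl -` S), Inl -` S, Inr -` S) of (j, A, B) \<Rightarrow> Inl ` A \<union> Inr ` B) = S"
      using split by simp
  next
    fix t assume "t \<in> ?T"
    then obtain j A B where t: "t = (j, A, B)" "j \<le> s" "A \<subseteq> U" "card A = j" "B \<subseteq> W" "card B = s - j"
      by auto
    have "Inl -` (Inl ` A \<union> Inr ` B) = A" "Inr -` (Inl ` A \<union> Inr ` B) = B" by auto
    then show "(card (Inl -` (case t of (j, A, B) \<Rightarrow> Inl ` A \<union> Inr ` B)),
      Inl -` (case t of (j, A, B) \<Rightarrow> Inl ` A \<union> Inr ` B), Inr -` (case t of (j, A, B) \<Rightarrow> Inl ` A \<union> Inr ` B)) = t"
      using t by simp
    show "(case t of (j, A, B) \<Rightarrow> Inl ` A \<union> Inr ` B) \<in> {S. S \<subseteq> Inl ` U \<union> Inr ` W \<and> card S = s}"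
      using t card by auto
  qed auto
  finally show ?thesis ..
qed

lemma join_edge [simp]:
  "{Inl x, Inl y} \<in> edges (G \<nabla> H) \<longleftrightarrow> {x, y} \<in> edges G"
  "{Inr u, Inr v} \<in> edges (G \<nabla> H) \<longleftrightarrow> {u, v} \<in> edges H"
  "{Inl x, Inr u} \<in> edges (G \<nabla> H) \<longleftrightarrow> x \<in> verts G \<and> u \<in> verts H"
  "{Inr u, Inl x} \<in> edges (G \<nabla> H) \<longleftrightarrow> x \<in> verts G \<and> u \<in> verts H"
proof -
  have l: "{Inl x, Inl y} = Inl ` {x, y}" and r: "{Inr u, Inr v} = Inr ` {u, v}" by auto
  have il: "Inl ` e \<in> (`) Inl ` E \<longleftrightarrow> e \<in> E" for e E by (auto simp: inj_image_eq_iff)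
  have ir: "Inr ` e \<in> (`) Inr ` E \<longleftrightarrow> e \<in> E" for e E by (auto simp: inj_image_eq_iff)
  have nl: "Inl ` {x, y} \<notin> (`) Inr ` edges H"
    "Inl ` {x, y} \<notin> {{Inl u, Inr v} |u v. u \<in> verts G \<and> v \<in> verts H}" by auto
  have nr: "Inr ` {u, v} \<notin> (`) Inl ` edges G"
    "Inr ` {u, v} \<notin> {{Inl u, Inr v} |u v. u \<in> verts G \<and> v \<in> verts H}" by auto
  show "{Inl x, Inl y} \<in> edges (G \<nabla> H) \<longleftrightarrow> {x, y} \<in> edges G"
    unfolding l graph_join_def graph.select_convs Un_iff il using nl by blast
  show "{Inr u, Inr v} \<in> edges (G \<nabla> H) \<longleftrightarrow> {u, v} \<in> edges H"
    unfolding r graph_join_def graph.select_convs Un_iff ir using nr by blast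
  have "{Inl x, Inr u} \<noteq> Inl ` e" "{Inl x, Inr u} \<noteq> Inr ` f" for e f by auto
  then show "{Inl x, Inr u} \<in> edges (G \<nabla> H) \<longleftrightarrow> x \<in> verts G \<and> u \<in> verts H"
    by (auto simp: graph_join_def doubleton_eq_iff)
  then show "{Inr u, Inl x} \<in> edges (G \<nabla> H) \<longleftrightarrow> x \<in> verts G \<and> u \<in> verts H"
    by (simp add: insert_commute)
qed

text \<open>Every pair of vertices from different sides is an edge, so the components of the two
  sides, tagged by their side, serve as labels.\<close>

lemma card_co_comps_join:
  assumes A: "A \<subseteq> verts G" "finite A" and B: "B \<subseteq> verts H" "finite B"
  shows "card (co_comps (G \<nabla> H) (Inl ` A \<union> Inr ` B)) = card (co_comps G A) + card (co_comps H B)"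
proof -
  let ?S = "Inl ` A \<union> Inr ` B"
  define l where "l z = (case z of Inl x \<Rightarrow> Inl ((nonadj G A)\<^sup>* `` {x}) | Inr y \<Rightarrow> Inr ((nonadj H B)\<^sup>* `` {y}))" for z
  have "card (co_comps (G \<nabla> H) ?S) = card (l ` ?S)"
  proof (rule card_co_comps)
    fix u v assume uv: "u \<in> ?S" "v \<in> ?S"
    show "l u = l v" if "{u, v} \<notin> edges (G \<nabla> H)"
    proof -
      have "(nonadj K C)\<^sup>* `` {x} = (nonadj K C)\<^sup>* `` {y}" if "x \<in> C" "y \<in> C" "{x, y} \<notin> edges K"
        for K :: "'z graph" and C x y
        by (rule nonadj_rtrancl_eq) (use that in \<open>auto simp: nonadj_def\<close>)
      note eq = this
      show ?thesis using uv that A(1) B(1) by (auto simp: l_def eq)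
    qed
    show "(u, v) \<in> (nonadj (G \<nabla> H) ?S)\<^sup>*" if luv: "l u = l v"
    proof (cases u)
      case (Inl x)
      then obtain y where v: "v = Inl y" using luv by (cases v) (auto simp: l_def)
      have "(x, y) \<in> (nonadj G A)\<^sup>*" using luv Inl v by (auto simp: l_def)
      then show ?thesis unfolding Inl v by (rule rtrancl_image) (auto simp: nonadj_def)
    next
      case (Inr x)
      then obtain y where v: "v = Inr y" using luv by (cases v) (auto simp: l_def)
      have "(x, y) \<in> (nonadj H B)\<^sup>*" using luv Inr v by (auto simp: l_def)
      then show ?thesis unfolding Inr v by (rule rtrancl_image) (auto simp: nonadj_def)
    qed
  qed
  also have "l ` ?S = co_comps G A <+> co_comps H B"
    by (auto simp: l_def co_comps_def Plus_def image_Un image_image)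
  also have "card \<dots> = card (co_comps G A) + card (co_comps H B)"
    by (rule card_Plus) (use A(2) B(2) in \<open>auto simp: co_comps_def\<close>)
  finally show ?thesis .
qed

lemma card_co_comps_edgeless: "A \<noteq> {} \<Longrightarrow> card (co_comps (edgeless a) A) = 1"
  by (rule card_co_comps_connected) (auto simp: nonadj_def edgeless_def)

lemma card_co_comps_pos: "finite S \<Longrightarrow> S \<noteq> {} \<Longrightarrow> 0 < card (co_comps G S)"
  by (simp add: co_comps_def card_gt_0_iff)

text \<open>A set with a nonempty trace on \<open>H\<close> has one component more than that trace
  if it contains \<open>j > 0\<close> vertices of the edgeless side, and no surplus for
  \<open>j = 0\<close>; the surplus produces the second sum. A nonempty set inside the edgeless side
  is a single component and contributes 0.\<close>

lemma linear_count_join: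
  assumes H: "finite (verts H)" shows "linear_count (edgeless a \<nabla> H) (Suc i) =
    (\<Sum>j\<le>i. (a choose j) * linear_count H (Suc i - j)) +
    (\<Sum>j = 1..i. (a choose j) * (card (verts H) choose (Suc i - j)))"
proof -
  let ?f = "\<lambda>A B. card (co_comps (edgeless a \<nabla> H) (Inl ` A \<union> Inr ` B)) - 1"
  let ?g = "\<lambda>j. \<Sum>A | A \<subseteq> {1..a} \<and> card A = j. \<Sum>B | B \<subseteq> verts H \<and> card B = Suc i - j. ?f A B"
  have verts: "verts (edgeless a \<nabla> H) = Inl ` {1..a} \<union> Inr ` verts H"
    by (simp add: graph_join_def edgeless_def)
  have fin: "finite A" if "A \<subseteq> {1..a}" for A :: "nat set" using finite_subset[OF that] by simp
  have finH: "finite B" if "B \<subseteq> verts H" for B by (rule finite_subset[OF that H])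
  have f: "?f A B = card (co_comps (edgeless a) A) + card (co_comps H B) - 1"
    if "A \<subseteq> {1..a}" "B \<subseteq> verts H" for A B
    using card_co_comps_join[of A "edgeless a" B H] that fin[OF that(1)] finH[OF that(2)]
    by (simp add: edgeless_def)
  have card_A: "card {A. A \<subseteq> {1..a} \<and> card A = j} = a choose j" for j
    using n_subsets[of "{1..a}" j] by simp
  have card_B: "card {B. B \<subseteq> verts H \<and> card B = j} = card (verts H) choose j" for j
    by (rule n_subsets[OF H])
  have g: "?g j = (a choose j) * (linear_count H (Suc i - j) +
      (if j = 0 then 0 else card (verts H) choose (Suc i - j)))" if j: "j \<le> i" for j
  proof -
    have "?g j = (\<Sum>A | A \<subseteq> {1..a} \<and> card A = j. \<Sum>B | B \<subseteq> verts H \<and> card B = Suc i - j.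
      (card (co_comps H B) - 1) + (if j = 0 then 0 else 1))"
    proof (intro sum.cong refl)
      fix A B assume "A \<in> {A. A \<subseteq> {1..a} \<and> card A = j}" "B \<in> {B. B \<subseteq> verts H \<and> card B = Suc i - j}"
      then have A: "A \<subseteq> {1..a}" "card A = j" and B: "B \<subseteq> verts H" "card B = Suc i - j" by auto
      have "B \<noteq> {}" using B(2) j by auto
      \<comment> \<open>Positivity lets the truncated \<open>- 1\<close> be charged to the summand
        of \<open>H\<close>.\<close>
      then have "0 < card (co_comps H B)" by (rule card_co_comps_pos[OF finH[OF B(1)]])
      moreover have "card (co_comps (edgeless a) A) = (if j = 0 then 0 else 1)"
        using A fin[OF A(1)] card_co_comps_edgeless[of A a] by (cases "A = {}") auto
      ultimately show "?f A B = (card (co_comps H B) - 1) + (if j = 0 then 0 else 1)"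
        using f[OF A(1) B(1)] by simp
    qed
    also have "\<dots> = (\<Sum>A | A \<subseteq> {1..a} \<and> card A = j. linear_count H (Suc i - j) +
      (if j = 0 then 0 else card (verts H) choose (Suc i - j)))"
      unfolding linear_count_def by (subst sum.distrib) (simp add: card_B)
    also have "\<dots> = (a choose j) * (linear_count H (Suc i - j) +
      (if j = 0 then 0 else card (verts H) choose (Suc i - j)))" using card_A[of j] by simp
    finally show ?thesis .
  qed
  have last: "?g (Suc i) = 0"
  proof (intro sum.neutral ballI)
    fix A B assume A: "A \<in> {A. A \<subseteq> {1..a} \<and> card A = Suc i}" and "B \<in> {B. B \<subseteq> verts H \<and> card B = Suc i - Suc i}"
    then have B: "B \<subseteq> verts H" "B = {}" using finH[of B] by auto
    have "A \<noteq> {}" using A by auto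
    then show "?f A B = 0" using f[of A B] A B card_co_comps_edgeless[of A a] by simp
  qed
  have "linear_count (edgeless a \<nabla> H) (Suc i) = (\<Sum>j\<le>Suc i. ?g j)"
    unfolding linear_count_def verts by (rule sum_subsets_Plus[OF _ H]) simp
  also have "\<dots> = (\<Sum>j\<le>i. ?g j)" using last by simp
  also have "\<dots> = (\<Sum>j\<le>i. (a choose j) * linear_count H (Suc i - j) +
      (if j = 0 then 0 else (a choose j) * (card (verts H) choose (Suc i - j))))"
    by (intro sum.cong refl) (subst g, simp_all add: algebra_simps)
  also have "\<dots> = (\<Sum>j\<le>i. (a choose j) * linear_count H (Suc i - j)) +
      (\<Sum>j\<le>i. if j = 0 then 0 else (a choose j) * (card (verts H) choose (Suc i - j)))"
    by (rule sum.distrib)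
  also have "(\<Sum>j\<le>i. if j = 0 then 0 else (a choose j) * (card (verts H) choose (Suc i - j))) =
    (\<Sum>j = 1..i. (a choose j) * (card (verts H) choose (Suc i - j)))"
    by (rule sum.mono_neutral_cong_right) auto
  finally show ?thesis .
qed

text \<open>A single vertex is a single component. In the join formula this removes the term
  \<open>j = i\<close> of the first sum.\<close>

lemma linear_count_1: "linear_count G 1 = 0"
proof -
  have "card (co_comps G S) - 1 = 0" if "card S = 1" for S
    using that by (auto simp: card_1_singleton_iff co_comps_def)
  then show ?thesis by (simp add: linear_count_def)
qed

section \<open>Vertex sets in disjoint copies\<close>

lemma copies_edge:
  "{(k, x), (l, y)} \<in> edges (disjoint_copies n G) \<longleftrightarrow> k = l \<and> k \<in> {1..n} \<and> {x, y} \<in> edges G"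
proof
  assume "{(k, x), (l, y)} \<in> edges (disjoint_copies n G)"
  then obtain m e where m: "{(k, x), (l, y)} = Pair m ` e" "m \<in> {1..n}" "e \<in> edges G"
    by (auto simp: disjoint_copies_def)
  then have kl: "k = m" "l = m" by (metis (no_types, lifting) Pair_inject imageE insertCI)+
  then have "Pair m ` {x, y} = Pair m ` e" using m(1) by simp
  moreover have "inj (Pair m)" by (simp add: inj_on_def)
  ultimately have "{x, y} = e" using inj_image_eq_iff by metis
  then show "k = l \<and> k \<in> {1..n} \<and> {x, y} \<in> edges G" using m kl by simp
next
  assume *: "k = l \<and> k \<in> {1..n} \<and> {x, y} \<in> edges G"
  then have "{(k, x), (l, y)} = Pair k ` {x, y}" by auto
  then show "{(k, x), (l, y)} \<in> edges (disjoint_copies n G)"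
    unfolding disjoint_copies_def using * by (auto simp del: image_insert)
qed

text \<open>Vertices of different copies are non-adjacent, and two vertices of one copy are
  connected in the complement through any vertex of another. So sets meeting two copies contribute
  0, and each set within one copy contributes as in \<open>G\<close>.\<close>

lemma linear_count_copies:
  assumes G: "finite (verts G)" and s: "0 < s"
  shows "linear_count (disjoint_copies n G) s = n * linear_count G s"
proof -
  let ?W = "{S. S \<subseteq> {1..n} \<times> verts G \<and> card S = s}"
  let ?T = "{1..n} \<times> {A. A \<subseteq> verts G \<and> card A = s}"
  let ?p = "\<lambda>(k, A). Pair k ` A"
  let ?f = "\<lambda>S. card (co_comps (disjoint_copies n G) S) - 1"
  have fin: "finite ?W" by (rule finite_subset[of _ "Pow ({1..n} \<times> verts G)"]) (use G in auto)
  have inj: "inj_on ?p ?T"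
  proof (rule inj_onI)
    fix t t' assume t: "t \<in> ?T" "t' \<in> ?T" "?p t = ?p t'"
    obtain k A l B where kA: "t = (k, A)" "t' = (l, B)" by (cases t, cases t')
    have "A \<noteq> {}" using t(1) kA s by auto
    then have "k = l" using t(3) kA by auto
    moreover have "snd ` Pair k ` A = snd ` Pair l ` B" using t(3) kA by simp
    then have "A = B" by (simp add: image_image)
    ultimately show "t = t'" using kA by simp
  qed
  have sub: "?p ` ?T \<subseteq> ?W" by (auto simp: card_image inj_on_def)
  have zero: "?f S = 0" if S: "S \<in> ?W - ?p ` ?T" for S
  proof -
    have two: "\<exists>z\<in>S. fst z \<noteq> k" for k
    proof (rule ccontr)
      assume k: "\<not> ?thesis"
      then have "S = Pair k ` snd ` S" by force
      moreover have "card (snd ` S) = card S" by (rule card_image, rule inj_onI) (use k in \<open>auto simp: prod_eq_iff\<close>)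
      moreover have "snd ` S \<subseteq> verts G" using S by auto
      moreover have "k \<in> {1..n}"
      proof -
        have "S \<noteq> {}" using S s by auto
        then obtain z where "z \<in> S" by blast
        then have "z \<in> {1..n} \<times> verts G" "fst z = k" using S k by blast+
        then show ?thesis by auto
      qed
      ultimately have "S \<in> ?p ` ?T" using S by (intro image_eqI[of _ _ "(k, snd ` S)"]) auto
      then show False using S by simp
    qed
    have diff: "(u, v) \<in> (nonadj (disjoint_copies n G) S)\<^sup>*" if "u \<in> S" "v \<in> S" "fst u \<noteq> fst v" for u v
      using that copies_edge[of "fst u" "snd u" "fst v" "snd v" n G] by (auto simp: nonadj_def)
    have "(u, v) \<in> (nonadj (disjoint_copies n G) S)\<^sup>*" if "u \<in> S" "v \<in> S" for u v
    proof (cases "fst u = fst v")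
      case True
      obtain w where w: "w \<in> S" "fst w \<noteq> fst u" using two by blast
      then have "(u, w) \<in> (nonadj (disjoint_copies n G) S)\<^sup>*" "(w, v) \<in> (nonadj (disjoint_copies n G) S)\<^sup>*"
        using diff that True by simp_all
      then show ?thesis by (rule rtrancl_trans)
    qed (use diff that in blast)
    moreover have "S \<noteq> {}" using S s by auto
    ultimately show ?thesis using card_co_comps_connected[of S "disjoint_copies n G"] by simp
  qed
  have copy: "card (co_comps (disjoint_copies n G) (Pair k ` A)) = card (co_comps G A)"
    if k: "k \<in> {1..n}" for k A
  proof -
    define l where "l z = (nonadj G A)\<^sup>* `` {snd z}" for z :: "nat \<times> 'a"
    have "card (co_comps (disjoint_copies n G) (Pair k ` A)) = card (l ` Pair k ` A)"
    proof (rule card_co_comps)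
      fix u v assume "u \<in> Pair k ` A" "v \<in> Pair k ` A"
      then obtain x y where xy: "u = (k, x)" "v = (k, y)" "x \<in> A" "y \<in> A" by auto
      show "l u = l v" if "{u, v} \<notin> edges (disjoint_copies n G)"
      proof -
        have "(x, y) \<in> (nonadj G A)\<^sup>*" using that xy k copies_edge[of k x k y n G] by (auto simp: nonadj_def)
        then show ?thesis using xy by (simp add: l_def nonadj_rtrancl_eq)
      qed
      show "(u, v) \<in> (nonadj (disjoint_copies n G) (Pair k ` A))\<^sup>*" if "l u = l v"
      proof -
        have "(x, y) \<in> (nonadj G A)\<^sup>*" using that xy by (auto simp: l_def)
        then show ?thesis unfolding xy by (rule rtrancl_image) (auto simp: nonadj_def copies_edge)
      qed
    qed
    also have "l ` Pair k ` A = co_comps G A" by (simp add: l_def co_comps_def image_image)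
    finally show ?thesis .
  qed
  have "linear_count (disjoint_copies n G) s = (\<Sum>S\<in>?W. ?f S)"
    by (simp add: linear_count_def disjoint_copies_def)
  also have "\<dots> = (\<Sum>S\<in>?p ` ?T. ?f S)"
    by (rule sum.mono_neutral_right[OF fin sub]) (use zero in blast)
  also have "\<dots> = (\<Sum>t\<in>?T. ?f (?p t))" by (rule sum.reindex[OF inj, unfolded o_def])
  also have "\<dots> = (\<Sum>k\<in>{1..n}. \<Sum>A | A \<subseteq> verts G \<and> card A = s. ?f (Pair k ` A))"
    by (simp add: sum.cartesian_product case_prod_unfold)
  also have "\<dots> = (\<Sum>k\<in>{1..n}. linear_count G s)"
    unfolding linear_count_def by (intro sum.cong refl) (simp add: copy)
  finally show ?thesis by simp
qed

section \<open>The graph \<open>B\<^sub>b\<close>\<close>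

lemma B_edge [simp]:
  assumes "i \<in> {1..b}" "j \<in> {1..b}"
  shows "{Inl i, Inl j} \<in> edges (B_graph b) \<longleftrightarrow> i \<noteq> j"
    and "{Inr i, Inr j} \<in> edges (B_graph b) \<longleftrightarrow> i \<noteq> j"
    and "{Inl i, Inr j} \<in> edges (B_graph b) \<longleftrightarrow> i = j"
    and "{Inr i, Inl j} \<in> edges (B_graph b) \<longleftrightarrow> i = j"
  using assms by (auto simp: B_graph_def doubleton_eq_iff nat_neq_iff)

lemma B_no_loop [simp]: "{u} \<notin> edges (B_graph b)"
proof -
  have "{u} = {x, y} \<longleftrightarrow> x = u \<and> y = u" for x y by auto
  then show ?thesis by (auto simp: B_graph_def)
qed

text \<open>In a complete bipartite graph minus a matching, \<open>i\<close> and \<open>k\<close> on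
  one side have a common neighbour unless the other side is contained in \<open>{i, k}\<close>. If
  it equals \<open>{i, k}\<close>, a third vertex on the first side gives a path of length four;
  \<open>nB\<close> and \<open>nAB\<close> exclude the remaining cases. The maps \<open>f\<close>
  and \<open>g\<close> allow either clique to play the first side.\<close>

lemma bipartite_path:
  assumes f: "\<And>i j. i \<in> A \<Longrightarrow> j \<in> B \<Longrightarrow> i \<noteq> j \<Longrightarrow> (f i, g j) \<in> r\<^sup>*"
    and g: "\<And>i j. i \<in> A \<Longrightarrow> j \<in> B \<Longrightarrow> i \<noteq> j \<Longrightarrow> (g j, f i) \<in> r\<^sup>*"
    and nB: "\<And>x. B = {x} \<Longrightarrow> x \<notin> A" and nAB: "\<And>x y. x \<noteq> y \<Longrightarrow> B = {x, y} \<Longrightarrow> A \<noteq> {x, y}"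
    and ne: "B \<noteq> {}" and ik: "i \<in> A" "k \<in> A" shows "(f i, f k) \<in> r\<^sup>*"
proof (cases "i = k \<or> (\<exists>j\<in>B. j \<noteq> i \<and> j \<noteq> k)")
  case True
  then show ?thesis using f g ik by (blast intro: rtrancl_trans)
next
  case False
  then have "B \<subseteq> {i, k}" "i \<noteq> k" by auto
  moreover have "B \<noteq> {i}" "B \<noteq> {k}" using nB ik by auto
  ultimately have Bik: "B = {i, k}" using ne by auto
  obtain l where "l \<in> A" "l \<noteq> i" "l \<noteq> k" using nAB[OF \<open>i \<noteq> k\<close>] Bik ik by blast
  then have "(f i, g k) \<in> r\<^sup>*" "(g k, f l) \<in> r\<^sup>*" "(f l, g i) \<in> r\<^sup>*" "(g i, f k) \<in> r\<^sup>*"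
    using f g ik Bik \<open>i \<noteq> k\<close> by auto
  then show ?thesis by (blast intro: rtrancl_trans)
qed

context
  fixes b :: nat and A B :: "nat set"
  assumes A: "A \<subseteq> {1..b}" and B: "B \<subseteq> {1..b}"
begin

abbreviation "BV \<equiv> Inl ` A \<union> Inr ` B :: (nat + nat) set"

lemma nonadj_B: "(u, v) \<in> nonadj (B_graph b) BV \<longleftrightarrow>
    (case (u, v) of (Inl i, Inl j) \<Rightarrow> i = j \<and> i \<in> A | (Inr i, Inr j) \<Rightarrow> i = j \<and> i \<in> B
      | (Inl i, Inr j) \<Rightarrow> i \<noteq> j \<and> i \<in> A \<and> j \<in> B | (Inr i, Inl j) \<Rightarrow> i \<noteq> j \<and> i \<in> B \<and> j \<in> A)"
  using A B by (auto simp: nonadj_def subset_iff split: sum.splits)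

text \<open>Inside one clique there are no non-edges between distinct vertices, so every vertex is a
  component of its own.\<close>

lemma card_co_comps_B_empty:
  assumes "A = {} \<or> B = {}" shows "card (co_comps (B_graph b) BV) = card BV"
proof -
  have "card (co_comps (B_graph b) BV) = card ((\<lambda>x. x) ` BV)"
  proof (rule card_co_comps)
    fix x y assume "x \<in> BV" "y \<in> BV" "{x, y} \<notin> edges (B_graph b)"
    then have "(x, y) \<in> nonadj (B_graph b) BV" by (simp add: nonadj_def)
    then show "x = y" using assms unfolding nonadj_B by (cases x; cases y) auto
  qed auto
  then show ?thesis by simp
qed

lemma B_path:
  assumes "i \<in> A" "j \<in> B" "i \<noteq> j"
  shows "(Inl i, Inr j) \<in> (nonadj (B_graph b) BV)\<^sup>*" "(Inr j, Inl i) \<in> (nonadj (B_graph b) BV)\<^sup>*"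
  using assms by (auto simp: nonadj_B)

text \<open>The partner \<open>Inr x\<close> is adjacent to every other vertex of the set and so
  isolated in the complement, where the vertices other than \<open>Inl x\<close> and
  \<open>Inr x\<close> are all neighbours of \<open>Inl x\<close>.\<close>

lemma card_co_comps_B_Inl:
  assumes "A = {x}" "x \<in> B" shows "card (co_comps (B_graph b) BV) = 2"
proof (rule card_co_comps_two[of "Inr x" _ "{Inr x}" "Inl x"])
  show "u \<in> {Inr x} \<longleftrightarrow> v \<in> {Inr x}" if "(u, v) \<in> nonadj (B_graph b) BV" for u v
    using that assms unfolding nonadj_B by (cases u; cases v) auto
  show "(u, Inl x) \<in> (nonadj (B_graph b) BV)\<^sup>*" if "u \<in> BV - {Inr x}" for u
    using that assms B_path(2)[of x] by auto
qed (use assms in auto)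

lemma card_co_comps_B_Inr:
  assumes "B = {x}" "x \<in> A" shows "card (co_comps (B_graph b) BV) = 2"
proof (rule card_co_comps_two[of "Inl x" _ "{Inl x}" "Inr x"])
  show "u \<in> {Inl x} \<longleftrightarrow> v \<in> {Inl x}" if "(u, v) \<in> nonadj (B_graph b) BV" for u v
    using that assms unfolding nonadj_B by (cases u; cases v) auto
  show "(u, Inr x) \<in> (nonadj (B_graph b) BV)\<^sup>*" if "u \<in> BV - {Inl x}" for u
    using that assms B_path(1)[of _ x] by auto
qed (use assms in auto)

text \<open>The induced subgraph is a 4-cycle, whose complement consists of two disjoint
  edges.\<close>

lemma card_co_comps_B_2:
  assumes "A = {x, y}" "B = {x, y}" "x \<noteq> y" shows "card (co_comps (B_graph b) BV) = 2"
proof (rule card_co_comps_two[of "Inl x" _ "{Inl x, Inr y}" "Inl y"])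
  show "u \<in> {Inl x, Inr y} \<longleftrightarrow> v \<in> {Inl x, Inr y}"
    if "(u, v) \<in> nonadj (B_graph b) BV" for u v
    using that assms unfolding nonadj_B by (cases u; cases v) auto
  show "(u, Inl x) \<in> (nonadj (B_graph b) BV)\<^sup>*" if "u \<in> BV \<inter> {Inl x, Inr y}" for u
    using that assms B_path(2)[of x y] by auto
  show "(u, Inl y) \<in> (nonadj (B_graph b) BV)\<^sup>*" if "u \<in> BV - {Inl x, Inr y}" for u
    using that assms B_path(2)[of y x] by auto
qed (use assms in auto)

text \<open>Outside the exceptional shapes treated before, \<open>bipartite_path\<close> connects
  each side, and unmatched pairs connect the sides with each other.\<close>

lemma card_co_comps_B_connected:
  assumes ne: "A \<noteq> {}" "B \<noteq> {}"
    and nA: "\<And>x. A = {x} \<Longrightarrow> x \<notin> B" and nB: "\<And>x. B = {x} \<Longrightarrow> x \<notin> A"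
    and nAB: "\<And>x y. x \<noteq> y \<Longrightarrow> A = {x, y} \<Longrightarrow> B \<noteq> {x, y}"
  shows "card (co_comps (B_graph b) BV) = 1"
proof -
  let ?R = "(nonadj (B_graph b) BV)\<^sup>*"
  have ll: "(Inl i, Inl k) \<in> ?R" if "i \<in> A" "k \<in> A" for i k
  proof (rule bipartite_path[OF B_path _ _ ne(2) that])
    show "x \<notin> A" if "B = {x}" for x by (rule nB[OF that])
    show "A \<noteq> {x, y}" if "x \<noteq> y" "B = {x, y}" for x y using nAB[OF that(1)] that(2) by blast
  qed
  have rr: "(Inr i, Inr k) \<in> ?R" if "i \<in> B" "k \<in> B" for i k
  proof (rule bipartite_path[OF B_path(2,1) _ _ ne(1) that])
    show "x \<notin> B" if "A = {x}" for x by (rule nA[OF that])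
    show "B \<noteq> {x, y}" if "x \<noteq> y" "A = {x, y}" for x y by (rule nAB[OF that])
  qed auto
  have lr: "(Inl i, Inr j) \<in> ?R" if ij: "i \<in> A" "j \<in> B" for i j
  proof (cases "i = j")
    case True
    then obtain k where k: "k \<in> B" "k \<noteq> i" using nB ij by blast
    then have "(Inl i, Inr k) \<in> ?R" using B_path(1) ij by blast
    then show ?thesis using rr[OF k(1) ij(2)] by (rule rtrancl_trans)
  qed (use B_path(1) ij in blast)
  show ?thesis
  proof (rule card_co_comps_connected)
    fix u v assume "u \<in> BV" "v \<in> BV"
    then show "(u, v) \<in> ?R" using ll rr lr nonadj_rtrancl_sym[OF lr] by auto
  qed (use ne in auto)
qed

end

lemma card_subsets_containing:
  assumes W: "finite W" and x: "x \<in> W"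
  shows "card {B. B \<subseteq> W \<and> card B = Suc i \<and> x \<in> B} = (card W - 1) choose i"
proof -
  have "{B. B \<subseteq> W \<and> card B = Suc i \<and> x \<in> B} = insert x ` {B. B \<subseteq> W - {x} \<and> card B = i}" (is "?L = ?R")
  proof
    show "?L \<subseteq> ?R"
    proof
      fix B assume B: "B \<in> ?L"
      then have "finite B" using W finite_subset by auto
      then have "B = insert x (B - {x})" "card (B - {x}) = i" using B by auto
      then show "B \<in> ?R" using B by blast
    qed
    show "?R \<subseteq> ?L"
    proof
      fix B assume "B \<in> ?R"
      then obtain C where C: "B = insert x C" "C \<subseteq> W - {x}" "card C = i" by blast
      then have "finite C" "x \<notin> C" using W finite_subset by auto
      then show "B \<in> ?L" using C x by auto
    qed
  qed
  moreover have "inj_on (insert x) {B. B \<subseteq> W - {x} \<and> card B = i}"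
    by (rule inj_onI) (metis Diff_insert_absorb insert_Diff1 mem_Collect_eq subset_Diff_insert)
  ultimately show ?thesis using n_subsets[of "W - {x}" i] W x by (simp add: card_image)
qed

text \<open>Origin of \<open>lam\<close>: let \<open>j\<close> of the \<open>i + 1\<close> vertices
  lie in the first clique. Sets inside one clique (\<open>j = 0\<close>, \<open>j = i + 1\<close>)
  contribute \<open>i\<close> each. Sets with a single vertex in one clique (\<open>j = 1\<close>,
  \<open>j = i\<close>) contribute 1 if its partner is present, which leaves \<open>i - 1\<close>
  vertices of the other clique to choose. Two matched pairs contribute 1; they occur for
  \<open>i = 3\<close> only and add \<open>b choose 2\<close>.\<close>

lemma linear_count_B:
  assumes b: "3 \<le> b" and i: "1 \<le> i" shows "linear_count (B_graph b) (Suc i) = lam b i"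
proof -
  let ?W = "{1..b}"
  let ?P = "\<lambda>j. {A. A \<subseteq> ?W \<and> card A = j}"
  let ?f = "\<lambda>A B. card (co_comps (B_graph b) (Inl ` A \<union> Inr ` B)) - 1"
  let ?g = "\<lambda>j. \<Sum>A\<in>?P j. \<Sum>B\<in>?P (Suc i - j). ?f A B"
  have fin: "finite A" if "A \<subseteq> ?W" for A :: "nat set" using finite_subset[OF that] by simp
  have finP: "finite (?P j)" for j by (rule finite_subset[of _ "Pow ?W"]) auto
  have cardP: "card (?P j) = b choose j" for j using n_subsets[of ?W j] by simp
  have P1: "?P 1 = (\<lambda>x. {x}) ` ?W" by (auto simp: card_1_singleton_iff)
  have P0: "?P 0 = {{}}" using fin by auto
  have f_sing: "?f {x} B = (if x \<in> B then 1 else 0)" if "x \<in> ?W" "B \<subseteq> ?W" "B \<noteq> {}" for x B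
  proof (cases "x \<in> B")
    case True
    then show ?thesis using card_co_comps_B_Inl[of "{x}" b B x] that by simp
  next
    case False
    have "card (co_comps (B_graph b) (Inl ` {x} \<union> Inr ` B)) = 1"
      by (rule card_co_comps_B_connected) (use that False in auto)
    then show ?thesis using False by simp
  qed
  have f_sing': "?f A {x} = (if x \<in> A then 1 else 0)" if "x \<in> ?W" "A \<subseteq> ?W" "A \<noteq> {}" for x A
  proof (cases "x \<in> A")
    case True
    then show ?thesis using card_co_comps_B_Inr[of A b "{x}" x] that by simp
  next
    case False
    have "card (co_comps (B_graph b) (Inl ` A \<union> Inr ` {x})) = 1"
      by (rule card_co_comps_B_connected) (use that False in auto)
    then show ?thesis using False by simp
  qed
  have f_big: "?f A B = (if A = B \<and> card A = 2 then 1 else 0)"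
    if "A \<subseteq> ?W" "B \<subseteq> ?W" "2 \<le> card A" "2 \<le> card B" for A B
  proof (cases "A = B \<and> card A = 2")
    case True
    then obtain x y where "A = {x, y}" "x \<noteq> y" by (meson card_2_iff)
    then show ?thesis using card_co_comps_B_2[of A b B x y] True that by auto
  next
    case False
    have "card (co_comps (B_graph b) (Inl ` A \<union> Inr ` B)) = 1"
      by (rule card_co_comps_B_connected) (use that False in auto)
    then show ?thesis using False by auto
  qed
  have sing: "(\<Sum>A\<in>?P 1. \<Sum>B\<in>?P i. if A \<subseteq> B then 1 else 0) = b * ((b - 1) choose (i - 1))"
  proof -
    have "(\<Sum>B\<in>?P i. if {x} \<subseteq> B then 1 else 0) = (b - 1) choose (i - 1)" if x: "x \<in> ?W" for x
    proof -
      have "(\<Sum>B\<in>?P i. if {x} \<subseteq> B then 1 else 0) = card {B \<in> ?P i. x \<in> B}"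
        by (subst card_eq_sum, rule sum.mono_neutral_cong_right) (use finP in auto)
      also have "{B \<in> ?P i. x \<in> B} = {B. B \<subseteq> ?W \<and> card B = Suc (i - 1) \<and> x \<in> B}" using i by auto
      finally show ?thesis using card_subsets_containing[of ?W x "i - 1"] x by simp
    qed
    then show ?thesis unfolding P1 by (simp add: sum.reindex)
  qed
  have g0: "?g 0 = i * (b choose (i + 1))"
  proof -
    have "?f {} B = i" if "B \<in> ?P (Suc i)" for B
      using card_co_comps_B_empty[of "{}" b B] that by (simp add: card_image)
    then show ?thesis unfolding P0 using cardP[of "Suc i"] by simp
  qed
  have gS: "?g (Suc i) = i * (b choose (i + 1))"
  proof -
    have "?f A {} = i" if "A \<in> ?P (Suc i)" for A
      using card_co_comps_B_empty[of A b "{}"] that by (simp add: card_image)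
    then have "?g (Suc i) = (\<Sum>A\<in>?P (Suc i). i)" by (intro sum.cong refl) (use P0 in simp)
    then show ?thesis using cardP[of "Suc i"] by simp
  qed
  have g1: "?g 1 = b * ((b - 1) choose (i - 1))"
  proof -
    have "?g 1 = (\<Sum>A\<in>?P 1. \<Sum>B\<in>?P i. if A \<subseteq> B then 1 else 0)"
    proof (intro sum.cong)
      fix A B assume "A \<in> ?P 1" and B: "B \<in> ?P i"
      then obtain x where "A = {x}" "x \<in> ?W" unfolding P1 by blast
      moreover have "B \<noteq> {}" using B i by auto
      ultimately show "?f A B = (if A \<subseteq> B then 1 else 0)" using f_sing[of x B] B by simp
    qed (use i in simp_all)
    then show ?thesis using sing by simp
  qed
  have gi: "?g i = b * ((b - 1) choose (i - 1))"
  proof -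
    have "?g i = (\<Sum>A\<in>?P i. \<Sum>B\<in>?P 1. if B \<subseteq> A then 1 else 0)"
    proof (intro sum.cong)
      fix A B assume A: "A \<in> ?P i" and "B \<in> ?P 1"
      then obtain x where "B = {x}" "x \<in> ?W" unfolding P1 by blast
      moreover have "A \<noteq> {}" using A i by auto
      ultimately show "?f A B = (if B \<subseteq> A then 1 else 0)" using f_sing'[of x A] A by simp
    qed simp_all
    then show ?thesis using sing by (subst (asm) sum.swap) simp
  qed
  have gm: "?g j = (if i = 3 \<and> j = 2 then b choose 2 else 0)" if j: "2 \<le> j" "j < i" for j
  proof -
    have "?g j = (\<Sum>A\<in>?P j. \<Sum>B\<in>?P (Suc i - j). if A = B \<and> j = 2 then 1 else 0)"
    proof (intro sum.cong refl)
      fix A B assume "A \<in> ?P j" "B \<in> ?P (Suc i - j)"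
      then show "?f A B = (if A = B \<and> j = 2 then 1 else 0)" using f_big[of A B] j by auto
    qed
    also have "\<dots> = (if i = 3 \<and> j = 2 then b choose 2 else 0)"
    proof (cases "i = 3 \<and> j = 2")
      case True
      then have "(\<Sum>A\<in>?P j. \<Sum>B\<in>?P (Suc i - j). if A = B \<and> j = 2 then 1 else 0) = (\<Sum>A\<in>?P 2. (1 :: nat))"
        using finP[of 2] by (intro sum.cong) (auto simp: sum.delta)
      then show ?thesis using True cardP[of 2] by simp
    next
      case False
      have 0: "(\<Sum>A\<in>?P j. \<Sum>B\<in>?P (Suc i - j). if A = B \<and> j = 2 then 1 else 0) = (0 :: nat)"
        by (intro sum.neutral ballI) (use False j in auto)
      show ?thesis unfolding 0 using False by auto
    qed
    finally show ?thesis .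
  qed
  have "linear_count (B_graph b) (Suc i) = (\<Sum>j\<le>Suc i. ?g j)"
    unfolding linear_count_def by (simp add: B_graph_def sum_subsets_Plus del: sum.atMost_Suc)
  also have "\<dots> = lam b i"
  \<comment> \<open>For \<open>i = 1\<close> the cases \<open>j = 1\<close> and \<open>j = i\<close>
    coincide, whence \<open>b\<close> rather than \<open>2 * b\<close> in
    \<open>lam b 1\<close>.\<close>
  proof (cases "i = 1")
    case True
    have "(\<Sum>j\<le>Suc i. ?g j) = ?g 0 + ?g 1 + ?g (Suc i)" using True by simp
    moreover have "b choose Suc (Suc 0) = b choose 2" by (simp add: numeral_2_eq_2)
    ultimately show ?thesis unfolding g0 g1 gS using True b by (simp add: lam_def)
  next
    case False
    have "{..Suc i} = {0, 1, i, Suc i} \<union> {2..<i}" using i False by auto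
    then have "(\<Sum>j\<le>Suc i. ?g j) = (\<Sum>j\<in>{0, 1, i, Suc i}. ?g j) + (\<Sum>j\<in>{2..<i}. ?g j)"
      by (simp only:) (rule sum.union_disjoint; auto)
    also have "(\<Sum>j\<in>{0, 1, i, Suc i}. ?g j) = ?g 0 + ?g 1 + ?g i + ?g (Suc i)"
      using i False by simp
    also have "\<dots> = 2 * i * (b choose (i + 1)) + 2 * b * ((b - 1) choose (i - 1))"
      unfolding g0 g1 gi gS by simp
    also have "(\<Sum>j\<in>{2..<i}. ?g j) = (\<Sum>j\<in>{2..<i}. if j = 2 then if i = 3 then b choose 2 else 0 else 0)"
      by (intro sum.cong refl) (simp only: gm atLeastLessThan_iff, auto)
    also have "\<dots> = (if i = 3 then b choose 2 else 0)" by (simp add: sum.delta)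
    finally have "(\<Sum>j\<le>Suc i. ?g j) = 2 * i * (b choose (i + 1)) + 2 * b * ((b - 1) choose (i - 1)) +
      (if i = 3 then b choose 2 else 0)" .
    also have "\<dots> = lam b i"
    \<comment> \<open>Beyond this range both binomial coefficients vanish, and
      \<open>3 \<le> b\<close> keeps \<open>i = 3\<close> inside it.\<close>
    proof (cases "i > 2 * b - 2")
      case True
      then show ?thesis using b by (simp add: lam_def binomial_eq_0)
    next
      case False
      then show ?thesis using i \<open>i \<noteq> 1\<close> by (simp add: lam_def)
    qed
    finally show ?thesis .
  qed
  finally show ?thesis .
qed

section \<open>Simplicity of the graphs and the final count\<close>

lemma simple_graph_join:
  assumes "simple_graph G" "simple_graph H" shows "simple_graph (G \<nabla> H)"
proof
  interpret G: simple_graph G by fact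
  interpret H: simple_graph H by fact
  show "finite (verts (G \<nabla> H))" using G.finite_verts H.finite_verts by (simp add: graph_join_def)
  fix e assume "e \<in> edges (G \<nabla> H)"
  then consider f where "e = Inl ` f" "f \<in> edges G" | f where "e = Inr ` f" "f \<in> edges H"
    | u v where "e = {Inl u, Inr v}" "u \<in> verts G" "v \<in> verts H"
    by (auto simp: graph_join_def)
  then show "\<exists>x y. x \<noteq> y \<and> e = {x, y} \<and> x \<in> verts (G \<nabla> H) \<and> y \<in> verts (G \<nabla> H)"
    using G.edgesD H.edgesD by cases (fastforce simp: graph_join_def)+
qed

lemma simple_graph_copies:
  assumes "simple_graph G" shows "simple_graph (disjoint_copies n G)"
proof
  interpret G: simple_graph G by fact
  show "finite (verts (disjoint_copies n G))" using G.finite_verts by (simp add: disjoint_copies_def)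
  fix e assume "e \<in> edges (disjoint_copies n G)"
  then obtain k f where k: "e = Pair k ` f" "k \<in> {1..n}" "f \<in> edges G" by (auto simp: disjoint_copies_def)
  then obtain x y where "x \<noteq> y" "f = {x, y}" "x \<in> verts G" "y \<in> verts G" using G.edgesD by blast
  then show "\<exists>x y. x \<noteq> y \<and> e = {x, y} \<and> x \<in> verts (disjoint_copies n G) \<and> y \<in> verts (disjoint_copies n G)"
    using k by (intro exI[of _ "(k, x)"] exI[of _ "(k, y)"]) (auto simp: disjoint_copies_def)
qed

lemma simple_graph_edgeless: "simple_graph (edgeless a)" by unfold_locales (auto simp: edgeless_def)

lemma simple_graph_B: "simple_graph (B_graph b)"
proof
  show "finite (verts (B_graph b))" by (simp add: B_graph_def)
  fix e assume "e \<in> edges (B_graph b)"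
  then consider i j where "e = {Inl i, Inl j}" "1 \<le> i" "i < j" "j \<le> b"
    | i j where "e = {Inr i, Inr j}" "1 \<le> i" "i < j" "j \<le> b"
    | i where "e = {Inl i, Inr i}" "1 \<le> i" "i \<le> b" by (auto simp: B_graph_def)
  then show "\<exists>x y. x \<noteq> y \<and> e = {x, y} \<and> x \<in> verts (B_graph b) \<and> y \<in> verts (B_graph b)"
  proof cases
    case (1 i j)
    then show ?thesis by (intro exI[of _ "Inl i"] exI[of _ "Inl j"]) (auto simp: B_graph_def)
  next
    case (2 i j)
    then show ?thesis by (intro exI[of _ "Inr i"] exI[of _ "Inr j"]) (auto simp: B_graph_def)
  next
    case (3 i)
    then show ?thesis by (intro exI[of _ "Inl i"] exI[of _ "Inr i"]) (auto simp: B_graph_def)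
  qed
qed

theorem theorem4p6:
  fixes a n b i :: nat
  assumes "a \<ge> 1" and "n \<ge> 1" and "b \<ge> 3" and "i \<ge> 1"
  shows "graph_betti TYPE('k::field) (edgeless a \<nabla> disjoint_copies n (B_graph b)) i (int i + 1) =
    n * (\<Sum>j = 0..i - 1. (a choose j) * lam b (i - j)) +
    (\<Sum>j = 1..i. (a choose j) * ((2 * b * n) choose (i - j + 1)))"
proof -
  let ?H = "disjoint_copies n (B_graph b)"
  obtain m where m: "i = Suc m" using assms(4) by (cases i) auto
  interpret H: simple_graph ?H by (rule simple_graph_copies[OF simple_graph_B])
  interpret G: simple_graph "edgeless a \<nabla> ?H"
    by (rule simple_graph_join[OF simple_graph_edgeless H.simple_graph_axioms])
  have finB: "finite (verts (B_graph b))" by (simp add: B_graph_def)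
  have cardH: "card (verts ?H) = 2 * b * n"
  proof -
    have "card (verts (B_graph b)) = b + b"
      unfolding B_graph_def by (simp, subst card_Un_disjoint) (auto simp: card_image)
    then show ?thesis by (simp add: disjoint_copies_def card_cartesian_product)
  qed
  have H: "linear_count ?H (Suc i - j) = n * lam b (i - j)" if "j \<le> m" for j
  proof -
    have "Suc i - j = Suc (i - j)" using that m by simp
    then show ?thesis
      using linear_count_copies[OF finB, of "Suc (i - j)" n] linear_count_B[OF assms(3), of "i - j"] that m
      by simp
  qed
  have "graph_betti TYPE('k) (edgeless a \<nabla> ?H) i (int i + 1) = linear_count (edgeless a \<nabla> ?H) (Suc i)"
  proof -
    \<comment> \<open>With \<open>i = Suc m\<close>, the internal degree \<open>i + 1\<close>
      belongs to vertex sets of size \<open>m + 2 = Suc i\<close>.\<close>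
    have "int i + 1 = int m + 2" using m by simp
    then show ?thesis using G.linear_betti[where 'k = 'k, of m] by (simp only: m linear_count_def) simp
  qed
  also have "\<dots> = (\<Sum>j\<le>i. (a choose j) * linear_count ?H (Suc i - j)) +
    (\<Sum>j = 1..i. (a choose j) * (2 * b * n choose (Suc i - j)))"
    using linear_count_join[OF H.finite_verts, of a i] by (simp only: cardH)
  also have "(\<Sum>j\<le>i. (a choose j) * linear_count ?H (Suc i - j)) =
    (\<Sum>j\<le>m. (a choose j) * linear_count ?H (Suc i - j))"
    using linear_count_1[of ?H] by (simp add: m)
  also have "\<dots> = (\<Sum>j\<le>m. n * ((a choose j) * lam b (i - j)))"
    by (intro sum.cong refl) (use H in simp)
  also have "\<dots> = n * (\<Sum>j = 0..i - 1. (a choose j) * lam b (i - j))"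
    by (simp add: sum_distrib_left m atLeast0AtMost)
  also have "(\<Sum>j = 1..i. (a choose j) * (2 * b * n choose (Suc i - j))) =
    (\<Sum>j = 1..i. (a choose j) * ((2 * b * n) choose (i - j + 1)))"
    by (intro sum.cong refl) (simp add: Suc_diff_le)
  finally show ?thesis .
qed

end
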